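(* Let $p\geq 3$ be a prime, let $n,d$ be positive integers, $G:=\mathbf{F}_p^n$, $s\ge 0$ an integer, $R\in\mathbf{N}$, and let $Q_1,\dots,Q_s:\mathbf{F}_p^d\to\mathbf{F}_p$ be quadratic functions satisfying $$\min_{(0,\dots,0)\neq (\lambda_1,\dots,\lambda_s)\in\mathbf{F}_p^s}\operatorname{rank}(\lambda_1Q_1+\dots+\lambda_sQ_s)\geq R$$ (a vacuous condition when $s=0$). Set $Z:=Q_1^{-1}(0)\cap\dots\cap Q_s^{-1}(0)$ when $s\geq 1$ and $Z:=\mathbf{F}_p^d$ when $s=0$. Assume that $0<\varepsilon<2^{-160}p^{-16}$ and $R\geq 2^{20}(s+\log_p(\varepsilon^{-1}))$. If $\psi:Z\to G$ is $(1-\varepsilon)$-approximately quadratic, then there exists a quadratic map $Q:\mathbf{F}_p^d\to G$ with $\psi(x)=Q(x)$ for at least a $(1-2^{10}\sqrt[16]{\varepsilon})$-proportion of $x\in Z$.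
   Context: For abelian groups $H,H'$, a function $\phi:H\to H'$ and $h\in H$, $\partial_h\phi(x):=\phi(x)-\phi(x+h)$ and $\partial_{h_1,\dots,h_k}:=\partial_{h_1}\cdots\partial_{h_k}$. A map $Q$ from a finite-dimensional $\mathbf{F}_p$-vector space to $\mathbf{F}_p$ or to $G$ is quadratic if $\partial_{h_1,h_2,h_3}Q(x)=0$ for all $x,h_1,h_2,h_3$ (equivalently, it is polynomial of degree at most $2$). A quadratic function $Q:\mathbf{F}_p^d\to\mathbf{F}_p$ ($p$ odd) has the form $Q(x)=x^TMx+z\cdot x+c$ with $M$ a symmetric $d\times d$ matrix, $z\in\mathbf{F}_p^d$, $c\in\mathbf{F}_p$; its rank is the rank of $M$. For a subset $A$ of a finite abelian group $H$ and an abelian group $H'$, a function $\phi:A\to H'$ is $\delta$-approximately quadratic (on $A$) if, among all tuples $(x,h_1,h_2,h_3)\in H^4$ such that $x+\omega\cdot(h_1,h_2,h_3)\in A$ for all $\omega\in\{0,1\}^3$, the proportion satisfying $$\sum_{\omega\in\{0,1\}^3}(-1)^{|\omega|}\phi(x+\omega\cdot(h_1,h_2,h_3))=0$$ is at least $\delta$, where $|\omega|$ is the number of $1$'s in $\omega$ and $\omega\cdot(h_1,h_2,h_3)=\omega_1h_1+\omega_2h_2+\omega_3h_3$. Here this is applied with $H=\mathbf{F}_p^d$ and $A=Z$. *)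

theory Defs
  imports "HOL-Analysis.Analysis" "Berlekamp_Zassenhaus.Finite_Field"
begin

text \<open>
  The field of \<open>p\<close> elements is \<^typ>\<open>'p::prime_card mod_ring\<close> with \<open>p = CARD('p)\<close>, and its \<open>d\<close>-th
  power is \<^typ>\<open>('p::prime_card mod_ring)^'d\<close> with \<open>d = CARD('d) \<ge> 1\<close>.
\<close>

text \<open>The sign convention is \<open>\<phi>(x) - \<phi>(x + h)\<close>.\<close>

definition mult_diff :: "'h::ab_group_add \<Rightarrow> ('h \<Rightarrow> 'k::ab_group_add) \<Rightarrow> 'h \<Rightarrow> 'k" where
  "mult_diff h \<phi> = (\<lambda>x. \<phi> x - \<phi> (x + h))"

definition quadratic :: "('h::ab_group_add \<Rightarrow> 'k::ab_group_add) \<Rightarrow> bool" where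
  "quadratic Q \<longleftrightarrow> (\<forall>h1 h2 h3 x. mult_diff h1 (mult_diff h2 (mult_diff h3 Q)) x = 0)"

definition represents_quadratic ::
    "'a::field^'d^'d \<Rightarrow> 'a^'d \<Rightarrow> 'a \<Rightarrow> ('a^'d \<Rightarrow> 'a) \<Rightarrow> bool" where
  "represents_quadratic M z c Q \<longleftrightarrow>
     transpose M = M \<and> (\<forall>x. Q x = scalar_product x (M *v x) + scalar_product z x + c)"

text \<open>
  Meaningful for quadratic \<open>Q\<close> over a prime field of odd order; there the symmetric matrix is
  unique, see \<open>quad_rank_eq\<close> below.
\<close>

definition quad_rank :: "('a::field^'d \<Rightarrow> 'a) \<Rightarrow> nat" where
  "quad_rank Q = rank (THE M. \<exists>z c. represents_quadratic M z c Q)"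

lemma represents_quadratic_polarisation:
  fixes M :: "'a::field^'d^'d"
  assumes "represents_quadratic M z c Q"
  shows "Q (axis i 1 + axis j 1) - Q (axis i 1) - Q (axis j 1) + Q 0 = 2 * M $ i $ j"
proof -
  have sp: "scalar_product (axis k 1) v = v $ k" for k and v :: "'a^'d"
    by (simp add: scalar_product_def axis_def if_distrib if_distribR cong: if_cong)
  have add1: "scalar_product (u + v) w = scalar_product u w + scalar_product v w"
    for u v w :: "'a^'d"
    by (simp add: scalar_product_def distrib_right sum.distrib)
  have add2: "scalar_product w (u + v) = scalar_product w u + scalar_product w v"
    for u v w :: "'a^'d"
    by (simp add: scalar_product_def distrib_left sum.distrib)
  have mv: "(M *v axis k 1) $ l = M $ l $ k" for k l
    by (simp add: matrix_vector_mult_def axis_def if_distrib if_distribR cong: if_cong)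
  have zero: "scalar_product 0 v = 0" "scalar_product v 0 = 0" for v :: "'a^'d"
    by (simp_all add: scalar_product_def)
  have "M $ j $ i = transpose M $ i $ j"
    by (simp add: transpose_def)
  then have sym: "M $ j $ i = M $ i $ j"
    using assms by (simp add: represents_quadratic_def)
  have Q: "Q x = scalar_product x (M *v x) + scalar_product z x + c" for x
    using assms by (simp add: represents_quadratic_def)
  show ?thesis
    by (simp add: Q add1 add2 sp mv zero sym matrix_vector_right_distrib)
qed

lemma quad_rank_eq:
  fixes M :: "'a::field^'d^'d"
  assumes "represents_quadratic M z c Q" and "(2::'a) \<noteq> 0"
  shows "quad_rank Q = rank M"
proof -
  have "N = M" if "represents_quadratic N z' c' Q" for N :: "'a^'d^'d" and z' c'
  proof -
    have "2 * N $ i $ j = 2 * M $ i $ j" for i j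
      using represents_quadratic_polarisation[OF that, of i j]
        represents_quadratic_polarisation[OF assms(1), of i j] by metis
    with assms(2) show ?thesis
      by (simp add: vec_eq_iff)
  qed
  with assms(1) have "(THE M. \<exists>z c. represents_quadratic M z c Q) = M"
    by blast
  then show ?thesis
    by (simp add: quad_rank_def)
qed

text \<open>Equal to the whole space when \<open>s = 0\<close>.\<close>

definition common_zeros :: "nat \<Rightarrow> (nat \<Rightarrow> 'h \<Rightarrow> 'a::zero) \<Rightarrow> 'h set" where
  "common_zeros s Q = {x. \<forall>i<s. Q i x = 0}"

definition proportion :: "'t set \<Rightarrow> ('t \<Rightarrow> bool) \<Rightarrow> real" where
  "proportion S P = real (card {t \<in> S. P t}) / real (card S)"

text \<open>A vector \<open>\<omega> \<in> {0,1}\<^sup>3\<close> is a triple of booleans, \<open>True\<close> standing for 1.\<close>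

type_synonym cube3 = "bool \<times> bool \<times> bool"

fun weight :: "cube3 \<Rightarrow> nat" where
  "weight (a, b, c) = of_bool a + of_bool b + of_bool c"

fun cube_point :: "'h::ab_group_add \<times> 'h \<times> 'h \<times> 'h \<Rightarrow> cube3 \<Rightarrow> 'h" where
  "cube_point (x, h1, h2, h3) (a, b, c) =
     x + ((if a then h1 else 0) + (if b then h2 else 0) + (if c then h3 else 0))"

definition cubes_in :: "'h::ab_group_add set \<Rightarrow> ('h \<times> 'h \<times> 'h \<times> 'h) set" where
  "cubes_in A = {t. \<forall>\<omega>. cube_point t \<omega> \<in> A}"

definition cube_alternating_sum ::
    "('h::ab_group_add \<Rightarrow> 'k::ab_group_add) \<Rightarrow> 'h \<times> 'h \<times> 'h \<times> 'h \<Rightarrow> 'k" where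
  "cube_alternating_sum \<phi> t =
     (\<Sum>\<omega>\<in>UNIV. if even (weight \<omega>) then \<phi> (cube_point t \<omega>) else - \<phi> (cube_point t \<omega>))"

text \<open>Only the values of \<open>\<phi>\<close> on \<open>A\<close> matter, so maps defined on \<open>A\<close> are taken to be total.\<close>

definition approx_quadratic_on ::
    "real \<Rightarrow> 'h::{finite, ab_group_add} set \<Rightarrow> ('h \<Rightarrow> 'k::ab_group_add) \<Rightarrow> bool" where
  "approx_quadratic_on \<delta> A \<phi> \<longleftrightarrow>
     proportion (cubes_in A) (\<lambda>t. cube_alternating_sum \<phi> t = 0) \<ge> \<delta>"

end

theory Submission
  imports Defs "HOL-Library.Function_Algebras"
begin

text \<open>
  Write \<open>V\<close> for the space, \<open>N\<close> for its size, \<open>q = p\<^sup>s\<close>, and \<open>\<beta>\<^sub>i(h, x)\<close> for the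
  polarisation of the \<open>i\<close>-th quadratic. The proof differentiates \<open>\<psi>\<close> once, repairs the derivatives
  so that they fit together, and integrates them.

  For a fixed shift \<open>h\<close> consider \<open>\<phi>\<^sub>h(x) = \<psi>(x + h) - \<psi>(x)\<close> on the slice \<open>Z \<inter> (Z - h)\<close>. A cube in
  \<open>Z\<close> with one side \<open>h\<close> is an additive quadruple in this slice, so for most \<open>h\<close> the function
  \<open>\<phi>\<^sub>h\<close> respects most additive quadruples. Linearity testing (\<open>linearity_testing\<close>, transferred to
  pseudorandom subsets of a group in \<open>affine_testing\<close>) shows that \<open>\<phi>\<^sub>h\<close> agrees with an affine map
  \<open>M\<^sub>h + t\<^sub>h\<close> on most of the slice (\<open>derivatives_affine\<close>). Differences of points of the slice lie in
  the common kernel of the functionals \<open>\<beta>\<^sub>i(h, \<cdot>)\<close>, so \<open>M\<^sub>h\<close> is determined there only, that is,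
  up to adding \<open>\<Sum>\<^sub>i \<beta>\<^sub>i(h, \<cdot>) c\<^sub>i\<close>.

  Because \<open>\<phi>\<close> satisfies \<open>\<phi>\<^sub>h\<^sub>+\<^sub>k(x) = \<phi>\<^sub>h(x) + \<phi>\<^sub>k(x + h)\<close>, the additive map
  \<open>M\<^sub>h\<^sub>+\<^sub>k - M\<^sub>h - M\<^sub>k\<close> is constant on most of \<open>Z \<inter> (Z - h) \<inter> (Z - h - k)\<close> for most pairs. Were one of
  its coordinates independent of the functionals \<open>\<beta>\<^sub>i(h, \<cdot>)\<close> and \<open>\<beta>\<^sub>i(k, \<cdot>)\<close>, it would take each
  value on about a \<open>1/p\<close> fraction of that set; so
  \<open>M\<^sub>h\<^sub>+\<^sub>k = M\<^sub>h + M\<^sub>k + \<Sum>\<^sub>i (\<beta>\<^sub>i(h, \<cdot>) A\<^sub>i(h, k) + \<beta>\<^sub>i(k, \<cdot>) A'\<^sub>i(h, k))\<close>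
  (\<open>composable_imp_correction\<close>). Linear independence of the \<open>\<beta>\<^sub>i\<close> at generic shifts
  lets one compare coefficients: commutativity gives \<open>A'(h, k) = A(k, h)\<close>, associativity gives
  \<open>A(u, v) + A(u + v, w) = A(u, v + w)\<close>. Hence \<open>A(h, k) = c(h + k) - c(h)\<close> with
  \<open>c(h) = A(u, h - u)\<close> for a well chosen \<open>u\<close>, and subtracting \<open>\<Sum>\<^sub>i \<beta>\<^sub>i(h, \<cdot>) c\<^sub>i(h)\<close> from
  \<open>M\<^sub>h\<close> makes it additive in \<open>h\<close> for most pairs (\<open>corrected_additive\<close>). A second use of linearity
  testing, with values in a group of functions, replaces it by a bilinear map \<open>B\<close>; on the slice of
  \<open>h\<close> the subtracted term is a constant, so \<open>\<phi>\<^sub>h(x) = B(h, x) + t(h)\<close> for most pairs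
  (\<open>derivatives_bilinear\<close>). The same identity for \<open>\<phi>\<close> forces
  \<open>t(h + k) = t(h) + t(k) + B(k, h)\<close>; so \<open>B\<close> is symmetric, \<open>t(h) - B(h, h)/2\<close> is additive for most
  pairs, and a third use of linearity testing gives an additive \<open>L\<close>. Then
  \<open>F(x) = B(x, x)/2 + L(x)\<close> has the derivatives of \<open>\<psi>\<close> for most pairs in \<open>Z\<^sup>2\<close>, and
  \<open>\<psi> - F\<close> is constant on most of \<open>Z\<close> (\<open>agrees_with_quadratic\<close>).

  Passing between statements about most points of \<open>Z\<close> and about most shifts in \<open>V\<close> rests on one
  equidistribution estimate: \<open>Z\<close> meets the common level sets of \<open>k\<close> independent additive functionals
  in about \<open>N / (q p\<^sup>k)\<close> points, by Weyl differencing and the rank hypothesis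
  (\<open>equidistribution\<close>, \<open>count_Z\<close>). The shifts for which the \<open>\<beta>\<^sub>i\<close> fail to be independent are rare
  for the same reason. All losses are linear in \<open>\<epsilon>\<close> and total less than \<open>2\<^sup>2\<^sup>1 \<epsilon>\<close>, which is far
  below \<open>2\<^sup>1\<^sup>0 \<epsilon>\<^sup>1\<^sup>/\<^sup>1\<^sup>6\<close> in the given range.
\<close>

text \<open>
  The additive functions meant here are group homomorphisms; the plain name \<open>additive\<close> denotes the
  finite additivity of set functions once measure theory is loaded.
\<close>

abbreviation additive_map :: "('a::ab_group_add \<Rightarrow> 'b::ab_group_add) \<Rightarrow> bool" where
  "additive_map \<equiv> Modules.additive"

lemmas additive_map_def = Modules.additive_def
  and additive_map_add = Modules.additive.add
  and additive_map_zero = Modules.additive.zero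
  and additive_map_diff = Modules.additive.diff
  and additive_map_sum = Modules.additive.sum

section \<open>Additive characters and exponential sums\<close>

definition additive_char :: "'p::prime_card mod_ring \<Rightarrow> complex" where
  "additive_char a = cis (2 * pi * real_of_int (to_int_mod_ring a) / real CARD('p))"

lemma additive_char_add:
  fixes a b :: "'p::prime_card mod_ring"
  shows "additive_char (a + b) = additive_char a * additive_char b"
proof -
  let ?p = "real CARD('p)"
  define k where "k = (to_int_mod_ring a + to_int_mod_ring b) div int CARD('p)"
  have "to_int_mod_ring (a + b) = (to_int_mod_ring a + to_int_mod_ring b) mod int CARD('p)"
    by transfer simp
  also have "\<dots> = to_int_mod_ring a + to_int_mod_ring b - int CARD('p) * k"
    by (simp add: k_def minus_div_mult_eq_mod [symmetric])
  finally have "real_of_int (to_int_mod_ring (a + b)) =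
      real_of_int (to_int_mod_ring a) + real_of_int (to_int_mod_ring b) - ?p * real_of_int k"
    by simp
  note eq = this
  have "2 * pi * real_of_int (to_int_mod_ring (a + b)) / ?p =
     2 * pi * real_of_int (to_int_mod_ring a) / ?p + 2 * pi * real_of_int (to_int_mod_ring b) / ?p
      - 2 * pi * real_of_int k"
    unfolding eq by (simp add: field_simps)
  moreover have "cis (2 * pi * real_of_int k) = 1"
    by (rule cis_multiple_2pi) simp
  ultimately show ?thesis
    by (simp add: additive_char_def cis_mult [symmetric] cis_divide [symmetric])
qed

lemma additive_char_0 [simp]: "additive_char (0::'p::prime_card mod_ring) = 1"
  by (simp add: additive_char_def to_int_mod_ring.rep_eq zero_mod_ring.rep_eq)

lemma norm_additive_char [simp]: "norm (additive_char a) = 1"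
  by (simp add: additive_char_def)

lemma additive_char_minus: "additive_char (- a) = cnj (additive_char a)"
proof -
  have "additive_char (- a) * additive_char a = 1"
    by (simp add: additive_char_add [symmetric])
  moreover have "cnj (additive_char a) * additive_char a = 1"
    by (simp add: additive_char_def cis_cnj cis_mult)
  ultimately show ?thesis
    by (metis (no_types) mult.assoc mult.commute mult.right_neutral)
qed

lemma additive_char_ne_1:
  fixes a :: "'p::prime_card mod_ring"
  assumes "a \<noteq> 0"
  shows "additive_char a \<noteq> 1"
proof
  assume "additive_char a = 1"
  then have "cos (2 * pi * real_of_int (to_int_mod_ring a) / real CARD('p)) = 1"
    by (metis additive_char_def cis.sel(1) one_complex.sel(1))
  then obtain n :: int where n: "2 * pi * real_of_int (to_int_mod_ring a) / real CARD('p) = real_of_int n * 2 * pi"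
    using cos_one_2pi_int by auto
  then have "real_of_int (to_int_mod_ring a) = real_of_int n * real CARD('p)"
    by (simp add: field_simps)
  then have eq: "to_int_mod_ring a = n * int CARD('p)"
    by (metis of_int_eq_iff of_int_mult of_int_of_nat_eq)
  have r: "to_int_mod_ring a \<in> {0..<int CARD('p)}"
    by (metis range_to_int_mod_ring rangeI)
  moreover have "to_int_mod_ring a \<noteq> 0"
    using assms by transfer
  ultimately have "0 < to_int_mod_ring a" "to_int_mod_ring a < int CARD('p)"
    unfolding atLeastLessThan_iff by linarith+
  then have "0 < n * int CARD('p)" "n * int CARD('p) < int CARD('p)"
    by (simp_all only: eq)
  show False
  proof -
    have "0 < n"
      using \<open>0 < n * int CARD('p)\<close> by (simp add: zero_less_mult_iff)
    then have "1 * int CARD('p) \<le> n * int CARD('p)"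
      by (intro mult_right_mono) auto
    with \<open>n * int CARD('p) < int CARD('p)\<close> show False
      by simp
  qed
qed

lemma sum_UNIV_shift:
  fixes f :: "'v::{finite, ab_group_add} \<Rightarrow> 'b::comm_monoid_add"
  shows "(\<Sum>x\<in>UNIV. f (x + h)) = (\<Sum>x\<in>UNIV. f x)"
  by (rule sum.reindex_bij_witness[of _ "\<lambda>x. x - h" "\<lambda>x. x + h"]) auto

lemma sum_additive_char_additive:
  fixes \<alpha> :: "'v::{finite, ab_group_add} \<Rightarrow> 'p::prime_card mod_ring"
  assumes "additive_map \<alpha>"
  shows "(\<Sum>x\<in>UNIV. additive_char (\<alpha> x)) = (if \<forall>x. \<alpha> x = 0 then of_nat CARD('v) else 0)"
proof (cases "\<forall>x. \<alpha> x = 0")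
  case False
  then obtain h where h: "\<alpha> h \<noteq> 0" by auto
  let ?S = "\<Sum>x\<in>UNIV. additive_char (\<alpha> x)"
  have "?S = (\<Sum>x\<in>UNIV. additive_char (\<alpha> (x + h)))"
    by (rule sum_UNIV_shift [symmetric])
  also have "\<dots> = additive_char (\<alpha> h) * ?S"
    by (simp add: additive_map_add[OF assms] additive_char_add sum_distrib_left mult.commute)
  finally show ?thesis
    using additive_char_ne_1[OF h] False by simp
qed simp

text \<open>
  Fourier inversion on a power of the field: averaging over all coefficient vectors \<open>l\<close> detects the
  simultaneous vanishing of the values \<open>y j\<close>.
\<close>

lemma sum_additive_char_PiE:
  fixes y :: "'j \<Rightarrow> 'p::prime_card mod_ring"
  assumes "finite J"
  shows "(\<Sum>l\<in>J \<rightarrow>\<^sub>E UNIV. additive_char (\<Sum>j\<in>J. l j * y j)) =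
           (if \<forall>j\<in>J. y j = 0 then of_nat (CARD('p) ^ card J) else 0)"
proof -
  have prod: "additive_char (\<Sum>j\<in>K. g j) = (\<Prod>j\<in>K. additive_char (g j))" if "finite K" for K and g :: "'j \<Rightarrow> 'p mod_ring"
    using that by (induction K rule: finite_induct) (auto simp: additive_char_add)
  have "(\<Sum>l\<in>J \<rightarrow>\<^sub>E UNIV. additive_char (\<Sum>j\<in>J. l j * y j)) =
      (\<Sum>l\<in>J \<rightarrow>\<^sub>E UNIV. \<Prod>j\<in>J. additive_char (l j * y j))"
    by (simp add: prod assms)
  also have "\<dots> = (\<Prod>j\<in>J. \<Sum>a\<in>UNIV. additive_char (a * y j))"
    by (subst prod_sum_PiE) (auto simp: assms)
  also have "\<dots> = (\<Prod>j\<in>J. if y j = 0 then of_nat CARD('p) else 0)"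
  proof (rule prod.cong[OF refl])
    fix j
    have "additive_map (\<lambda>a. a * y j)"
      by (simp add: additive_map_def distrib_right)
    moreover have "(\<forall>a. a * y j = 0) \<longleftrightarrow> y j = 0"
      by (metis mult_1 mult_zero_right)
    ultimately show "(\<Sum>a\<in>UNIV. additive_char (a * y j)) = (if y j = 0 then of_nat CARD('p) else 0)"
      using sum_additive_char_additive[of "\<lambda>a. a * y j"] by simp
  qed
  also have "\<dots> = (if \<forall>j\<in>J. y j = 0 then of_nat (CARD('p) ^ card J) else 0)"
    using assms by (auto simp: prod_zero_iff)
  finally show ?thesis .
qed

text \<open>
  Squaring the sum and substituting \<open>y = x + h\<close> leaves, for each \<open>h\<close>, the character sum of the
  additive map \<open>b h\<close>, which vanishes unless \<open>b h\<close> is identically zero.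
\<close>

lemma weyl_bound:
  fixes f :: "'v::{finite, ab_group_add} \<Rightarrow> 'p::prime_card mod_ring"
  assumes diff: "\<And>x h. f (x + h) - f x = b h x + c h"
    and b: "\<And>h. additive_map (b h)"
    and ker: "real (card {h. \<forall>x. b h x = 0}) \<le> \<rho> * real CARD('v)"
  shows "norm (\<Sum>x\<in>UNIV. additive_char (f x)) \<le> sqrt \<rho> * real CARD('v)"
proof -
  let ?S = "\<Sum>x\<in>UNIV. additive_char (f x)"
  let ?N = "real CARD('v)"
  have "?S * cnj ?S = (\<Sum>x\<in>UNIV. \<Sum>y\<in>UNIV. additive_char (f y) * cnj (additive_char (f x)))"
    by (simp add: sum_product mult.commute) (rule sum.swap)
  also have "\<dots> = (\<Sum>x\<in>UNIV. \<Sum>h\<in>UNIV. additive_char (f (x + h)) * cnj (additive_char (f x)))"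
  proof (rule sum.cong[OF refl])
    fix x
    show "(\<Sum>y\<in>UNIV. additive_char (f y) * cnj (additive_char (f x))) =
        (\<Sum>h\<in>UNIV. additive_char (f (x + h)) * cnj (additive_char (f x)))"
      using sum_UNIV_shift[of "\<lambda>y. additive_char (f y) * cnj (additive_char (f x))" x]
      by (simp add: add.commute)
  qed
  also have "\<dots> = (\<Sum>x\<in>UNIV. \<Sum>h\<in>UNIV. additive_char (b h x) * additive_char (c h))"
    by (simp add: additive_char_minus[symmetric] additive_char_add[symmetric] diff[symmetric])
  also have "\<dots> = (\<Sum>h\<in>UNIV. additive_char (c h) * (\<Sum>x\<in>UNIV. additive_char (b h x)))"
    by (subst sum.swap) (simp add: sum_distrib_left mult.commute)
  also have "\<dots> = (\<Sum>h | \<forall>x. b h x = 0. additive_char (c h) * of_nat CARD('v))"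
    by (simp add: sum_additive_char_additive[OF b] if_distrib sum.If_cases cong: if_cong)
  finally have "norm (?S * cnj ?S) = norm (\<Sum>h | \<forall>x. b h x = 0. additive_char (c h) * of_nat CARD('v))"
    by simp
  also have "\<dots> \<le> (\<Sum>h | \<forall>x. b h x = 0. norm (additive_char (c h) * of_nat CARD('v)))"
    by (rule norm_sum)
  also have "\<dots> = real (card {h. \<forall>x. b h x = 0}) * ?N"
    by (simp add: norm_mult)
  also have "\<dots> \<le> \<rho> * ?N * ?N"
    by (rule mult_right_mono[OF ker]) simp
  finally have "(norm ?S)\<^sup>2 \<le> \<rho> * ?N\<^sup>2"
    by (simp only: norm_mult complex_mod_cnj power2_eq_square mult.assoc)
  then have "norm ?S \<le> sqrt (\<rho> * ?N\<^sup>2)"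
    by (simp add: real_le_rsqrt)
  then show ?thesis
    by (simp add: real_sqrt_mult)
qed

text \<open>
  Expanding both indicator functions into characters, the trivial pair of coefficient vectors gives
  the main term \<open>N\<close>. Pairs that are trivial on the quadratic side contribute nothing, because a
  nontrivial combination of the \<open>F j\<close> is a nonzero additive map; all others are controlled by the
  hypothesis \<open>sums\<close>.
\<close>

lemma equidistribution:
  fixes f :: "'i \<Rightarrow> 'v::{finite, ab_group_add} \<Rightarrow> 'p::prime_card mod_ring"
    and F :: "'j \<Rightarrow> 'v \<Rightarrow> 'p mod_ring"
  assumes I: "finite I" and J: "finite J"
    and F: "\<And>j. j \<in> J \<Longrightarrow> additive_map (F j)"
    and indep: "\<And>l. \<exists>j\<in>J. l j \<noteq> 0 \<Longrightarrow> \<exists>x. (\<Sum>j\<in>J. l j * F j x) \<noteq> 0"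
    and sums: "\<And>l \<alpha> c. additive_map \<alpha> \<Longrightarrow> \<exists>i\<in>I. l i \<noteq> 0 \<Longrightarrow>
       norm (\<Sum>x\<in>UNIV. additive_char ((\<Sum>i\<in>I. l i * f i x) + \<alpha> x + c)) \<le> \<eta> * real CARD('v)"
    and \<eta>: "0 \<le> \<eta>"
  defines "P \<equiv> real CARD('p) ^ card I * real CARD('p) ^ card J"
  shows "\<bar>P * real (card {x. (\<forall>i\<in>I. f i x = 0) \<and> (\<forall>j\<in>J. F j x = c j)}) - real CARD('v)\<bar>
           \<le> P * \<eta> * real CARD('v)"
proof -
  let ?N = "real CARD('v)"
  let ?A = "{x. (\<forall>i\<in>I. f i x = 0) \<and> (\<forall>j\<in>J. F j x = c j)}"
  let ?LI = "I \<rightarrow>\<^sub>E (UNIV :: 'p mod_ring set)" and ?LJ = "J \<rightarrow>\<^sub>E (UNIV :: 'p mod_ring set)"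
  define T where "T l m = (\<Sum>x\<in>UNIV. additive_char ((\<Sum>i\<in>I. l i * f i x) + (\<Sum>j\<in>J. m j * F j x) - (\<Sum>j\<in>J. m j * c j)))" for l m
  have fin: "finite ?LI" "finite ?LJ"
    using I J by (simp_all add: finite_PiE)
  have addl: "additive_map (\<lambda>x. \<Sum>j\<in>J. m j * F j x)" for m
    using F by (simp add: additive_map_def distrib_left sum.distrib)
  have "complex_of_real (P * real (card ?A)) =
      (\<Sum>x\<in>UNIV. if (\<forall>i\<in>I. f i x = 0) \<and> (\<forall>j\<in>J. F j x - c j = 0) then complex_of_real P else 0)"
    by (simp add: sum.If_cases mult.commute)
  also have "\<dots> = (\<Sum>x\<in>UNIV. (\<Sum>l\<in>?LI. additive_char (\<Sum>i\<in>I. l i * f i x)) *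
       (\<Sum>m\<in>?LJ. additive_char (\<Sum>j\<in>J. m j * (F j x - c j))))"
    by (intro sum.cong refl) (simp add: sum_additive_char_PiE[OF I] sum_additive_char_PiE[OF J] P_def)
  also have "\<dots> = (\<Sum>x\<in>UNIV. \<Sum>l\<in>?LI. \<Sum>m\<in>?LJ.
     additive_char ((\<Sum>i\<in>I. l i * f i x) + (\<Sum>j\<in>J. m j * F j x) - (\<Sum>j\<in>J. m j * c j)))"
    by (simp only: sum_product additive_char_add [symmetric] right_diff_distrib sum_subtractf
        add_diff_eq)
  also have "\<dots> = (\<Sum>l\<in>?LI. \<Sum>m\<in>?LJ. T l m)"
  proof -
    have "(\<Sum>x\<in>UNIV. \<Sum>l\<in>?LI. \<Sum>m\<in>?LJ. g x l m) = (\<Sum>l\<in>?LI. \<Sum>m\<in>?LJ. \<Sum>x\<in>UNIV. g x l m)"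
      for g :: "'v \<Rightarrow> ('i \<Rightarrow> 'p mod_ring) \<Rightarrow> ('j \<Rightarrow> 'p mod_ring) \<Rightarrow> complex"
      by (subst sum.swap, rule sum.cong[OF refl], rule sum.swap)
    then show ?thesis
      unfolding T_def .
  qed
  also have "\<dots> = (\<Sum>(l,m)\<in>?LI \<times> ?LJ. T l m)"
    by (rule sum.cartesian_product)
  finally have main: "complex_of_real (P * real (card ?A)) = (\<Sum>(l,m)\<in>?LI \<times> ?LJ. T l m)" .
  define l0 m0 where "l0 = (\<lambda>i\<in>I. 0::'p mod_ring)" and "m0 = (\<lambda>j\<in>J. 0::'p mod_ring)"
  have in0: "(l0, m0) \<in> ?LI \<times> ?LJ"
    by (auto simp: l0_def m0_def)
  have T0: "T l0 m0 = of_nat CARD('v)"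
    by (simp add: T_def l0_def m0_def)
  have nz: "\<exists>i\<in>I. l i \<noteq> 0" if "l \<in> ?LI" "l \<noteq> l0" for l
  proof (rule ccontr)
    assume "\<not> ?thesis"
    then have "l = l0"
      using that(1) by (intro ext) (auto simp: l0_def PiE_def extensional_def)
    with that(2) show False by simp
  qed
  have nzm: "\<exists>j\<in>J. m j \<noteq> 0" if "m \<in> ?LJ" "m \<noteq> m0" for m
  proof (rule ccontr)
    assume "\<not> ?thesis"
    then have "m = m0"
      using that(1) by (intro ext) (auto simp: m0_def PiE_def extensional_def)
    with that(2) show False by simp
  qed
  have bound: "norm (T l m) \<le> \<eta> * ?N" if lm: "(l, m) \<in> ?LI \<times> ?LJ - {(l0, m0)}" for l m
  proof (cases "l = l0")
    case True
    then have m: "\<exists>j\<in>J. m j \<noteq> 0"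
      using lm nzm by auto
    have "T l m = additive_char (- (\<Sum>j\<in>J. m j * c j)) * (\<Sum>x\<in>UNIV. additive_char (\<Sum>j\<in>J. m j * F j x))"
      unfolding T_def by (simp add: True l0_def sum_distrib_left additive_char_add[symmetric] add.commute)
    also have "\<dots> = 0"
      using indep[OF m] by (auto simp: sum_additive_char_additive[OF addl])
    finally show ?thesis
      using \<eta> by simp
  next
    case False
    then have "\<exists>i\<in>I. l i \<noteq> 0"
      using lm nz by auto
    from sums[OF addl this, of m "- (\<Sum>j\<in>J. m j * c j)"] show ?thesis
      by (simp add: T_def)
  qed
  have "complex_of_real (P * real (card ?A) - ?N) = (\<Sum>(l,m)\<in>?LI \<times> ?LJ - {(l0,m0)}. T l m)"
    unfolding of_real_diff main
    using sum.remove[of "?LI \<times> ?LJ" "(l0, m0)" "\<lambda>(l,m). T l m"] fin in0 T0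
    by simp
  then have "\<bar>P * real (card ?A) - ?N\<bar> = norm (\<Sum>(l,m)\<in>?LI \<times> ?LJ - {(l0,m0)}. T l m)"
    using norm_of_real[where 'a = complex] by (simp only: flip: norm_of_real[where 'a = complex])
  also have "\<dots> \<le> real (card (?LI \<times> ?LJ - {(l0,m0)})) * (\<eta> * ?N)"
    using bound by (intro sum_norm_bound) auto
  also have "\<dots> \<le> real (card (?LI \<times> ?LJ)) * (\<eta> * ?N)"
    using fin \<eta> by (intro mult_right_mono of_nat_mono card_mono) auto
  also have "real (card (?LI \<times> ?LJ)) = P"
    using I J by (simp add: card_cartesian_product card_PiE P_def)
  finally show ?thesis
    by (simp add: mult.assoc)
qed


section \<open>Linearity testing\<close>

definition subgroup_set :: "'v::ab_group_add set \<Rightarrow> bool" where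
  "subgroup_set H \<longleftrightarrow> 0 \<in> H \<and> (\<forall>x\<in>H. \<forall>y\<in>H. x + y \<in> H \<and> x - y \<in> H)"

lemma subgroup_setD:
  assumes "subgroup_set H"
  shows "0 \<in> H" "x \<in> H \<Longrightarrow> y \<in> H \<Longrightarrow> x + y \<in> H" "x \<in> H \<Longrightarrow> y \<in> H \<Longrightarrow> x - y \<in> H"
  using assms by (auto simp: subgroup_set_def)

lemma subgroup_set_UNIV [simp]: "subgroup_set UNIV"
  by (simp add: subgroup_set_def)

lemma card_pairs_eq_sum:
  assumes "finite A" "finite B"
  shows "card {(a, b). a \<in> A \<and> b \<in> B \<and> P a b} = (\<Sum>a\<in>A. card {b \<in> B. P a b})"
proof -
  have "{(a, b). a \<in> A \<and> b \<in> B \<and> P a b} = (SIGMA a:A. {b \<in> B. P a b})"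
    by auto
  then show ?thesis
    using assms by (simp add: card_SigmaI)
qed

text \<open>
  The pigeonhole step used to fix a popular vote, a base point, or a reference shift.
\<close>

lemma exists_le_average:
  fixes f :: "'a \<Rightarrow> nat"
  assumes "finite A" "A \<noteq> {}" "real (\<Sum>a\<in>A. f a) \<le> c * real (card A)"
  obtains a where "a \<in> A" "real (f a) \<le> c"
proof (rule ccontr)
  assume "\<not> thesis"
  then have "\<forall>a\<in>A. c < real (f a)"
    using that by (meson not_le)
  then have "(\<Sum>a\<in>A. c) < (\<Sum>a\<in>A. real (f a))"
    using assms by (intro sum_strict_mono) auto
  with assms show False
    by (simp add: mult.commute)
qed

text \<open>
  The Blum--Luby--Rubinfeld argument. The value \<open>g a\<close> is a popular value of
  \<open>f (a + b) - f b\<close>: two such votes, for \<open>b\<close> and for \<open>c\<close>,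
  agree as soon as \<open>(a + b, c)\<close> and \<open>(a + c, b)\<close> both pass the test. So almost all votes for
  \<open>g a\<close> agree, for every \<open>a\<close> without exception, and additivity of \<open>g\<close> follows by choosing one
  \<open>c\<close> at which three popular votes are all correct.
\<close>

theorem linearity_testing:
  fixes f :: "'v::ab_group_add \<Rightarrow> 'k::ab_group_add"
  assumes H: "finite H" "subgroup_set H"
    and bad: "real (card {(a, b). a \<in> H \<and> b \<in> H \<and> f a + f b \<noteq> f (a + b)}) \<le> \<delta> * (real (card H))\<^sup>2"
    and \<delta>: "\<delta> < 1/6"
  obtains g where "\<And>a b. a \<in> H \<Longrightarrow> b \<in> H \<Longrightarrow> g (a + b) = g a + g b"
    and "real (card {a \<in> H. f a \<noteq> g a}) \<le> 2 * \<delta> * real (card H)"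
proof -
  let ?m = "real (card H)"
  let ?B = "{(a, b). a \<in> H \<and> b \<in> H \<and> f a + f b \<noteq> f (a + b)}"
  note Hc = subgroup_setD[OF H(2)]
  have Hne: "H \<noteq> {}"
    using Hc(1) by auto
  have m: "?m > 0"
    using H Hne by (simp add: card_gt_0_iff)
  have finB: "finite ?B"
    by (rule finite_subset[of _ "H \<times> H"]) (auto simp: H)
  have \<delta>0: "0 \<le> \<delta>"
  proof (rule ccontr)
    assume "\<not> 0 \<le> \<delta>"
    then have "\<delta> * ?m\<^sup>2 < 0"
      using m by (simp add: mult_neg_pos)
    with bad show False
      by linarith
  qed
  have vote: "\<exists>v. real (card {b \<in> H. f (a + b) - f b \<noteq> v}) \<le> 2 * \<delta> * ?m" if a: "a \<in> H" for a
  proof -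
    let ?D = "{(c, b). c \<in> H \<and> b \<in> H \<and> f (a + b) - f b \<noteq> f (a + c) - f c}"
    let ?D1 = "{(c, b). c \<in> H \<and> b \<in> H \<and> f (a + b) + f c \<noteq> f (a + b + c)}"
    let ?D2 = "{(c, b). c \<in> H \<and> b \<in> H \<and> f (a + c) + f b \<noteq> f (a + c + b)}"
    have fin: "finite ?D1" "finite ?D2"
      by (rule finite_subset[of _ "H \<times> H"]; auto simp: H)+
    have "card ?D1 \<le> card ?B"
      using finB a Hc by (intro card_inj_on_le[of "\<lambda>(c, b). (a + b, c)"]) (auto simp: inj_on_def)
    moreover have "card ?D2 \<le> card ?B"
      using finB a Hc by (intro card_inj_on_le[of "\<lambda>(c, b). (a + c, b)"]) (auto simp: inj_on_def)
    moreover have "?D \<subseteq> ?D1 \<union> ?D2"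
      by (auto simp: algebra_simps)
    then have "card ?D \<le> card ?D1 + card ?D2"
      using fin by (intro order.trans[OF card_mono card_Un_le]) auto
    ultimately have "real (card ?D) \<le> 2 * (\<delta> * ?m\<^sup>2)"
      using bad by linarith
    then have "real (\<Sum>c\<in>H. card {b \<in> H. f (a + b) - f b \<noteq> f (a + c) - f c}) \<le> 2 * \<delta> * ?m * ?m"
      by (simp add: card_pairs_eq_sum[OF H(1) H(1)] power2_eq_square mult.assoc)
    from exists_le_average[OF H(1) Hne this] show ?thesis
      by blast
  qed
  define g where "g a = (SOME v. real (card {b \<in> H. f (a + b) - f b \<noteq> v}) \<le> 2 * \<delta> * ?m)" for a
  have g: "real (card {b \<in> H. f (a + b) - f b \<noteq> g a}) \<le> 2 * \<delta> * ?m" if "a \<in> H" for a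
    unfolding g_def by (rule someI_ex[OF vote[OF that]])
  show thesis
  proof (rule that[of g])
    fix a b
    assume ab: "a \<in> H" "b \<in> H"
    let ?E1 = "{c \<in> H. f (a + b + c) - f c \<noteq> g (a + b)}"
    let ?E2 = "{c \<in> H. f (b + c) - f c \<noteq> g b}"
    let ?E3 = "{c \<in> H. f (a + (b + c)) - f (b + c) \<noteq> g a}"
    have "card ?E3 \<le> card {c \<in> H. f (a + c) - f c \<noteq> g a}"
      using H ab Hc by (intro card_inj_on_le[of "\<lambda>c. b + c"]) (auto simp: inj_on_def)
    then have "real (card ?E3) \<le> 2 * \<delta> * ?m"
      using g[OF ab(1)] by linarith
    moreover have "real (card (?E1 \<union> ?E2 \<union> ?E3)) \<le> real (card ?E1) + real (card ?E2) + real (card ?E3)"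
      using card_Un_le[of "?E1 \<union> ?E2" ?E3] card_Un_le[of ?E1 ?E2] by linarith
    ultimately have "real (card (?E1 \<union> ?E2 \<union> ?E3)) \<le> 6 * \<delta> * ?m"
      using g[OF ab(2)] g[OF Hc(2)[OF ab]] by linarith
    also have "\<dots> < 1 * ?m"
      using \<delta> m by (intro mult_strict_right_mono) auto
    finally have "card (?E1 \<union> ?E2 \<union> ?E3) < card H"
      by simp
    then have "?E1 \<union> ?E2 \<union> ?E3 \<noteq> H"
      by auto
    then obtain c where "c \<in> H" "c \<notin> ?E1 \<union> ?E2 \<union> ?E3"
      by blast
    then show "g (a + b) = g a + g b"
      by (auto simp: algebra_simps)
  next
    let ?A = "{a \<in> H. f a \<noteq> g a}"
    have "(1 - 2 * \<delta>) * ?m \<le> real (card {b \<in> H. f a + f b \<noteq> f (a + b)})" if a: "a \<in> ?A" for a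
    proof -
      have "H \<subseteq> {b \<in> H. f (a + b) - f b \<noteq> g a} \<union> {b \<in> H. f a + f b \<noteq> f (a + b)}"
        using a by (auto simp: algebra_simps)
      then have "card H \<le> card {b \<in> H. f (a + b) - f b \<noteq> g a} + card {b \<in> H. f a + f b \<noteq> f (a + b)}"
        using H(1) by (intro order.trans[OF card_mono card_Un_le]) auto
      then have "?m \<le> real (card {b \<in> H. f (a + b) - f b \<noteq> g a}) + real (card {b \<in> H. f a + f b \<noteq> f (a + b)})"
        by linarith
      then show ?thesis
        using g[of a] a by (simp add: algebra_simps)
    qed
    then have "(\<Sum>a\<in>?A. (1 - 2 * \<delta>) * ?m) \<le> (\<Sum>a\<in>?A. real (card {b \<in> H. f a + f b \<noteq> f (a + b)}))"
      by (rule sum_mono)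
    also have "\<dots> \<le> (\<Sum>a\<in>H. real (card {b \<in> H. f a + f b \<noteq> f (a + b)}))"
      using H by (intro sum_mono2) auto
    also have "\<dots> = real (card ?B)"
      by (simp add: card_pairs_eq_sum[OF H(1) H(1)])
    finally have "real (card ?A) * ((1 - 2 * \<delta>) * ?m) \<le> \<delta> * ?m * ?m"
      using bad by (simp add: power2_eq_square)
    then have "real (card ?A) * (1 - 2 * \<delta>) \<le> \<delta> * ?m"
      using m by (simp add: mult.assoc[symmetric])
    moreover have "real (card ?A) * (1/2) \<le> real (card ?A) * (1 - 2 * \<delta>)"
      using \<delta> by (intro mult_left_mono) auto
    ultimately show "real (card ?A) \<le> 2 * \<delta> * ?m"
      by linarith
  qed
qed


text \<open>
  Linearity testing for a function given only on a subset \<open>Y\<close> of relative density \<open>\<sigma>\<close> whose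
  differences lie in \<open>H\<close>. The set must look random: apart from the exceptional sets \<open>E1\<close> and
  \<open>E2\<close>, the number of \<open>x\<close> with \<open>x, x + a \<in> Y\<close>, respectively \<open>x, x + a, x + a + b \<in> Y\<close>, has
  the expected order. Let \<open>w a\<close> be the popular value of \<open>\<phi> (x + a) - \<phi> x\<close>. A uniformly random triple
  of points of \<open>Y\<close> then has \<open>w a + w b = w (a + b)\<close> for its two successive differences with high
  probability; by the lower bound \<open>shift2\<close> this passes to a random pair \<open>(a, b)\<close> in
  \<open>H\<close>, and ordinary linearity testing applies to \<open>w\<close>. The conclusion loses only a constant factor
  over the proportion \<open>\<kappa>\<close> of bad quadruples.
\<close>

theorem affine_testing:
  fixes \<phi> :: "'v::ab_group_add \<Rightarrow> 'k::ab_group_add"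
  assumes H: "finite H" "subgroup_set H"
    and Y: "finite Y" "\<And>x y. x \<in> Y \<Longrightarrow> y \<in> Y \<Longrightarrow> y - x \<in> H"
    and \<sigma>: "0 < \<sigma>" "\<sigma> \<le> 1"
    and cardY: "9/10 * \<sigma> * real (card H) \<le> real (card Y)" "real (card Y) \<le> 11/10 * \<sigma> * real (card H)"
    and E1: "E1 \<subseteq> H" "real (card E1) \<le> \<tau> * real (card H)"
    and E2: "E2 \<subseteq> H \<times> H" "real (card E2) \<le> \<tau> * (real (card H))\<^sup>2"
    and shift1: "\<And>a. a \<in> H - E1 \<Longrightarrow> 9/10 * \<sigma>^2 * real (card H) \<le> real (card {x \<in> Y. x + a \<in> Y})"
      "\<And>a. a \<in> H - E1 \<Longrightarrow> real (card {x \<in> Y. x + a \<in> Y}) \<le> 11/10 * \<sigma>^2 * real (card H)"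
    and shift2: "\<And>a b. (a, b) \<in> H \<times> H - E2 \<Longrightarrow>
        9/10 * \<sigma>^3 * real (card H) \<le> real (card {x \<in> Y. x + a \<in> Y \<and> x + a + b \<in> Y})"
    and bad: "real (\<Sum>a\<in>H. card {(x, y). (x \<in> Y \<and> x + a \<in> Y) \<and> (y \<in> Y \<and> y + a \<in> Y) \<and>
        \<phi> (x + a) - \<phi> x \<noteq> \<phi> (y + a) - \<phi> y}) \<le> \<kappa> * \<sigma>^4 * (real (card H))^3"
    and \<kappa>: "\<tau> \<le> \<kappa> * \<sigma>" "\<kappa> \<le> 1/100"
  obtains g y0 where "\<And>a b. a \<in> H \<Longrightarrow> b \<in> H \<Longrightarrow> g (a + b) = g a + g b"
    and "y0 \<in> Y" and "real (card {x \<in> Y. \<phi> x \<noteq> \<phi> y0 + g (x - y0)}) \<le> 36 * \<kappa> * \<sigma> * real (card H)"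
proof -
  define m where "m = real (card H)"
  define S where "S a = {x \<in> Y. x + a \<in> Y}" for a
  define b where "b a = card {(x, y). x \<in> S a \<and> y \<in> S a \<and> \<phi> (x + a) - \<phi> x \<noteq> \<phi> (y + a) - \<phi> y}" for a
  note Hc = subgroup_setD[OF H(2)]
  have "H \<noteq> {}"
    using Hc(1) by auto
  then have m: "m > 0"
    using H by (simp add: card_gt_0_iff m_def)
  have finS: "finite (S a)" for a
    by (simp add: S_def Y)
  have \<tau>0: "0 \<le> \<tau>"
  proof (rule ccontr)
    assume "\<not> 0 \<le> \<tau>"
    then have "\<tau> * m < 0"
      using m by (simp add: mult_neg_pos)
    with E1(2) show False
      by (simp add: m_def)
  qed
  then have \<kappa>0: "0 \<le> \<kappa>"
    using \<kappa>(1) \<sigma>(1) by (metis order_trans zero_le_mult_iff not_less)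
  have \<tau>\<kappa>: "\<tau> \<le> \<kappa>"
    using \<kappa>(1) \<sigma> \<kappa>0 by (meson mult_left_le order_trans)
  have cY: "9/10 * \<sigma> * m \<le> real (card Y)" "real (card Y) \<le> 11/10 * \<sigma> * m"
    using cardY by (simp_all add: m_def)
  have Ypos: "real (card Y) > 0"
    using cY(1) \<sigma> m by (smt (verit) mult_pos_pos divide_pos_pos)
  then have Yne: "Y \<noteq> {}"
    by auto
  have sumb: "real (\<Sum>a\<in>H. b a) \<le> \<kappa> * \<sigma>^4 * m^3"
    using bad by (simp add: b_def S_def m_def conj_assoc)
  have "\<exists>v. card {x \<in> S a. \<phi> (x + a) - \<phi> x \<noteq> v} * card (S a) \<le> b a" for a
  proof (cases "S a = {}")
    case False
    have "real (\<Sum>x\<in>S a. card {y \<in> S a. \<phi> (x + a) - \<phi> x \<noteq> \<phi> (y + a) - \<phi> y}) \<le> (real (b a) / real (card (S a))) * real (card (S a))"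
      using False finS by (simp add: b_def card_pairs_eq_sum[OF finS finS] )
    from exists_le_average[OF finS False this]
    obtain x where x: "real (card {y \<in> S a. \<phi> (x + a) - \<phi> x \<noteq> \<phi> (y + a) - \<phi> y}) \<le> real (b a) / real (card (S a))"
      by blast
    have "real (card (S a)) > 0"
      using False finS by (simp add: card_gt_0_iff)
    then have "real (card {y \<in> S a. \<phi> (x + a) - \<phi> x \<noteq> \<phi> (y + a) - \<phi> y}) * real (card (S a)) \<le> real (b a)"
      using x by (simp add: pos_le_divide_eq)
    then have "card {y \<in> S a. \<phi> (y + a) - \<phi> y \<noteq> \<phi> (x + a) - \<phi> x} * card (S a) \<le> b a"
      by (simp only: of_nat_mult [symmetric] of_nat_le_iff not_sym eq_commute[of "\<phi> (_ + a) - \<phi> _" "\<phi> (x + a) - \<phi> x"])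
    then show ?thesis
      by blast
  qed simp
  then obtain w where w: "card {x \<in> S a. \<phi> (x + a) - \<phi> x \<noteq> w a} * card (S a) \<le> b a" for a
    by metis
  have fibre: "card {(x, y). x \<in> Y \<and> y \<in> Y \<and> P x (y - x)} = (\<Sum>a\<in>H. card {x \<in> S a. P x a})" for P
  proof -
    have "card {(x, y). x \<in> Y \<and> y \<in> Y \<and> P x (y - x)} = card {(a, x). a \<in> H \<and> x \<in> Y \<and> x + a \<in> Y \<and> P x a}"
      by (rule bij_betw_same_card[of "\<lambda>(x, y). (y - x, x)"], rule bij_betwI[where g = "\<lambda>(a, x). (x, x + a)"])
        (use Y in auto)
    also have "\<dots> = (\<Sum>a\<in>H. card {x \<in> Y. x + a \<in> Y \<and> P x a})"
      by (rule card_pairs_eq_sum[OF H(1) Y(1)])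
    finally show ?thesis
      by (simp add: S_def conj_assoc)
  qed
  have E1Y: "real (card E1) * real (card Y) \<le> 11/10 * \<kappa> * \<sigma>^2 * m^2"
  proof -
    have "real (card E1) * real (card Y) \<le> (\<tau> * m) * (11/10 * \<sigma> * m)"
      using E1(2) cY \<tau>0 m by (intro mult_mono) (auto simp: m_def)
    also have "\<dots> = \<tau> * (11/10 * \<sigma> * m^2)"
      by (simp add: power2_eq_square)
    also have "\<dots> \<le> (\<kappa> * \<sigma>) * (11/10 * \<sigma> * m^2)"
      using \<kappa>(1) \<sigma> by (intro mult_right_mono) auto
    finally show ?thesis
      by (simp add: power2_eq_square algebra_simps)
  qed
  \<comment> \<open>The pairs in \<open>Y\<close> on which the popular value \<open>w\<close> is wrong.\<close>
  define D where "D = {(x, y). x \<in> Y \<and> y \<in> Y \<and> \<phi> y - \<phi> x \<noteq> w (y - x)}"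
  have finYY: "finite {(x, y). x \<in> Y \<and> y \<in> Y \<and> P x y}" for P
    by (rule finite_subset[of _ "Y \<times> Y"]) (auto simp: Y)
  have sumE1: "(\<Sum>a\<in>A \<inter> E1. real (card {x \<in> S a. P x a})) \<le> real (card E1) * real (card Y)" for P A
  proof -
    have "(\<Sum>a\<in>A \<inter> E1. real (card {x \<in> S a. P x a})) \<le> (\<Sum>a\<in>A \<inter> E1. real (card Y))"
      by (intro sum_mono of_nat_mono card_mono) (auto simp: Y S_def)
    also have "\<dots> \<le> real (card E1) * real (card Y)"
      using finite_subset[OF E1(1) H(1)] by (auto intro!: mult_right_mono card_mono)
    finally show ?thesis .
  qed
  have Dle: "real (card D) \<le> 3 * \<kappa> * \<sigma>^2 * m^2"
  proof -
    have "card D = (\<Sum>a\<in>H. card {x \<in> S a. \<phi> (x + a) - \<phi> x \<noteq> w a})"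
      using fibre[of "\<lambda>x a. \<phi> (x + a) - \<phi> x \<noteq> w a"] by (simp add: D_def)
    then have "real (card D) = (\<Sum>a\<in>H - E1. real (card {x \<in> S a. \<phi> (x + a) - \<phi> x \<noteq> w a})) +
        (\<Sum>a\<in>H \<inter> E1. real (card {x \<in> S a. \<phi> (x + a) - \<phi> x \<noteq> w a}))"
      by (simp add: sum.Int_Diff[OF H(1), of _ E1] add.commute)
    also have "(\<Sum>a\<in>H \<inter> E1. real (card {x \<in> S a. \<phi> (x + a) - \<phi> x \<noteq> w a})) \<le> 11/10 * \<kappa> * \<sigma>^2 * m^2"
      using sumE1 E1Y by (rule order_trans)
    also have "(\<Sum>a\<in>H - E1. real (card {x \<in> S a. \<phi> (x + a) - \<phi> x \<noteq> w a})) \<le> (\<Sum>a\<in>H - E1. real (b a) / (9/10 * \<sigma>^2 * m))"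
    proof (rule sum_mono)
      fix a
      assume a: "a \<in> H - E1"
      let ?d = "real (card {x \<in> S a. \<phi> (x + a) - \<phi> x \<noteq> w a})"
      have "?d * (9/10 * \<sigma>^2 * m) \<le> ?d * real (card (S a))"
        using shift1(1)[OF a] by (intro mult_left_mono) (auto simp: S_def m_def)
      also have "\<dots> \<le> real (b a)"
        using w[of a] by (simp only: of_nat_mult [symmetric] of_nat_le_iff)
      finally show "?d \<le> real (b a) / (9/10 * \<sigma>^2 * m)"
        using \<sigma> m by (subst pos_le_divide_eq) auto
    qed
    also have "\<dots> \<le> (\<Sum>a\<in>H. real (b a) / (9/10 * \<sigma>^2 * m))"
      using H m by (intro sum_mono2) auto
    also have "\<dots> = real (\<Sum>a\<in>H. b a) / (9/10 * \<sigma>^2 * m)"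
      by (simp only: of_nat_sum sum_divide_distrib)
    also have "\<dots> \<le> (\<kappa> * \<sigma>^4 * m^3) / (9/10 * \<sigma>^2 * m)"
      using sumb m by (intro divide_right_mono) auto
    also have "\<dots> = 10/9 * \<kappa> * \<sigma>^2 * m^2"
      using \<sigma> m by (simp add: field_simps eval_nat_numeral)
    finally have "real (card D) \<le> (10/9 + 11/10) * (\<kappa> * \<sigma>^2 * m^2)"
      by (simp add: algebra_simps)
    also have "\<dots> \<le> 3 * (\<kappa> * \<sigma>^2 * m^2)"
      using \<kappa>0 by (intro mult_right_mono) auto
    finally show ?thesis
      by (simp add: mult.assoc)
  qed
  define B where "B = {(a, a'). a \<in> H \<and> a' \<in> H \<and> w a + w a' \<noteq> w (a + a')}"
  have finB: "finite B"
    unfolding B_def by (rule finite_subset[of _ "H \<times> H"]) (auto simp: H)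
  have Bm: "real (card B) \<le> 12 * \<kappa> * m\<^sup>2"
  proof -
    \<comment> \<open>A pair \<open>(a, a')\<close> with \<open>w a + w a' \<noteq> w (a + a')\<close> spoils every triple \<open>(x, x + a, x + a + a')\<close>.\<close>
    define T where "T = {(x, y, z). x \<in> Y \<and> y \<in> Y \<and> z \<in> Y \<and> ((x, y) \<in> D \<or> (y, z) \<in> D \<or> (x, z) \<in> D)}"
    have finD: "finite D"
      unfolding D_def by (rule finYY)
    have "T \<subseteq> (\<lambda>((x, y), z). (x, y, z)) ` (D \<times> Y) \<union> (\<lambda>((y, z), x). (x, y, z)) ` (D \<times> Y) \<union> (\<lambda>((x, z), y). (x, y, z)) ` (D \<times> Y)"
    proof
      fix t
      assume "t \<in> T"
      then obtain x y z where t: "t = (x, y, z)" "x \<in> Y" "y \<in> Y" "z \<in> Y"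
        and "(x, y) \<in> D \<or> (y, z) \<in> D \<or> (x, z) \<in> D"
        by (auto simp: T_def)
      then consider "((x, y), z) \<in> D \<times> Y" | "((y, z), x) \<in> D \<times> Y" | "((x, z), y) \<in> D \<times> Y"
        by auto
      then show "t \<in> (\<lambda>((x, y), z). (x, y, z)) ` (D \<times> Y) \<union> (\<lambda>((y, z), x). (x, y, z)) ` (D \<times> Y) \<union> (\<lambda>((x, z), y). (x, y, z)) ` (D \<times> Y)"
        unfolding t(1) by cases (force intro: rev_image_eqI)+
    qed
    then have "card T \<le> card ((\<lambda>((x, y), z). (x, y, z)) ` (D \<times> Y) \<union> (\<lambda>((y, z), x). (x, y, z)) ` (D \<times> Y) \<union> (\<lambda>((x, z), y). (x, y, z)) ` (D \<times> Y))"
      using finD Y by (intro card_mono) auto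
    also have "\<dots> \<le> card ((\<lambda>((x, y), z). (x, y, z)) ` (D \<times> Y)) + card ((\<lambda>((y, z), x). (x, y, z)) ` (D \<times> Y)) + card ((\<lambda>((x, z), y). (x, y, z)) ` (D \<times> Y))"
      by (intro order.trans[OF card_Un_le] add_mono card_Un_le order.refl)
    also have "\<dots> \<le> card (D \<times> Y) + card (D \<times> Y) + card (D \<times> Y)"
      using finD Y by (intro add_mono card_image_le) auto
    finally have T: "card T \<le> 3 * (card D * card Y)"
      by (simp add: card_cartesian_product)
    have finT: "finite T"
      unfolding T_def by (rule finite_subset[of _ "Y \<times> Y \<times> Y"]) (auto simp: Y)
    have "card (SIGMA (a, a') : B - E2. {x \<in> Y. x + a \<in> Y \<and> x + a + a' \<in> Y}) \<le> card T"
    proof (rule card_inj_on_le[OF _ _ finT])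
      show "inj_on (\<lambda>((a, a'), x). (x, x + a, x + a + a')) (SIGMA (a, a') : B - E2. {x \<in> Y. x + a \<in> Y \<and> x + a + a' \<in> Y})"
        by (auto simp: inj_on_def)
      have "(x, x + a, x + a + a') \<in> T" if "(a, a') \<in> B" "x \<in> Y" "x + a \<in> Y" "x + a + a' \<in> Y" for a a' x
      proof (rule ccontr)
        assume "\<not> ?thesis"
        then have "\<phi> (x + a) - \<phi> x = w a" "\<phi> (x + a + a') - \<phi> (x + a) = w a'" "\<phi> (x + a + a') - \<phi> x = w (a + a')"
          using that by (auto simp: T_def D_def add.assoc)
        note eqs = this
        have "w a + w a' = w (a + a')"
          unfolding eqs [symmetric] by (simp add: algebra_simps)
        with that(1) show False
          by (simp add: B_def)
      qed
      then show "(\<lambda>((a, a'), x). (x, x + a, x + a + a')) ` (SIGMA (a, a') : B - E2. {x \<in> Y. x + a \<in> Y \<and> x + a + a' \<in> Y}) \<subseteq> T"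
        by auto
    qed
    also have "card (SIGMA (a, a') : B - E2. {x \<in> Y. x + a \<in> Y \<and> x + a + a' \<in> Y}) = (\<Sum>(a, a')\<in>B - E2. card {x \<in> Y. x + a \<in> Y \<and> x + a + a' \<in> Y})"
      using finB Y by (subst card_SigmaI) (auto simp: case_prod_unfold)
    finally have "real (\<Sum>(a, a')\<in>B - E2. card {x \<in> Y. x + a \<in> Y \<and> x + a + a' \<in> Y}) \<le> real (3 * (card D * card Y))"
      using T by (intro of_nat_mono) (rule order_trans)
    then have "real (\<Sum>(a, a')\<in>B - E2. card {x \<in> Y. x + a \<in> Y \<and> x + a + a' \<in> Y}) \<le> 3 * (real (card D) * real (card Y))"
      by (simp only: of_nat_mult of_nat_numeral)
    moreover have "real (card (B - E2)) * (9/10 * \<sigma>^3 * m) \<le> real (\<Sum>(a, a')\<in>B - E2. card {x \<in> Y. x + a \<in> Y \<and> x + a + a' \<in> Y})"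
    proof -
      have "real (card (B - E2)) * (9/10 * \<sigma>^3 * m) = (\<Sum>(a, a')\<in>B - E2. 9/10 * \<sigma>^3 * m)"
        by simp
      also have "\<dots> \<le> (\<Sum>(a, a')\<in>B - E2. real (card {x \<in> Y. x + a \<in> Y \<and> x + a + a' \<in> Y}))"
      proof (rule sum_mono)
        fix aa
        assume "aa \<in> B - E2"
        then show "(case aa of (a, a') \<Rightarrow> 9/10 * \<sigma>^3 * m) \<le> (case aa of (a, a') \<Rightarrow> real (card {x \<in> Y. x + a \<in> Y \<and> x + a + a' \<in> Y}))"
          using shift2 by (auto simp: B_def m_def)
      qed
      finally show ?thesis
        by (simp add: case_prod_unfold)
    qed
    ultimately have "real (card (B - E2)) * (9/10 * \<sigma>^3 * m) \<le> 3 * (real (card D) * real (card Y))"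
      by linarith
    also have "\<dots> \<le> 3 * ((3 * \<kappa> * \<sigma>^2 * m^2) * (11/10 * \<sigma> * m))"
      using Dle cY(2) \<kappa>0 \<sigma> by (intro mult_left_mono mult_mono) auto
    also have "\<dots> = 11 * \<kappa> * m\<^sup>2 * (9/10 * \<sigma>^3 * m)"
      by (simp add: eval_nat_numeral)
    finally have "real (card (B - E2)) \<le> 11 * \<kappa> * m\<^sup>2"
      using \<sigma> m by (subst (asm) mult_le_cancel_right_pos) auto
    moreover have "real (card E2) \<le> \<kappa> * m\<^sup>2"
      using E2(2) \<tau>\<kappa> by (smt (verit) m_def mult_right_mono zero_le_power2)
    moreover have "card B \<le> card (B - E2) + card E2"
      using finite_subset[OF E2(1)] H finB by (intro order.trans[OF card_mono card_Un_le]) auto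
    ultimately show ?thesis
      by linarith
  qed
  have "12 * \<kappa> < 1/6"
    using \<kappa>(2) by linarith
  then obtain g where g: "\<And>a b. a \<in> H \<Longrightarrow> b \<in> H \<Longrightarrow> g (a + b) = g a + g b"
    and wg: "real (card {a \<in> H. w a \<noteq> g a}) \<le> 2 * (12 * \<kappa>) * m"
    using linearity_testing[OF H Bm[unfolded B_def m_def]] unfolding m_def by blast
  define G where "G = {(x, y). x \<in> Y \<and> y \<in> Y \<and> \<phi> y - \<phi> x \<noteq> g (y - x)}"
  define G' where "G' = {(x, y). x \<in> Y \<and> y \<in> Y \<and> w (y - x) \<noteq> g (y - x)}"
  have "real (card G') \<le> 276/10 * (\<kappa> * \<sigma>^2 * m^2)"
  proof -
    let ?A = "{a \<in> H. w a \<noteq> g a}"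
    have "card G' = (\<Sum>a\<in>H. card {x \<in> S a. w a \<noteq> g a})"
      unfolding G'_def by (rule fibre)
    also have "\<dots> = (\<Sum>a\<in>?A. card {x \<in> S a. w a \<noteq> g a})"
      using H by (intro sum.mono_neutral_right) auto
    finally have eq: "card G' = (\<Sum>a\<in>?A. card {x \<in> S a. w a \<noteq> g a})" .
    have "real (card G') = (\<Sum>a\<in>?A - E1. real (card {x \<in> S a. w a \<noteq> g a})) +
        (\<Sum>a\<in>?A \<inter> E1. real (card {x \<in> S a. w a \<noteq> g a}))"
      unfolding eq of_nat_sum using H by (subst sum.Int_Diff[of ?A _ E1]) (simp_all add: add.commute)
    also have "(\<Sum>a\<in>?A \<inter> E1. real (card {x \<in> S a. w a \<noteq> g a})) \<le> 11/10 * \<kappa> * \<sigma>^2 * m^2"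
      using sumE1 E1Y by (rule order_trans)
    also have "(\<Sum>a\<in>?A - E1. real (card {x \<in> S a. w a \<noteq> g a})) \<le> (\<Sum>a\<in>?A - E1. 11/10 * \<sigma>^2 * m)"
      using shift1(2) by (intro sum_mono) (auto simp: S_def m_def)
    also have "\<dots> \<le> real (card ?A) * (11/10 * \<sigma>^2 * m)"
    proof -
      have "real (card (?A - E1)) \<le> real (card ?A)"
        using H by (intro of_nat_mono card_mono) auto
      then have "real (card (?A - E1)) * (11/10 * \<sigma>^2 * m) \<le> real (card ?A) * (11/10 * \<sigma>^2 * m)"
        using m by (intro mult_right_mono) auto
      then show ?thesis
        by (simp only: sum_constant)
    qed
    also have "\<dots> \<le> 2 * (12 * \<kappa>) * m * (11/10 * \<sigma>^2 * m)"
      using wg m by (intro mult_right_mono) auto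
    finally show ?thesis
      by (simp add: power2_eq_square algebra_simps)
  qed
  moreover have "card G \<le> card D + card G'"
    unfolding D_def G_def G'_def by (intro order.trans[OF card_mono card_Un_le] finite_UnI finYY) auto
  ultimately have "real (card G) \<le> 306/10 * (\<kappa> * \<sigma>^2 * m^2)"
    using Dle by (simp add: algebra_simps)
  also have "\<dots> \<le> 36 * \<kappa> * \<sigma> * m * (9/10 * \<sigma> * m)"
    using \<kappa>0 \<sigma> m by (simp add: power2_eq_square)
  also have "\<dots> \<le> 36 * \<kappa> * \<sigma> * m * real (card Y)"
    using cY(1) \<kappa>0 \<sigma> m by (intro mult_left_mono) auto
  finally have "real (\<Sum>x\<in>Y. card {y \<in> Y. \<phi> y - \<phi> x \<noteq> g (y - x)}) \<le> 36 * \<kappa> * \<sigma> * m * real (card Y)"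
    unfolding G_def by (simp add: card_pairs_eq_sum[OF Y(1) Y(1)])
  from exists_le_average[OF Y(1) Yne this] obtain y0
    where "y0 \<in> Y" and y0: "real (card {y \<in> Y. \<phi> y - \<phi> y0 \<noteq> g (y - y0)}) \<le> 36 * \<kappa> * \<sigma> * m"
    by blast
  moreover have "{x \<in> Y. \<phi> x \<noteq> \<phi> y0 + g (x - y0)} = {y \<in> Y. \<phi> y - \<phi> y0 \<noteq> g (y - y0)}"
    by (auto simp: algebra_simps)
  ultimately show thesis
    using that[of g y0] g by (simp add: m_def)
qed


section \<open>Quadratic functions and their radicals\<close>

text \<open>
  The term \<open>f 0\<close> makes this the bilinear form of the leading part even when \<open>f\<close> has a constant term.
\<close>

definition polar :: "('v::ab_group_add \<Rightarrow> 'k::ab_group_add) \<Rightarrow> 'v \<Rightarrow> 'v \<Rightarrow> 'k" where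
  "polar f h x = f (x + h) - f x - f h + f 0"

lemma polar_commute: "polar f h x = polar f x h"
  by (simp add: polar_def algebra_simps)

text \<open>
  The vanishing third derivative, solved for the far corner of a cube.
\<close>

lemma quadratic_expand:
  assumes "quadratic f"
  shows "f (x + a + b + c) = f (x + a + b) + f (x + a + c) + f (x + b + c) - f (x + a) - f (x + b) - f (x + c) + f x"
proof -
  have "mult_diff a (mult_diff b (mult_diff c f)) x = 0"
    using assms by (simp add: quadratic_def)
  then show ?thesis
    by (simp add: mult_diff_def algebra_simps)
qed

lemma additive_map_polar:
  assumes "quadratic f"
  shows "additive_map (polar f h)" and "additive_map (\<lambda>h. polar f h x)"
proof -
  have *: "additive_map (polar f h)" for h
    using quadratic_expand[OF assms, of 0] by (simp add: additive_map_def polar_def algebra_simps)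
  then show "additive_map (polar f h)" .
  show "additive_map (\<lambda>h. polar f h x)"
    using * by (simp add: polar_commute[of f _ x])
qed

lemma additive_map_scale:
  fixes \<alpha> :: "('p::prime_card mod_ring)^'d \<Rightarrow> 'p mod_ring"
  assumes "additive_map \<alpha>"
  shows "\<alpha> (c *s v) = c * \<alpha> v"
proof -
  have "\<alpha> (of_nat k *s v) = of_nat k * \<alpha> v" for k
    by (induction k) (simp_all add: additive_map_add[OF assms] additive_map_zero[OF assms]
        vector_sadd_rdistrib distrib_right)
  then show ?thesis
    using surj_of_nat_mod_ring[of c] by blast
qed

lemma additive_map_coords:
  fixes \<alpha> :: "('p::prime_card mod_ring)^'d \<Rightarrow> 'p mod_ring"
  assumes "additive_map \<alpha>"
  shows "\<alpha> x = (\<Sum>i\<in>UNIV. x $ i * \<alpha> (axis i 1))"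
proof -
  have "x = (\<Sum>i\<in>UNIV. x $ i *s axis i 1)"
    by (simp add: vec_eq_iff axis_def if_distrib cong: if_cong)
  then have "\<alpha> x = \<alpha> (\<Sum>i\<in>UNIV. x $ i *s axis i 1)"
    by simp
  then show ?thesis
    by (simp add: additive_map_sum[OF assms] additive_map_scale[OF assms])
qed

lemma two_neq_zero_mod_ring:
  assumes "CARD('p::prime_card) \<ge> 3"
  shows "(2 :: 'p mod_ring) \<noteq> 0"
proof
  assume "(2 :: 'p mod_ring) = 0"
  then have "CARD('p) dvd 2"
    using of_nat_0_mod_ring_dvd[of 2, where 'a = 'p] by simp
  with assms show False
    by (auto dest: dvd_imp_le)
qed

text \<open>
  The matrix of the polarisation, halved, represents \<open>f\<close>: the remainder
  \<open>L x = f x - f 0 - polar f x x / 2\<close> is additive, hence a linear form.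
\<close>

lemma polar_eq_matrix:
  fixes f :: "('p::prime_card mod_ring)^'d \<Rightarrow> 'p mod_ring"
  assumes "quadratic f" and "CARD('p) \<ge> 3"
  obtains M where "quad_rank f = rank M" and "\<And>h x. polar f h x = 2 * scalar_product x (M *v h)"
proof -
  have two: "(2 :: 'p mod_ring) \<noteq> 0"
    by (rule two_neq_zero_mod_ring[OF assms(2)])
  note padd = additive_map_polar[OF assms(1)]
  define M :: "('p mod_ring)^'d^'d" where "M = (\<chi> i j. polar f (axis j 1) (axis i 1) / 2)"
  define L where "L x = f x - f 0 - polar f x x / 2" for x
  have polar: "polar f h x = 2 * scalar_product x (M *v h)" for h x
  proof -
    have "polar f h x = (\<Sum>i\<in>UNIV. x $ i * polar f h (axis i 1))"
      by (rule additive_map_coords[OF padd(1)])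
    also have "\<dots> = (\<Sum>i\<in>UNIV. x $ i * (\<Sum>j\<in>UNIV. h $ j * polar f (axis j 1) (axis i 1)))"
      by (subst additive_map_coords[OF padd(2)]) simp
    also have "\<dots> = (\<Sum>i\<in>UNIV. x $ i * (\<Sum>j\<in>UNIV. 2 * (M $ i $ j * h $ j)))"
      using two by (simp add: M_def) (simp add: mult.commute)
    also have "\<dots> = 2 * scalar_product x (M *v h)"
      by (simp add: scalar_product_def matrix_vector_mult_def sum_distrib_left mult.left_commute)
    finally show ?thesis .
  qed
  have "additive_map L"
    unfolding additive_map_def
  proof (intro allI)
    fix x y
    have "polar f (x + y) (x + y) = polar f x x + polar f y y + 2 * polar f x y"
      by (simp add: additive_map_add[OF padd(1)] additive_map_add[OF padd(2)] polar_commute[of f y x])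
    then have eq1: "polar f (x + y) (x + y) / 2 = polar f x x / 2 + polar f y y / 2 + polar f x y"
      using two by (simp add: add_divide_distrib)
    have eq2: "polar f x y = f (x + y) - f x - f y + f 0"
      by (simp add: polar_def add.commute algebra_simps)
    show "L (x + y) = L x + L y"
      unfolding L_def eq1 eq2 by (simp add: algebra_simps)
  qed
  then have L: "L x = scalar_product (\<chi> i. L (axis i 1)) x" for x
    by (subst additive_map_coords) (simp_all add: scalar_product_def mult.commute)
  have "represents_quadratic M (\<chi> i. L (axis i 1)) (f 0) f"
    unfolding represents_quadratic_def
  proof (intro conjI allI)
    show "transpose M = M"
      by (simp add: transpose_def M_def vec_eq_iff polar_commute)
    fix x
    have "scalar_product x (M *v x) = polar f x x / 2"
      using two by (simp add: polar)
    then show "f x = scalar_product x (M *v x) + scalar_product (\<chi> i. L (axis i 1)) x + f 0"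
      unfolding L[symmetric] by (simp add: L_def)
  qed
  then have "quad_rank f = rank M"
    using two by (rule quad_rank_eq)
  with polar show thesis
    using that by blast
qed

lemma card_linear_forms:
  fixes F :: "'j \<Rightarrow> 'v::{finite, ab_group_add} \<Rightarrow> 'p::prime_card mod_ring"
  assumes "finite J" and "\<And>j. j \<in> J \<Longrightarrow> additive_map (F j)"
    and "\<And>l. \<exists>j\<in>J. l j \<noteq> 0 \<Longrightarrow> \<exists>x. (\<Sum>j\<in>J. l j * F j x) \<noteq> 0"
  shows "real CARD('p) ^ card J * real (card {x. \<forall>j\<in>J. F j x = c j}) = real CARD('v)"
  using equidistribution[where I = "{}::unit set" and J = J and F = F and c = c and \<eta> = 0 and f = "\<lambda>_ _. 0"] assms
  by simp

text \<open>
  The radical is the kernel of the representing matrix. A basis of its row space consists of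
  \<open>rank M\<close> independent linear forms that vanish on the kernel, so counting their common zeros bounds
  the kernel.
\<close>

lemma card_radical_le:
  fixes f :: "('p::prime_card mod_ring)^'d \<Rightarrow> 'p mod_ring"
  assumes "quadratic f" and "CARD('p) \<ge> 3" and "R \<le> quad_rank f"
  shows "real (card {h. \<forall>x. polar f h x = 0}) \<le> (1 / real CARD('p) ^ R) * real CARD(('p mod_ring)^'d)"
proof -
  let ?p = "real CARD('p)"
  have p: "?p \<ge> 1"
    using assms(2) by simp
  obtain M where M: "quad_rank f = rank M" and polar: "\<And>h x. polar f h x = 2 * scalar_product x (M *v h)"
    using polar_eq_matrix[OF assms(1,2)] by blast
  obtain B where B: "B \<subseteq> rows M" "vec.independent B" "card B = rank M"
    using vec.basis_exists[of "rows M"] unfolding row_rank_def_gen by metis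
  have finB: "finite B"
    by simp
  have count: "?p ^ card B * real (card {h. \<forall>b\<in>B. scalar_product b h = 0}) = real CARD(('p mod_ring)^'d)"
  proof (rule card_linear_forms[OF finB])
    show "additive_map (scalar_product b)" for b :: "('p mod_ring)^'d"
      by (simp add: additive_map_def scalar_product_def distrib_left sum.distrib)
    fix l :: "('p mod_ring)^'d \<Rightarrow> 'p mod_ring"
    assume "\<exists>j\<in>B. l j \<noteq> 0"
    then have "(\<Sum>b\<in>B. l b *s b) \<noteq> 0"
      using B(2) vec.dependent_finite[OF finB] by blast
    then obtain i where "(\<Sum>b\<in>B. l b *s b) $ i \<noteq> 0"
      by (auto simp: vec_eq_iff)
    then have "(\<Sum>b\<in>B. l b * scalar_product b (axis i 1)) \<noteq> 0"
      by (simp add: scalar_product_def axis_def if_distrib cong: if_cong)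
    then show "\<exists>x. (\<Sum>b\<in>B. l b * scalar_product b x) \<noteq> 0"
      by blast
  qed
  have "{h. \<forall>x. polar f h x = 0} \<subseteq> {h. \<forall>b\<in>B. scalar_product b h = 0}"
  proof safe
    fix h b
    assume h: "\<forall>x. polar f h x = 0" and "b \<in> B"
    then obtain i where b: "b = row i M"
      using B(1) by (auto simp: rows_def)
    have "2 * scalar_product (axis i 1) (M *v h) = 0"
      using h polar by metis
    then have "scalar_product (axis i 1) (M *v h) = 0"
      using two_neq_zero_mod_ring[OF assms(2)] by simp
    then have "(M *v h) $ i = 0"
      by (simp add: scalar_product_def axis_def if_distrib if_distribR cong: if_cong)
    then show "scalar_product b h = 0"
      by (simp add: b scalar_product_def matrix_vector_mult_def row_def)
  qed
  then have "card {h. \<forall>x. polar f h x = 0} \<le> card {h. \<forall>b\<in>B. scalar_product b h = 0}"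
    by (intro card_mono) auto
  then have "?p ^ R * real (card {h. \<forall>x. polar f h x = 0}) \<le> ?p ^ card B * real (card {h. \<forall>b\<in>B. scalar_product b h = 0})"
    using assms(3) M B(3) p by (intro mult_mono power_increasing) auto
  then show ?thesis
    unfolding count using p by (simp add: field_simps)
qed

section \<open>Point counts on varieties of high rank\<close>

text \<open>
  High rank enters only through the relative size \<open>\<rho>\<close> of the radicals. The exponents of \<open>q\<close> in
  \<open>rho1\<close> and \<open>rho2\<close> are chosen with room to spare: configurations of at most four points and one
  further functional are counted, so relative errors are at most \<open>q\<^sup>4 p\<close> times the
  exponential sum bound \<open>sqrt \<rho>\<close>, and exceptional shifts are weighed against powers of \<open>q\<close> below the
  twentieth.
\<close>

locale high_rank_variety =
  fixes s :: nat and Q :: "nat \<Rightarrow> ('p::prime_card mod_ring)^'d \<Rightarrow> 'p mod_ring"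
    and \<rho> \<epsilon> N q :: real
  defines "N \<equiv> real CARD(('p mod_ring)^'d)"
    and "q \<equiv> real CARD('p) ^ s"
  assumes quadratic: "i < s \<Longrightarrow> quadratic (Q i)"
    and radical: "\<exists>i<s. l i \<noteq> 0 \<Longrightarrow>
       real (card {h. \<forall>x. (\<Sum>i<s. l i * polar (Q i) h x) = 0}) \<le> \<rho> * N"
    and p3: "CARD('p) \<ge> 3"
    and rho0: "0 \<le> \<rho>"
    and rho1: "10 * q ^ 20 * \<rho> \<le> \<epsilon>"
    and rho2: "10 * q ^ 4 * real CARD('p) * sqrt \<rho> \<le> 1"
    and eps: "0 < \<epsilon>" "\<epsilon> < 1 / 2 ^ 100"
begin

definition Z :: "(('p mod_ring)^'d) set" where
  "Z = {x. \<forall>i<s. Q i x = 0}"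

text \<open>
  The functionals \<open>polar (Q i) h\<close>, for \<open>i < s\<close> and \<open>h\<close> in the list, are linearly independent as an
  indexed family.
\<close>

definition generic :: "(('p mod_ring)^'d) list \<Rightarrow> bool" where
  "generic hs \<longleftrightarrow> (\<forall>c. (\<exists>k<length hs. \<exists>i<s. c k i \<noteq> 0) \<longrightarrow>
     (\<exists>x. (\<Sum>k<length hs. \<Sum>i<s. c k i * polar (Q i) (hs ! k) x) \<noteq> 0))"

lemma N_pos: "N > 0"
  by (simp add: N_def)

lemma q_ge1: "q \<ge> 1"
  using p3 by (simp add: q_def)

lemmas add_polar = additive_map_polar[OF quadratic]

lemma generic_Nil [simp]: "generic []"
  by (simp add: generic_def)

text \<open>
  A dependence that uses the new shift \<open>b\<close> fixes a nontrivial combination of the \<open>polar (Q i) b\<close>,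
  which determines \<open>b\<close> up to the radical of that combination.
\<close>

lemma card_not_generic_Cons:
  assumes "generic hs"
  shows "real (card {b. \<not> generic (b # hs)}) \<le> q ^ (length hs + 1) * \<rho> * N"
proof -
  let ?n = "length hs"
  define C where "C = {c \<in> ({..<Suc ?n} \<times> {..<s}) \<rightarrow>\<^sub>E (UNIV :: 'p mod_ring set). \<exists>i<s. c (0, i) \<noteq> 0}"
  define W where "W c = {b. \<forall>x. (\<Sum>i<s. c (0, i) * polar (Q i) b x) +
     (\<Sum>k<?n. \<Sum>i<s. c (Suc k, i) * polar (Q i) (hs ! k) x) = 0}" for c :: "nat \<times> nat \<Rightarrow> 'p mod_ring"
  have finC: "finite C"
    unfolding C_def by (simp add: finite_PiE)
  have "real (card C) \<le> real (card (({..<Suc ?n} \<times> {..<s}) \<rightarrow>\<^sub>E (UNIV :: 'p mod_ring set)))"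
    unfolding C_def by (intro of_nat_mono card_mono) (auto simp: finite_PiE)
  also have "\<dots> = q ^ (?n + 1)"
    by (simp add: card_PiE q_def power_mult [symmetric] power_add [symmetric] algebra_simps)
  finally have cardC: "real (card C) \<le> q ^ (?n + 1)" .
  have W: "real (card (W c)) \<le> \<rho> * N" if c: "c \<in> C" for c
  proof (cases "W c = {}")
    case True
    then show ?thesis
      using rho0 N_pos by simp
  next
    case False
    then obtain b0 where b0: "b0 \<in> W c"
      by blast
    let ?r = "{h. \<forall>x. (\<Sum>i<s. c (0, i) * polar (Q i) h x) = 0}"
    have "card (W c) \<le> card ?r"
    proof (rule card_inj_on_le[of "\<lambda>b. b - b0"])
      show "(\<lambda>b. b - b0) ` W c \<subseteq> ?r"
      proof safe
        fix b x
        assume "b \<in> W c"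
        then have "(\<Sum>i<s. c (0, i) * polar (Q i) b x) = (\<Sum>i<s. c (0, i) * polar (Q i) b0 x)"
          using b0 unfolding W_def mem_Collect_eq by (metis (no_types, lifting) add_right_cancel)
        then show "(\<Sum>i<s. c (0, i) * polar (Q i) (b - b0) x) = 0"
          by (simp add: additive_map_diff[OF add_polar(2)] right_diff_distrib sum_subtractf)
      qed
    qed (auto simp: inj_on_def)
    moreover have "real (card ?r) \<le> \<rho> * N"
      using c by (intro radical) (auto simp: C_def)
    ultimately show ?thesis
      by linarith
  qed
  have "{b. \<not> generic (b # hs)} \<subseteq> (\<Union>c\<in>C. W c)"
  proof
    fix b
    assume "b \<in> {b. \<not> generic (b # hs)}"
    then obtain c where c: "\<exists>k<Suc ?n. \<exists>i<s. c k i \<noteq> 0"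
      and zero: "\<And>x. (\<Sum>k<Suc ?n. \<Sum>i<s. c k i * polar (Q i) ((b # hs) ! k) x) = 0"
      by (auto simp: generic_def)
    have zero': "(\<Sum>i<s. c 0 i * polar (Q i) b x) + (\<Sum>k<?n. \<Sum>i<s. c (Suc k) i * polar (Q i) (hs ! k) x) = 0" for x
      using zero[of x] by (simp add: sum.lessThan_Suc_shift del: sum.lessThan_Suc)
    have c0: "\<exists>i<s. c 0 i \<noteq> 0"
    proof (rule ccontr)
      assume "\<not> ?thesis"
      then have c0: "\<forall>i<s. c 0 i = 0"
        by blast
      then have "\<exists>k<?n. \<exists>i<s. c (Suc k) i \<noteq> 0"
        using c by (metis not0_implies_Suc Suc_less_eq)
      then have "\<exists>x. (\<Sum>k<?n. \<Sum>i<s. c (Suc k) i * polar (Q i) (hs ! k) x) \<noteq> 0"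
        using assms[unfolded generic_def, rule_format, of "\<lambda>k i. c (Suc k) i"] by blast
      with zero' c0 show False
        by simp
    qed
    define c' where "c' = (\<lambda>(k, i)\<in>{..<Suc ?n} \<times> {..<s}. c k i)"
    have "c' \<in> C"
      using c0 by (auto simp: C_def c'_def)
    moreover have "b \<in> W c'"
      using zero' by (simp add: W_def c'_def)
    ultimately show "b \<in> (\<Union>c\<in>C. W c)"
      by blast
  qed
  then have "card {b. \<not> generic (b # hs)} \<le> card (\<Union>c\<in>C. W c)"
    by (intro card_mono) auto
  also have "\<dots> \<le> (\<Sum>c\<in>C. card (W c))"
    by (rule card_UN_le[OF finC])
  finally have "real (card {b. \<not> generic (b # hs)}) \<le> (\<Sum>c\<in>C. real (card (W c)))"
    by (metis of_nat_le_iff of_nat_sum)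
  also have "\<dots> \<le> (\<Sum>c\<in>C. \<rho> * N)"
    by (rule sum_mono[OF W])
  also have "\<dots> = real (card C) * (\<rho> * N)"
    by simp
  also have "\<dots> \<le> q ^ (?n + 1) * (\<rho> * N)"
    using cardC rho0 N_pos by (intro mult_right_mono) auto
  finally show ?thesis
    by (simp add: mult.assoc)
qed

lemma exponential_sum_bound:
  assumes "additive_map \<alpha>" and "\<exists>i\<in>{..<s}. l i \<noteq> 0"
  shows "norm (\<Sum>x\<in>UNIV. additive_char ((\<Sum>i\<in>{..<s}. l i * Q i x) + \<alpha> x + c)) \<le> sqrt \<rho> * real CARD(('p mod_ring)^'d)"
proof (rule weyl_bound)
  let ?b = "\<lambda>h x. \<Sum>i<s. l i * polar (Q i) h x"
  let ?c = "\<lambda>h. (\<Sum>i<s. l i * (Q i h - Q i 0)) + \<alpha> h"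
  fix x h
  have "(\<Sum>i<s. l i * Q i (x + h)) - (\<Sum>i<s. l i * Q i x) = ?b h x + (\<Sum>i<s. l i * (Q i h - Q i 0))"
    by (simp add: polar_def sum_subtractf [symmetric] sum.distrib [symmetric] algebra_simps)
  then show "(\<Sum>i\<in>{..<s}. l i * Q i (x + h)) + \<alpha> (x + h) + c - ((\<Sum>i\<in>{..<s}. l i * Q i x) + \<alpha> x + c) = ?b h x + ?c h"
    by (simp add: additive_map_add[OF assms(1)] algebra_simps)
  show "additive_map (?b h)"
    by (simp add: additive_map_def additive_map_add[OF add_polar(1)] distrib_left sum.distrib)
  show "real (card {h. \<forall>x. ?b h x = 0}) \<le> \<rho> * real CARD(('p mod_ring)^'d)"
    using radical[of l] assms(2) by (simp add: N_def Bex_def)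
qed

text \<open>
  Equidistribution for the functionals attached to a generic list. The third part adds a functional
  \<open>E\<close> outside their span; the extra factor \<open>p\<close> says that \<open>E\<close> cannot concentrate on a single value.
\<close>

lemma count_Z:
  fixes c :: "nat \<Rightarrow> nat \<Rightarrow> 'p mod_ring"
  assumes "generic hs" and "length hs \<le> 3"
  defines "A \<equiv> {x \<in> Z. \<forall>k<length hs. \<forall>i<s. polar (Q i) (hs ! k) x = c k i}"
  shows "9/10 * N \<le> q ^ (length hs + 1) * real (card A)"
    and "q ^ (length hs + 1) * real (card A) \<le> 11/10 * N"
    and "additive_map E \<Longrightarrow>
       (\<And>c. \<exists>x. E x \<noteq> (\<Sum>k<length hs. \<Sum>i<s. c k i * polar (Q i) (hs ! k) x)) \<Longrightarrow>
       real CARD('p) * q ^ (length hs + 1) * real (card {x \<in> A. E x = e}) \<le> 11/10 * N"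
proof -
  let ?n = "length hs" and ?p = "real CARD('p)"
  let ?J = "{..<?n} \<times> {..<s}"
  let ?F = "\<lambda>(k, i). polar (Q i) (hs ! k)"
  have p1: "?p \<ge> 1"
    using p3 by simp
  have qn: "q ^ (?n + 1) \<le> q ^ 4"
    using assms(2) q_ge1 by (intro power_increasing) auto
  have pw: "q * ?p ^ card ?J = q ^ (?n + 1)"
    by (simp add: q_def power_mult [symmetric] power_add [symmetric] algebra_simps)
  have small: "P * sqrt \<rho> * N \<le> N / 10" if "P \<le> q ^ 4 * ?p" for P
  proof -
    have "P * sqrt \<rho> \<le> q ^ 4 * ?p * sqrt \<rho>"
      using that rho0 by (intro mult_right_mono) auto
    also have "\<dots> \<le> 1 / 10"
      using rho2 by simp
    finally have "P * sqrt \<rho> * N \<le> 1 / 10 * N"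
      using N_pos by (intro mult_right_mono) auto
    then show ?thesis
      by simp
  qed
  have sumJ: "(\<Sum>j\<in>?J. l j * ?F j x) = (\<Sum>k<?n. \<Sum>i<s. l (k, i) * polar (Q i) (hs ! k) x)" for l x
    by (simp add: sum.cartesian_product case_prod_unfold)
  have "\<bar>real CARD('p) ^ card {..<s} * real CARD('p) ^ card ?J *
      real (card {x. (\<forall>i\<in>{..<s}. Q i x = 0) \<and> (\<forall>j\<in>?J. ?F j x = (case j of (k, i) \<Rightarrow> c k i))}) - real CARD(('p mod_ring)^'d)\<bar>
      \<le> real CARD('p) ^ card {..<s} * real CARD('p) ^ card ?J * sqrt \<rho> * real CARD(('p mod_ring)^'d)"
  proof (rule equidistribution)
    show "additive_map (?F j)" if "j \<in> ?J" for j
      using that add_polar(1) by auto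
    show "\<exists>x. (\<Sum>j\<in>?J. l j * ?F j x) \<noteq> 0" if "\<exists>j\<in>?J. l j \<noteq> 0" for l
      using assms(1)[unfolded generic_def, rule_format, of "\<lambda>k i. l (k, i)"] that unfolding sumJ by auto
  qed (use exponential_sum_bound rho0 in auto)
  moreover have "{x. (\<forall>i\<in>{..<s}. Q i x = 0) \<and> (\<forall>j\<in>?J. ?F j x = (case j of (k, i) \<Rightarrow> c k i))} = A"
    by (auto simp: A_def Z_def)
  ultimately have "\<bar>q ^ (?n + 1) * real (card A) - N\<bar> \<le> q ^ (?n + 1) * sqrt \<rho> * N"
    unfolding N_def[symmetric] card_lessThan q_def[symmetric] pw by simp
  moreover have "q ^ (?n + 1) \<le> q ^ 4 * ?p"
    using qn p1 q_ge1 by (smt (verit) mult_left_le mult_le_cancel_left1 zero_le_power)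
  ultimately have "\<bar>q ^ (?n + 1) * real (card A) - N\<bar> \<le> N / 10"
    using small by (meson order_trans)
  then show "9/10 * N \<le> q ^ (?n + 1) * real (card A)" "q ^ (?n + 1) * real (card A) \<le> 11/10 * N"
    by linarith+
  assume E: "additive_map E"
    and indep: "\<And>c. \<exists>x. E x \<noteq> (\<Sum>k<?n. \<Sum>i<s. c k i * polar (Q i) (hs ! k) x)"
  \<comment> \<open>The free index \<open>(?n, 0)\<close> carries the functional \<open>E\<close>.\<close>
  let ?J' = "insert (?n, 0) ?J"
  let ?F' = "\<lambda>(k, i). if k < ?n then polar (Q i) (hs ! k) else E"
  have notin: "(?n, 0) \<notin> ?J"
    by simp
  have sumJ': "(\<Sum>j\<in>?J'. l j * ?F' j x) = l (?n, 0) * E x + (\<Sum>k<?n. \<Sum>i<s. l (k, i) * polar (Q i) (hs ! k) x)" for l x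
  proof -
    have "(\<Sum>j\<in>?J. l j * ?F' j x) = (\<Sum>j\<in>?J. l j * ?F j x)"
      by (intro sum.cong) auto
    then show ?thesis
      using sumJ[of l x] notin by simp
  qed
  have "\<bar>real CARD('p) ^ card {..<s} * real CARD('p) ^ card ?J' *
      real (card {x. (\<forall>i\<in>{..<s}. Q i x = 0) \<and> (\<forall>j\<in>?J'. ?F' j x = (case j of (k, i) \<Rightarrow> if k < ?n then c k i else e))}) - real CARD(('p mod_ring)^'d)\<bar>
      \<le> real CARD('p) ^ card {..<s} * real CARD('p) ^ card ?J' * sqrt \<rho> * real CARD(('p mod_ring)^'d)"
  proof (rule equidistribution)
    show "additive_map (?F' j)" if "j \<in> ?J'" for j
      using that add_polar(1) E by auto
    show "\<exists>x. (\<Sum>j\<in>?J'. l j * ?F' j x) \<noteq> 0" if l: "\<exists>j\<in>?J'. l j \<noteq> 0" for l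
    proof (cases "l (?n, 0) = 0")
      case True
      then show ?thesis
        using assms(1)[unfolded generic_def, rule_format, of "\<lambda>k i. l (k, i)"] l unfolding sumJ' by auto
    next
      case False
      obtain x where x: "E x \<noteq> (\<Sum>k<?n. \<Sum>i<s. (- l (k, i) / l (?n, 0)) * polar (Q i) (hs ! k) x)"
        using indep[of "\<lambda>k i. - l (k, i) / l (?n, 0)"] by blast
      have "l (?n, 0) * (\<Sum>k<?n. \<Sum>i<s. (- l (k, i) / l (?n, 0)) * polar (Q i) (hs ! k) x) =
          - (\<Sum>k<?n. \<Sum>i<s. l (k, i) * polar (Q i) (hs ! k) x)"
        using False by (simp add: sum_distrib_left sum_negf [symmetric])
      moreover have "l (?n, 0) * E x \<noteq> l (?n, 0) * (\<Sum>k<?n. \<Sum>i<s. (- l (k, i) / l (?n, 0)) * polar (Q i) (hs ! k) x)"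
        using x False by simp
      ultimately have "l (?n, 0) * E x \<noteq> - (\<Sum>k<?n. \<Sum>i<s. l (k, i) * polar (Q i) (hs ! k) x)"
        by simp
      then show ?thesis
        unfolding sumJ' using eq_neg_iff_add_eq_0 by blast
    qed
  qed (use exponential_sum_bound rho0 in auto)
  note bound = this
  have set_eq: "{x. (\<forall>i\<in>{..<s}. Q i x = 0) \<and> (\<forall>j\<in>?J'. ?F' j x = (case j of (k, i) \<Rightarrow> if k < ?n then c k i else e))} = {x \<in> A. E x = e}"
    by (auto simp: A_def Z_def)
  have pw': "real CARD('p) ^ card {..<s} * real CARD('p) ^ card ?J' = ?p * q ^ (?n + 1)"
    using pw notin by (simp add: q_def)
  have "\<bar>?p * q ^ (?n + 1) * real (card {x \<in> A. E x = e}) - N\<bar> \<le> ?p * q ^ (?n + 1) * sqrt \<rho> * N"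
    using bound unfolding set_eq pw' N_def[symmetric] .
  moreover have "?p * q ^ (?n + 1) \<le> q ^ 4 * ?p"
    using qn p1 by (simp add: mult.commute)
  ultimately have "\<bar>?p * q ^ (?n + 1) * real (card {x \<in> A. E x = e}) - N\<bar> \<le> N / 10"
    using small by (meson order_trans)
  then show "?p * q ^ (?n + 1) * real (card {x \<in> A. E x = e}) \<le> 11/10 * N"
    by linarith
qed

end


section \<open>First derivatives are affine on most slices\<close>

context high_rank_variety
begin

definition translates :: "(('p mod_ring)^'d) list \<Rightarrow> (('p mod_ring)^'d) set" where
  "translates hs = {x \<in> Z. \<forall>h\<in>set hs. x + h \<in> Z}"

text \<open>
  On \<open>Z\<close> a further translate imposes only linear conditions, since the quadratic parts cancel.
\<close>

lemma mem_Z_shift: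
  assumes "x \<in> Z"
  shows "x + h \<in> Z \<longleftrightarrow> (\<forall>i<s. polar (Q i) h x = Q i 0 - Q i h)"
  using assms by (auto simp: Z_def polar_def algebra_simps)

lemma translates_eq:
  "translates hs = {x \<in> Z. \<forall>k<length hs. \<forall>i<s. polar (Q i) (hs ! k) x = Q i 0 - Q i (hs ! k)}"
  by (auto simp: translates_def all_set_conv_all_nth mem_Z_shift)

lemma card_translates:
  assumes "generic hs" and "length hs \<le> 3"
  shows "9/10 * N \<le> q ^ (length hs + 1) * real (card (translates hs))"
    and "q ^ (length hs + 1) * real (card (translates hs)) \<le> 11/10 * N"
    and "additive_map E \<Longrightarrow>
       (\<And>c. \<exists>x. E x \<noteq> (\<Sum>k<length hs. \<Sum>i<s. c k i * polar (Q i) (hs ! k) x)) \<Longrightarrow>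
       real CARD('p) * q ^ (length hs + 1) * real (card {x \<in> translates hs. E x = e}) \<le> 11/10 * N"
  unfolding translates_eq by (rule count_Z[OF assms]; assumption)+

lemma generic_add:
  assumes "generic (b # a # hs)"
  shows "generic ((a + b) # a # hs)"
  unfolding generic_def
proof (intro allI impI)
  fix c :: "nat \<Rightarrow> nat \<Rightarrow> 'p mod_ring"
  assume c: "\<exists>k<length ((a + b) # a # hs). \<exists>i<s. c k i \<noteq> 0"
  define c' where "c' k i = (if k = 1 then c 0 i + c 1 i else c k i)" for k i
  have "\<exists>k<length (b # a # hs). \<exists>i<s. c' k i \<noteq> 0"
  proof (rule ccontr)
    assume "\<not> ?thesis"
    then have 0: "c' k i = 0" if "k < length hs + 2" "i < s" for k i
      using that by auto
    then have "c k i = 0" if "k < length hs + 2" "i < s" for k i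
      using 0[OF that] 0[of 0 i] that by (cases "k = 1") (auto simp: c'_def)
    with c show False
      by auto
  qed
  then obtain x where "(\<Sum>k<length (b # a # hs). \<Sum>i<s. c' k i * polar (Q i) ((b # a # hs) ! k) x) \<noteq> 0"
    using assms unfolding generic_def by blast
  moreover have "(\<Sum>k<length ((a + b) # a # hs). \<Sum>i<s. c k i * polar (Q i) (((a + b) # a # hs) ! k) x) =
      (\<Sum>k<length (b # a # hs). \<Sum>i<s. c' k i * polar (Q i) ((b # a # hs) ! k) x)"
    by (simp add: sum.lessThan_Suc_shift c'_def additive_map_add[OF add_polar(2)] algebra_simps sum.distrib
        del: sum.lessThan_Suc)
  ultimately show "\<exists>x. (\<Sum>k<length ((a + b) # a # hs). \<Sum>i<s. c k i * polar (Q i) (((a + b) # a # hs) ! k) x) \<noteq> 0"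
    by metis
qed

definition perp :: "('p mod_ring)^'d \<Rightarrow> (('p mod_ring)^'d) set" where
  "perp h = {a. \<forall>i<s. polar (Q i) h a = 0}"

lemma subgroup_perp: "subgroup_set (perp h)"
  by (auto simp: subgroup_set_def perp_def additive_map_add[OF add_polar(1)]
      additive_map_diff[OF add_polar(1)] additive_map_zero[OF add_polar(1)])

lemma card_slice:
  assumes "generic [h]"
  shows "q * real (card {x. \<forall>i<s. polar (Q i) h x = c i}) = N"
proof -
  have "real CARD('p) ^ card {..<s} * real (card {x. \<forall>i\<in>{..<s}. polar (Q i) h x = c i}) = real CARD(('p mod_ring)^'d)"
  proof (rule card_linear_forms)
    show "\<exists>x. (\<Sum>i<s. l i * polar (Q i) h x) \<noteq> 0" if "\<exists>i\<in>{..<s}. l i \<noteq> 0" for l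
      using assms[unfolded generic_def, rule_format, of "\<lambda>_. l"] that by auto
  qed (use add_polar(1) in auto)
  then show ?thesis
    by (simp add: q_def N_def Ball_def)
qed

lemma card_perp:
  assumes "generic [h]"
  shows "q * real (card (perp h)) = N"
  unfolding perp_def by (rule card_slice[OF assms])

text \<open>
  A basis dual to the functionals \<open>polar (Q i) h\<close>, which exists because every value vector is
  attained by \<open>card_slice\<close>, yields an additive projection \<open>pr\<close> onto \<open>perp h\<close>.
\<close>

lemma extend_from_perp:
  fixes g :: "('p mod_ring)^'d \<Rightarrow> 'k::ab_group_add"
  assumes "generic [h]"
    and g: "\<And>a b. a \<in> perp h \<Longrightarrow> b \<in> perp h \<Longrightarrow> g (a + b) = g a + g b"
  obtains M where "additive_map M" and "\<And>a. a \<in> perp h \<Longrightarrow> M a = g a"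
proof -
  have "\<exists>e. \<forall>i<s. polar (Q i) h e = (if i = j then 1 else 0)" for j
  proof -
    let ?S = "{x. \<forall>i<s. polar (Q i) h x = (if i = j then 1 else 0)}"
    have "q * real (card ?S) = N"
      by (rule card_slice[OF assms(1)])
    then have "?S \<noteq> {}"
      using N_pos by (metis card.empty mult_zero_right of_nat_0 less_irrefl)
    then show ?thesis
      by blast
  qed
  then obtain e where e: "\<And>i j. i < s \<Longrightarrow> polar (Q i) h (e j) = (if i = j then 1 else 0)"
    by metis
  define pr where "pr a = a - (\<Sum>j<s. polar (Q j) h a *s e j)" for a
  have pr: "pr a \<in> perp h" for a
    by (simp add: perp_def pr_def additive_map_diff[OF add_polar(1)] additive_map_sum[OF add_polar(1)]
        additive_map_scale[OF add_polar(1)] e if_distrib cong: if_cong)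
  have "pr (a + b) = pr a + pr b" for a b
    by (simp add: pr_def additive_map_add[OF add_polar(1)] vector_sadd_rdistrib sum.distrib)
  then have "additive_map (\<lambda>a. g (pr a))"
    using g[OF pr pr] by (simp add: additive_map_def)
  moreover have "g (pr a) = g a" if "a \<in> perp h" for a
    using that by (simp add: perp_def pr_def)
  ultimately show thesis
    using that by blast
qed

lemma diff_mem_perp:
  assumes "x \<in> Z" "x + h \<in> Z" "y \<in> Z" "y + h \<in> Z"
  shows "y - x \<in> perp h"
  using assms mem_Z_shift[of x h] mem_Z_shift[of y h]
  by (auto simp: perp_def additive_map_diff[OF add_polar(1)])

text \<open>
  Membership of \<open>y + h\<close> in \<open>Z\<close> is decided by the values \<open>polar (Q i) h y\<close>, which do not change
  when \<open>y\<close> moves by an element of \<open>perp h\<close>. Every pair of sides of a cube in \<open>Z\<close> is orthogonal, which is why such a cube imposes fewer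
  independent conditions than it has corners.
\<close>

lemma parallelogram_mem_Z:
  assumes "x \<in> Z" "x + h \<in> Z" "x + a \<in> Z" "a \<in> perp h"
  shows "x + a + h \<in> Z"
proof -
  have "polar (Q i) h (x + a) = Q i 0 - Q i h" if "i < s" for i
    using assms mem_Z_shift[of x h] that by (auto simp: perp_def additive_map_add[OF add_polar(1)])
  then show ?thesis
    using assms mem_Z_shift[of "x + a" h] by auto
qed

lemma card_not_generic1: "real (card {h. \<not> generic [h]}) \<le> q * \<rho> * N"
  using card_not_generic_Cons[of "[]"] by simp

lemma card_not_generic2: "generic [h] \<Longrightarrow> real (card {a. \<not> generic [a, h]}) \<le> q\<^sup>2 * \<rho> * N"
  using card_not_generic_Cons[of "[h]"] by (simp add: power2_eq_square)

lemma card_not_generic3: "generic [a, h] \<Longrightarrow> real (card {b. \<not> generic [b, a, h]}) \<le> q ^ 3 * \<rho> * N"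
  using card_not_generic_Cons[of "[a, h]"] by (simp add: power3_eq_cube mult.assoc)

lemma rho_small:
  assumes "k \<le> 20"
  shows "q ^ k * \<rho> \<le> \<epsilon> / 10"
proof -
  have "q ^ k * \<rho> \<le> q ^ 20 * \<rho>"
    using assms q_ge1 rho0 by (intro mult_right_mono power_increasing) auto
  then show ?thesis
    using rho1 by linarith
qed

definition parallelograms :: "('p mod_ring)^'d \<Rightarrow> ('p mod_ring)^'d \<Rightarrow> (('p mod_ring)^'d) set" where
  "parallelograms h a = {x. x \<in> Z \<and> x + h \<in> Z \<and> x + a \<in> Z \<and> x + a + h \<in> Z}"

lemma parallelograms_subset: "parallelograms h a \<subseteq> translates [a, h]"
  by (auto simp: parallelograms_def translates_def)

lemma parallelograms_eq: "a \<in> perp h \<Longrightarrow> parallelograms h a = translates [a, h]"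
  by (auto simp: parallelograms_def translates_def parallelogram_mem_Z)

lemma parallelograms_empty:
  assumes "a \<notin> perp h"
  shows "parallelograms h a = {}"
proof (rule ccontr)
  assume "parallelograms h a \<noteq> {}"
  then obtain x where "x \<in> Z" "x + h \<in> Z" "x + a \<in> Z" "x + a + h \<in> Z"
    by (auto simp: parallelograms_def)
  then have "(x + a) - x \<in> perp h"
    by (intro diff_mem_perp)
  with assms show False
    by simp
qed

lemma card_le_N: "real (card (A :: (('p mod_ring)^'d) set)) \<le> N"
  unfolding N_def by (intro of_nat_mono card_mono) auto

lemma cubes_in_Z_iff:
  "(x, h, a, k) \<in> cubes_in Z \<longleftrightarrow> x \<in> parallelograms h a \<and> x + k \<in> parallelograms h a"
  by (auto simp: cubes_in_def parallelograms_def all_bool_eq algebra_simps)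

text \<open>
  A cube is a pair of parallelograms with the same sides \<open>(h, a)\<close>. There are about \<open>N\<^sup>2 / q\<close>
  orthogonal pairs of sides and about \<open>N / q\<^sup>3\<close> base points for each, so about
  \<open>(N\<^sup>2 / q) (N / q\<^sup>3)\<^sup>2 = N\<^sup>4 / q\<^sup>7\<close> cubes.
\<close>

lemma card_cubes_in_Z: "q ^ 7 * real (card (cubes_in Z)) \<le> 2 * N ^ 4"
proof -
  let ?n = "\<lambda>h a. card (parallelograms h a)"
  have "card (cubes_in Z) = card (SIGMA h:UNIV. SIGMA a:UNIV. parallelograms h a \<times> parallelograms h a)"
    by (rule bij_betw_same_card[of "\<lambda>(x, h, a, k). (h, a, x, x + k)"],
        rule bij_betwI[where g = "\<lambda>(h, a, x, y). (x, h, a, y - x)"]) (auto simp: cubes_in_Z_iff)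
  also have "\<dots> = (\<Sum>h\<in>UNIV. \<Sum>a\<in>UNIV. ?n h a * ?n h a)"
    by (simp add: card_SigmaI card_cartesian_product)
  finally have eq: "real (card (cubes_in Z)) = (\<Sum>h\<in>UNIV. \<Sum>a\<in>UNIV. (real (?n h a))\<^sup>2)"
    by (simp add: power2_eq_square)
  have n_le: "(real (?n h a))\<^sup>2 \<le> N\<^sup>2" for h a
    using card_le_N by (intro power_mono) auto
  have gen: "q ^ 7 * (\<Sum>a\<in>UNIV. (real (?n h a))\<^sup>2) \<le> 132/100 * N ^ 3" if h: "generic [h]" for h
  proof -
    have n_gen: "q ^ 6 * (real (?n h a))\<^sup>2 \<le> 121/100 * N\<^sup>2" if a: "generic [a, h]" for a
    proof -
      have "q ^ 3 * real (?n h a) \<le> q ^ 3 * real (card (translates [a, h]))"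
        using q_ge1 by (intro mult_left_mono of_nat_mono card_mono parallelograms_subset) auto
      also have "\<dots> \<le> 11/10 * N"
        using card_translates(2)[OF a] by (simp add: eval_nat_numeral)
      finally have "(q ^ 3 * real (?n h a))\<^sup>2 \<le> (11/10 * N)\<^sup>2"
        using q_ge1 by (intro power_mono) auto
      moreover have "(q ^ 3 * real (?n h a))\<^sup>2 = q ^ 6 * (real (?n h a))\<^sup>2"
        by (simp add: power_mult_distrib flip: power_mult)
      moreover have "(11/10 * N)\<^sup>2 = 121/100 * N\<^sup>2"
        by (simp add: power2_eq_square)
      ultimately show ?thesis
        by simp
    qed
    have "(\<Sum>a\<in>UNIV. (real (?n h a))\<^sup>2) = (\<Sum>a\<in>perp h. (real (?n h a))\<^sup>2)"
      by (rule sum.mono_neutral_right) (auto simp: parallelograms_empty)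
    also have "q ^ 6 * \<dots> \<le> (\<Sum>a\<in>perp h. 121/100 * N\<^sup>2 + (if generic [a, h] then 0 else q ^ 6 * N\<^sup>2))"
      unfolding sum_distrib_left
    proof (rule sum_mono)
      fix a
      show "q ^ 6 * (real (?n h a))\<^sup>2 \<le> 121/100 * N\<^sup>2 + (if generic [a, h] then 0 else q ^ 6 * N\<^sup>2)"
      proof (cases "generic [a, h]")
        case True
        then show ?thesis
          using n_gen[of a] by simp
      next
        case False
        have "q ^ 6 * (real (?n h a))\<^sup>2 \<le> q ^ 6 * N\<^sup>2"
          using n_le q_ge1 by (intro mult_left_mono) auto
        moreover have "0 \<le> 121/100 * N\<^sup>2"
          by simp
        ultimately show ?thesis
          unfolding if_not_P[OF False] by linarith
      qed
    qed
    also have "\<dots> \<le> real (card (perp h)) * (121/100 * N\<^sup>2) + real (card {a. \<not> generic [a, h]}) * (q ^ 6 * N\<^sup>2)"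
    proof -
      have "(\<Sum>a\<in>perp h. if generic [a, h] then 0 else q ^ 6 * N\<^sup>2) \<le> (\<Sum>a\<in>UNIV. if generic [a, h] then 0 else q ^ 6 * N\<^sup>2)"
        using q_ge1 by (intro sum_mono2) auto
      also have "\<dots> = real (card {a. \<not> generic [a, h]}) * (q ^ 6 * N\<^sup>2)"
        by (simp add: sum.If_cases Collect_neg_eq)
      finally show ?thesis
        by (simp add: sum.distrib)
    qed
    finally have "q * (q ^ 6 * (\<Sum>a\<in>UNIV. (real (?n h a))\<^sup>2)) \<le>
        q * (real (card (perp h)) * (121/100 * N\<^sup>2) + real (card {a. \<not> generic [a, h]}) * (q ^ 6 * N\<^sup>2))"
      using q_ge1 by (intro mult_left_mono) auto
    also have "\<dots> = (q * real (card (perp h))) * (121/100 * N\<^sup>2) + real (card {a. \<not> generic [a, h]}) * (q ^ 7 * N\<^sup>2)"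
      by (simp add: algebra_simps eval_nat_numeral)
    also have "\<dots> \<le> N * (121/100 * N\<^sup>2) + (q\<^sup>2 * \<rho> * N) * (q ^ 7 * N\<^sup>2)"
      using card_not_generic2[OF h] card_perp[OF h] q_ge1 by (intro add_mono mult_right_mono) auto
    also have "\<dots> = (121/100 + q ^ 9 * \<rho>) * N ^ 3"
      by (simp add: algebra_simps eval_nat_numeral)
    also have "\<dots> \<le> 132/100 * N ^ 3"
      using rho_small[of 9] eps N_pos by (intro mult_right_mono) auto
    finally show ?thesis
      by (simp add: eval_nat_numeral mult.assoc)
  qed
  have "q ^ 7 * real (card (cubes_in Z)) = (\<Sum>h\<in>UNIV. q ^ 7 * (\<Sum>a\<in>UNIV. (real (?n h a))\<^sup>2))"
    unfolding eq by (rule sum_distrib_left)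
  also have "\<dots> \<le> (\<Sum>h\<in>UNIV. 132/100 * N ^ 3 + (if generic [h] then 0 else q ^ 7 * N ^ 3))"
  proof (rule sum_mono)
    fix h
    have "(\<Sum>a\<in>UNIV. (real (?n h a))\<^sup>2) \<le> (\<Sum>a\<in>(UNIV :: (('p mod_ring)^'d) set). N\<^sup>2)"
      using n_le by (rule sum_mono)
    also have "\<dots> = N ^ 3"
      unfolding sum_constant N_def[symmetric] by (simp add: eval_nat_numeral)
    finally have upper: "q ^ 7 * (\<Sum>a\<in>UNIV. (real (?n h a))\<^sup>2) \<le> q ^ 7 * N ^ 3"
      using q_ge1 by (intro mult_left_mono) auto
    show "q ^ 7 * (\<Sum>a\<in>UNIV. (real (?n h a))\<^sup>2) \<le> 132/100 * N ^ 3 + (if generic [h] then 0 else q ^ 7 * N ^ 3)"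
    proof (cases "generic [h]")
      case True
      then show ?thesis
        using gen[of h] by simp
    next
      case False
      have "0 \<le> 132/100 * N ^ 3"
        using N_pos by simp
      with upper show ?thesis
        unfolding if_not_P[OF False] by linarith
    qed
  qed
  also have "\<dots> = N * (132/100 * N ^ 3) + real (card {h. \<not> generic [h]}) * (q ^ 7 * N ^ 3)"
    unfolding sum.distrib sum_constant N_def[symmetric] by (simp add: sum.If_cases Collect_neg_eq)
  also have "\<dots> \<le> N * (132/100 * N ^ 3) + (q * \<rho> * N) * (q ^ 7 * N ^ 3)"
    using card_not_generic1 q_ge1 N_pos by (intro add_mono mult_right_mono) auto
  also have "\<dots> = (132/100 + q ^ 8 * \<rho>) * N ^ 4"
    by (simp add: algebra_simps eval_nat_numeral)
  also have "\<dots> \<le> 2 * N ^ 4"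
    using rho_small[of 8] eps N_pos by (intro mult_right_mono) auto
  finally show ?thesis .
qed

text \<open>
  The cubes with first side \<open>h\<close> that violate the identity, seen as additive quadruples
  \<open>x, x + a, y, y + a\<close> for the derivative of \<open>\<psi>\<close> in direction \<open>h\<close>.
\<close>

definition failures :: "(('p mod_ring)^'d \<Rightarrow> 'k::ab_group_add) \<Rightarrow> ('p mod_ring)^'d \<Rightarrow> nat" where
  "failures \<psi> h = (\<Sum>a\<in>perp h. card {(x, y). x \<in> parallelograms h a \<and> y \<in> parallelograms h a \<and>
      (\<psi> (x + a + h) - \<psi> (x + a)) - (\<psi> (x + h) - \<psi> x) \<noteq> (\<psi> (y + a + h) - \<psi> (y + a)) - (\<psi> (y + h) - \<psi> y)})"

lemma cube_alternating_sum_eq: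
  "cube_alternating_sum \<psi> (x, h, a, k) =
     ((\<psi> (x + a + h) - \<psi> (x + a)) - (\<psi> (x + h) - \<psi> x)) -
     ((\<psi> (x + k + a + h) - \<psi> (x + k + a)) - (\<psi> (x + k + h) - \<psi> (x + k)))"
  unfolding cube_alternating_sum_def UNIV_Times_UNIV[symmetric] UNIV_bool
  by (simp add: sum.cartesian_product[symmetric] algebra_simps)

lemma sum_failures_le:
  fixes \<psi> :: "('p mod_ring)^'d \<Rightarrow> 'k::ab_group_add"
  assumes "approx_quadratic_on (1 - \<epsilon>) Z \<psi>"
  shows "q ^ 7 * real (\<Sum>h\<in>UNIV. failures \<psi> h) \<le> 2 * \<epsilon> * N ^ 4"
proof -
  let ?bad = "{t \<in> cubes_in Z. cube_alternating_sum \<psi> t \<noteq> 0}"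
  let ?good = "{t \<in> cubes_in Z. cube_alternating_sum \<psi> t = 0}"
  let ?d = "\<lambda>h a x. (\<psi> (x + a + h) - \<psi> (x + a)) - (\<psi> (x + h) - \<psi> x)"
  have "card (cubes_in Z) = card (?bad \<union> ?good)"
    by (rule arg_cong[of _ _ card]) auto
  also have "\<dots> = card ?bad + card ?good"
    by (rule card_Un_disjoint) auto
  finally have split: "real (card (cubes_in Z)) = real (card ?bad) + real (card ?good)"
    by simp
  have "(1 - \<epsilon>) * real (card (cubes_in Z)) \<le> real (card ?good)"
  proof (cases "card (cubes_in Z) = 0")
    case False
    then have "real (card (cubes_in Z)) > 0"
      by linarith
    then show ?thesis
      using assms unfolding approx_quadratic_on_def proportion_def by (simp only: pos_le_divide_eq)
  qed auto
  then have bad: "real (card ?bad) \<le> \<epsilon> * real (card (cubes_in Z))"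
    using split by (simp add: algebra_simps)
  have "(\<Sum>h\<in>UNIV. failures \<psi> h) = card (SIGMA h:UNIV. SIGMA a:perp h. {(x, y). x \<in> parallelograms h a \<and> y \<in> parallelograms h a \<and> ?d h a x \<noteq> ?d h a y})"
    by (simp add: card_SigmaI failures_def)
  also have "\<dots> \<le> card ?bad"
    by (rule card_inj_on_le[of "\<lambda>(h, a, x, y). (x, h, a, y - x)"])
      (auto simp: inj_on_def cubes_in_Z_iff cube_alternating_sum_eq)
  finally have "real (\<Sum>h\<in>UNIV. failures \<psi> h) \<le> real (card ?bad)"
    by (rule of_nat_mono)
  then have "q ^ 7 * real (\<Sum>h\<in>UNIV. failures \<psi> h) \<le> q ^ 7 * (\<epsilon> * real (card (cubes_in Z)))"
    using bad q_ge1 by (intro mult_left_mono order_trans[OF _ bad]) simp_all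
  also have "\<dots> \<le> \<epsilon> * (2 * N ^ 4)"
    using card_cubes_in_Z eps by (simp add: mult.left_commute mult_left_mono)
  finally show ?thesis
    by (simp add: mult_ac)
qed

text \<open>
  Affine testing for \<open>Y = Z \<inter> (Z - h)\<close> inside \<open>perp h\<close>, where \<open>Y\<close> has density about
  \<open>(N / q\<^sup>2) / (N / q) = 1 / q\<close>. When \<open>h\<close> has too many failures for the test, the bound exceeds the
  size of the slice and the zero map will do. This keeps the estimate linear in \<open>failures \<psi> h\<close>, so
  that summing over \<open>h\<close> costs no square root.
\<close>

lemma derivative_affine_on_slice:
  fixes \<psi> :: "('p mod_ring)^'d \<Rightarrow> 'k::ab_group_add"
  assumes h: "generic [h]"
  obtains M t where "additive_map M"
    and "q\<^sup>2 * real (card {x \<in> translates [h]. \<psi> (x + h) - \<psi> x \<noteq> M x + t}) \<le>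
      110 * (q ^ 7 * real (failures \<psi> h) / N ^ 3 + 2 * q ^ 6 * \<rho>) * N"
proof -
  define \<phi> where "\<phi> x = \<psi> (x + h) - \<psi> x" for x
  define \<kappa> where "\<kappa> = q ^ 7 * real (failures \<psi> h) / N ^ 3 + 2 * q ^ 6 * \<rho>"
  define Y where "Y = translates [h]"
  have \<kappa>1: "q ^ 7 * real (failures \<psi> h) / N ^ 3 \<le> \<kappa>" "2 * q ^ 6 * \<rho> \<le> \<kappa>"
    using q_ge1 N_pos rho0 by (auto simp: \<kappa>_def)
  have \<kappa>0: "0 \<le> \<kappa>"
    using \<kappa>1(2) q_ge1 rho0 by (smt (verit) mult_nonneg_nonneg zero_le_power)
  have cardY: "9/10 * N \<le> q\<^sup>2 * real (card Y)" "q\<^sup>2 * real (card Y) \<le> 11/10 * N"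
    using card_translates(1,2)[OF h] by (simp_all add: Y_def power2_eq_square)
  have m: "real (card (perp h)) = N / q"
    using card_perp[OF h] q_ge1 by (simp add: field_simps)
  show thesis
  proof (cases "\<kappa> \<le> 1/100")
    case False
    have "q\<^sup>2 * real (card {x \<in> Y. \<phi> x \<noteq> 0 + 0}) \<le> q\<^sup>2 * real (card Y)"
      using q_ge1 by (intro mult_left_mono of_nat_mono card_mono) auto
    also have "\<dots> \<le> 110 * \<kappa> * N"
      using cardY(2) False N_pos mult_right_mono[of "1/100" \<kappa> N] by linarith
    finally show ?thesis
      using that[of "\<lambda>_. 0" 0] by (simp add: additive_map_def Y_def \<phi>_def \<kappa>_def)
  next
    case True
    define E1 where "E1 = {a \<in> perp h. \<not> generic [a, h]}"
    define E2 where "E2 = {(a, b) \<in> perp h \<times> perp h. \<not> generic [b, a, h]}"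
    have memY: "x \<in> Y \<longleftrightarrow> x \<in> Z \<and> x + h \<in> Z" for x
      by (auto simp: Y_def translates_def)
    have par: "{x \<in> Y. x + a \<in> Y} = parallelograms h a" for a
      by (auto simp: memY parallelograms_def)
    obtain g y0 where g: "\<And>a b. a \<in> perp h \<Longrightarrow> b \<in> perp h \<Longrightarrow> g (a + b) = g a + g b"
      and "y0 \<in> Y" and gfail: "real (card {x \<in> Y. \<phi> x \<noteq> \<phi> y0 + g (x - y0)}) \<le> 36 * \<kappa> * (1/q) * real (card (perp h))"
    proof (rule affine_testing[where \<phi> = \<phi> and Y = Y and H = "perp h" and \<sigma> = "1/q" and \<tau> = "2 * q ^ 5 * \<rho>" and \<kappa> = \<kappa> and ?E1.0 = E1 and ?E2.0 = E2])
      show "finite (perp h)" "finite Y"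
        by simp_all
      show "subgroup_set (perp h)"
        by (rule subgroup_perp)
      show "y - x \<in> perp h" if "x \<in> Y" "y \<in> Y" for x y
        using that by (auto simp: memY diff_mem_perp)
      show "0 < 1/q" "1/q \<le> 1"
        using q_ge1 by auto
      show "9/10 * (1/q) * real (card (perp h)) \<le> real (card Y)" "real (card Y) \<le> 11/10 * (1/q) * real (card (perp h))"
        using cardY q_ge1 by (simp_all add: m field_simps power2_eq_square)
      show "E1 \<subseteq> perp h" "E2 \<subseteq> perp h \<times> perp h"
        by (auto simp: E1_def E2_def)
      have E1: "real (card E1) \<le> q\<^sup>2 * \<rho> * N"
      proof -
        have "real (card E1) \<le> real (card {a. \<not> generic [a, h]})"
          by (intro of_nat_mono card_mono) (auto simp: E1_def)
        then show ?thesis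
          using card_not_generic2[OF h] by linarith
      qed
      have "q\<^sup>2 * \<rho> * N = q ^ 3 * \<rho> * (N / q)"
        using q_ge1 by (simp add: eval_nat_numeral)
      also have "\<dots> \<le> 2 * q ^ 5 * \<rho> * (N / q)"
      proof -
        have "1 * q ^ 3 \<le> 2 * q ^ 5"
          using q_ge1 by (intro mult_mono power_increasing) auto
        then show ?thesis
          using q_ge1 rho0 N_pos by (intro mult_right_mono) auto
      qed
      finally show "real (card E1) \<le> 2 * q ^ 5 * \<rho> * real (card (perp h))"
        unfolding m using E1 by linarith
      show "real (card E2) \<le> 2 * q ^ 5 * \<rho> * (real (card (perp h)))\<^sup>2"
      proof -
        have "E2 \<subseteq> (E1 \<times> UNIV) \<union> (SIGMA a : {a. generic [a, h]}. {b. \<not> generic [b, a, h]})"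
          by (auto simp: E1_def E2_def)
        then have "card E2 \<le> card ((E1 \<times> UNIV) \<union> (SIGMA a : {a. generic [a, h]}. {b. \<not> generic [b, a, h]}))"
          by (intro card_mono) auto
        also have "\<dots> \<le> card (E1 \<times> (UNIV :: (('p mod_ring)^'d) set)) + card (SIGMA a : {a. generic [a, h]}. {b. \<not> generic [b, a, h]})"
          by (rule card_Un_le)
        also have "card (SIGMA a : {a. generic [a, h]}. {b. \<not> generic [b, a, h]}) = (\<Sum>a | generic [a, h]. card {b. \<not> generic [b, a, h]})"
          by (subst card_SigmaI) auto
        finally have "real (card E2) \<le> real (card (E1 \<times> (UNIV :: (('p mod_ring)^'d) set)) + (\<Sum>a | generic [a, h]. card {b. \<not> generic [b, a, h]}))"
          by (rule of_nat_mono)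
        then have "real (card E2) \<le> real (card E1) * N + (\<Sum>a | generic [a, h]. real (card {b. \<not> generic [b, a, h]}))"
          by (simp only: card_cartesian_product N_def of_nat_mult of_nat_sum of_nat_add)
        also have "(\<Sum>a | generic [a, h]. real (card {b. \<not> generic [b, a, h]})) \<le> (\<Sum>a | generic [a, h]. q ^ 3 * \<rho> * N)"
          using card_not_generic3 by (intro sum_mono) auto
        also have "\<dots> \<le> N * (q ^ 3 * \<rho> * N)"
          unfolding sum_constant using card_le_N q_ge1 rho0 N_pos by (intro mult_right_mono) auto
        also have "real (card E1) * N \<le> (q ^ 3 * \<rho> * N) * N"
        proof -
          have "q\<^sup>2 * \<rho> * N \<le> q ^ 3 * \<rho> * N"
            using q_ge1 rho0 N_pos by (intro mult_right_mono power_increasing) auto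
          then show ?thesis
            using E1 N_pos by (intro mult_right_mono) auto
        qed
        finally have "real (card E2) \<le> 2 * q ^ 3 * \<rho> * N\<^sup>2"
          by (simp add: power2_eq_square algebra_simps)
        also have "\<dots> = 2 * q ^ 5 * \<rho> * (N / q)\<^sup>2"
          using q_ge1 by (simp add: power_divide eval_nat_numeral)
        finally show ?thesis
          by (simp add: m)
      qed
      show "9/10 * (1/q)\<^sup>2 * real (card (perp h)) \<le> real (card {x \<in> Y. x + a \<in> Y})"
        "real (card {x \<in> Y. x + a \<in> Y}) \<le> 11/10 * (1/q)\<^sup>2 * real (card (perp h))"
        if a: "a \<in> perp h - E1" for a
      proof -
        have gen: "generic [a, h]"
          using a by (auto simp: E1_def)
        have "{x \<in> Y. x + a \<in> Y} = translates [a, h]"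
          using a by (simp add: par parallelograms_eq)
        then show "9/10 * (1/q)\<^sup>2 * real (card (perp h)) \<le> real (card {x \<in> Y. x + a \<in> Y})"
          "real (card {x \<in> Y. x + a \<in> Y}) \<le> 11/10 * (1/q)\<^sup>2 * real (card (perp h))"
          using card_translates(1,2)[OF gen] q_ge1 by (simp_all add: m field_simps eval_nat_numeral)
      qed
      show "9/10 * (1/q) ^ 3 * real (card (perp h)) \<le> real (card {x \<in> Y. x + a \<in> Y \<and> x + a + b \<in> Y})"
        if ab: "(a, b) \<in> perp h \<times> perp h - E2" for a b
      proof -
        have "generic [b, a, h]"
          using ab by (auto simp: E2_def)
        then have gen: "generic [a + b, a, h]"
          by (rule generic_add)
        have "a + b \<in> perp h"
          using ab subgroup_setD(2)[OF subgroup_perp] by auto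
        then have "translates [a + b, a, h] \<subseteq> {x \<in> Y. x + a \<in> Y \<and> x + a + b \<in> Y}"
          using ab parallelogram_mem_Z[of _ h "a + b"] parallelogram_mem_Z[of _ h a]
          by (auto simp: memY translates_def add.assoc)
        then have "card (translates [a + b, a, h]) \<le> card {x \<in> Y. x + a \<in> Y \<and> x + a + b \<in> Y}"
          by (intro card_mono) auto
        moreover have "9/10 * (1/q) ^ 3 * real (card (perp h)) \<le> real (card (translates [a + b, a, h]))"
          using card_translates(1)[OF gen] q_ge1 by (simp add: m field_simps eval_nat_numeral)
        ultimately show ?thesis
          by linarith
      qed
      show "real (\<Sum>a\<in>perp h. card {(x, y). (x \<in> Y \<and> x + a \<in> Y) \<and> (y \<in> Y \<and> y + a \<in> Y) \<and>
          \<phi> (x + a) - \<phi> x \<noteq> \<phi> (y + a) - \<phi> y}) \<le> \<kappa> * (1/q) ^ 4 * (real (card (perp h))) ^ 3"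
      proof -
        have mem: "x \<in> Y \<and> x + a \<in> Y \<longleftrightarrow> x \<in> parallelograms h a" for x a
          using par[of a] by blast
        have "(\<Sum>a\<in>perp h. card {(x, y). (x \<in> Y \<and> x + a \<in> Y) \<and> (y \<in> Y \<and> y + a \<in> Y) \<and>
            \<phi> (x + a) - \<phi> x \<noteq> \<phi> (y + a) - \<phi> y}) = failures \<psi> h"
          unfolding mem failures_def \<phi>_def by simp
        moreover have "real (failures \<psi> h) \<le> \<kappa> * (N ^ 3 / q ^ 7)"
          using \<kappa>1(1) q_ge1 N_pos by (simp add: field_simps)
        moreover have "(1/q) ^ 4 * (N / q) ^ 3 = N ^ 3 / q ^ 7"
          by (simp add: power_divide eval_nat_numeral)
        ultimately show ?thesis
          by (simp add: m mult.assoc)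
      qed
      show "2 * q ^ 5 * \<rho> \<le> \<kappa> * (1/q)"
        using \<kappa>1(2) q_ge1 by (simp add: field_simps eval_nat_numeral)
    qed (use True in auto)
    obtain M where M: "additive_map M" "\<And>a. a \<in> perp h \<Longrightarrow> M a = g a"
      using extend_from_perp[OF h g] by blast
    have "M x + (\<phi> y0 - M y0) = \<phi> y0 + g (x - y0)" if "x \<in> Y" for x
    proof -
      have "M (x - y0) = g (x - y0)"
        using that \<open>y0 \<in> Y\<close> by (intro M(2)) (auto simp: memY diff_mem_perp)
      then show ?thesis
        by (simp add: additive_map_diff[OF M(1)] algebra_simps)
    qed
    then have set_eq: "{x \<in> Y. \<phi> x \<noteq> M x + (\<phi> y0 - M y0)} = {x \<in> Y. \<phi> x \<noteq> \<phi> y0 + g (x - y0)}"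
      by auto
    have "q\<^sup>2 * real (card {x \<in> Y. \<phi> x \<noteq> M x + (\<phi> y0 - M y0)}) \<le> q\<^sup>2 * (36 * \<kappa> * (1/q) * (N / q))"
      unfolding set_eq using gfail by (intro mult_left_mono) (simp_all only: m zero_le_power2)
    also have "\<dots> = 36 * (\<kappa> * N)"
      using q_ge1 by (simp add: power2_eq_square)
    also have "\<dots> \<le> 110 * (\<kappa> * N)"
      using \<kappa>0 N_pos by (intro mult_right_mono) auto
    finally have bound: "q\<^sup>2 * real (card {x \<in> Y. \<phi> x \<noteq> M x + (\<phi> y0 - M y0)}) \<le> 110 * \<kappa> * N"
      by (simp only: mult.assoc)
    show ?thesis
      by (rule that[OF M(1) bound[unfolded Y_def \<phi>_def \<kappa>_def]])
  qed
qed

lemma derivatives_affine: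
  fixes \<psi> :: "('p mod_ring)^'d \<Rightarrow> 'k::ab_group_add"
  assumes "approx_quadratic_on (1 - \<epsilon>) Z \<psi>"
  obtains M t where "\<And>h. additive_map (M h)"
    and "q\<^sup>2 * real (card {(h, x). x \<in> Z \<and> x + h \<in> Z \<and> \<psi> (x + h) - \<psi> x \<noteq> M h x + t h}) \<le> 250 * \<epsilon> * N\<^sup>2"
proof -
  let ?b = "\<lambda>h. 110 * (q ^ 7 * real (failures \<psi> h) / N ^ 3 + 2 * q ^ 6 * \<rho>) * N"
  define P where "P h M t \<longleftrightarrow> additive_map M \<and>
      (generic [h] \<longrightarrow> q\<^sup>2 * real (card {x \<in> translates [h]. \<psi> (x + h) - \<psi> x \<noteq> M x + t}) \<le> ?b h)" for h M t
  have "\<exists>M t. P h M t" for h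
  proof (cases "generic [h]")
    case True
    show ?thesis
      unfolding P_def by (rule derivative_affine_on_slice[OF True, of \<psi>]) blast
  next
    case False
    have "additive_map (\<lambda>_ :: ('p mod_ring)^'d. 0 :: 'k)"
      by (simp add: additive_map_def)
    with False show ?thesis
      unfolding P_def by blast
  qed
  then obtain M t where "\<And>h. P h (M h) (t h)"
    by metis
  then have M: "\<And>h. additive_map (M h)"
    and fail: "\<And>h. generic [h] \<Longrightarrow> q\<^sup>2 * real (card {x \<in> translates [h]. \<psi> (x + h) - \<psi> x \<noteq> M h x + t h}) \<le> ?b h"
    by (auto simp: P_def)
  let ?F = "\<lambda>h. {x \<in> translates [h]. \<psi> (x + h) - \<psi> x \<noteq> M h x + t h}"
  have b0: "0 \<le> ?b h" for h
    using q_ge1 N_pos rho0 by simp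
  have "{(h, x). x \<in> Z \<and> x + h \<in> Z \<and> \<psi> (x + h) - \<psi> x \<noteq> M h x + t h} = (SIGMA h:UNIV. ?F h)"
    by (auto simp: translates_def)
  then have "q\<^sup>2 * real (card {(h, x). x \<in> Z \<and> x + h \<in> Z \<and> \<psi> (x + h) - \<psi> x \<noteq> M h x + t h}) = (\<Sum>h\<in>UNIV. q\<^sup>2 * real (card (?F h)))"
    by (simp add: card_SigmaI sum_distrib_left)
  also have "\<dots> \<le> (\<Sum>h\<in>UNIV. ?b h + (if generic [h] then 0 else q\<^sup>2 * N))"
  proof (rule sum_mono)
    fix h
    have "q\<^sup>2 * real (card (?F h)) \<le> q\<^sup>2 * N"
      using q_ge1 card_le_N by (intro mult_left_mono) auto
    then show "q\<^sup>2 * real (card (?F h)) \<le> ?b h + (if generic [h] then 0 else q\<^sup>2 * N)"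
      using fail[of h] b0[of h] by auto
  qed
  also have "\<dots> = (\<Sum>h\<in>UNIV. ?b h) + real (card {h. \<not> generic [h]}) * (q\<^sup>2 * N)"
    by (simp add: sum.distrib sum.If_cases Collect_neg_eq)
  also have "(\<Sum>h\<in>UNIV. ?b h) = 110 * ((q ^ 7 * real (\<Sum>h\<in>UNIV. failures \<psi> h)) / N ^ 3 + N * (2 * q ^ 6 * \<rho>)) * N"
  proof -
    have "(\<Sum>h\<in>UNIV. q ^ 7 * real (failures \<psi> h) / N ^ 3 + 2 * q ^ 6 * \<rho>) =
        (\<Sum>h\<in>UNIV. q ^ 7 * real (failures \<psi> h) / N ^ 3) + real CARD(('p mod_ring)^'d) * (2 * q ^ 6 * \<rho>)"
      unfolding sum.distrib sum_constant ..
    then show ?thesis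
      unfolding N_def[symmetric]
      by (simp only: sum_distrib_left [symmetric] sum_distrib_right [symmetric] sum_divide_distrib [symmetric] of_nat_sum)
  qed
  also have "\<dots> \<le> 110 * ((2 * \<epsilon> * N ^ 4) / N ^ 3 + N * (2 * (\<epsilon> / 10))) * N"
    using sum_failures_le[OF assms] rho_small[of 6] N_pos
    by (intro mult_right_mono mult_left_mono add_mono divide_right_mono) auto
  also have "\<dots> = 242 * \<epsilon> * N\<^sup>2"
    using N_pos by (simp add: field_simps eval_nat_numeral)
  also have "real (card {h. \<not> generic [h]}) * (q\<^sup>2 * N) \<le> (q * \<rho> * N) * (q\<^sup>2 * N)"
    using card_not_generic1 N_pos by (intro mult_right_mono) auto
  also have "\<dots> = (q ^ 3 * \<rho>) * N\<^sup>2"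
    by (simp add: eval_nat_numeral)
  also have "\<dots> \<le> \<epsilon> / 10 * N\<^sup>2"
    using rho_small[of 3] by (intro mult_right_mono) auto
  finally have "q\<^sup>2 * real (card {(h, x). x \<in> Z \<and> x + h \<in> Z \<and> \<psi> (x + h) - \<psi> x \<noteq> M h x + t h}) \<le> (242 + 1/10) * (\<epsilon> * N\<^sup>2)"
    by (simp add: algebra_simps)
  also have "\<dots> \<le> 250 * (\<epsilon> * N\<^sup>2)"
    using eps by (intro mult_right_mono) auto
  finally show thesis
    using that[OF M] by (simp add: mult.assoc)
qed

end


section \<open>Integrating the derivatives\<close>

text \<open>
  A nonzero homomorphism is nonzero on at least half of its domain; applied in both variables, a
  nonzero biadditive map is nonzero on at least a quarter of all pairs.
\<close>

lemma biadditive_eq_0: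
  fixes D :: "'v::{finite, ab_group_add} \<Rightarrow> 'v \<Rightarrow> 'k::ab_group_add"
  assumes add: "\<And>h. additive_map (D h)" "\<And>x. additive_map (\<lambda>h. D h x)"
    and few: "4 * real (card {(h, x). D h x \<noteq> 0}) < (real CARD('v))\<^sup>2"
  shows "D h x = 0"
proof (rule ccontr)
  let ?N = "real CARD('v)"
  have half: "?N \<le> 2 * real (card {x. f x \<noteq> 0})" if f: "additive_map f" "f y \<noteq> 0" for f :: "'v \<Rightarrow> 'k" and y
  proof -
    have "card {x. f x = 0} \<le> card {x. f x \<noteq> 0}"
      using f(2) by (intro card_inj_on_le[of "\<lambda>x. x + y"]) (auto simp: inj_on_def additive_map_add[OF f(1)])
    moreover have "CARD('v) = card ({x. f x = 0} \<union> {x. f x \<noteq> 0})"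
      by (rule arg_cong[of _ _ card]) auto
    then have "CARD('v) = card {x. f x = 0} + card {x. f x \<noteq> 0}"
      by (subst (asm) card_Un_disjoint) auto
    ultimately show ?thesis
      by linarith
  qed
  assume nz: "D h x \<noteq> 0"
  let ?A = "{h. D h x \<noteq> 0}"
  have "?N \<le> 2 * real (card ?A)"
    using half[OF add(2) nz] .
  then have "?N * ?N \<le> (2 * real (card ?A)) * ?N"
    by (intro mult_right_mono) auto
  also have "(2 * real (card ?A)) * ?N = 2 * (\<Sum>h\<in>?A. ?N)"
    by simp
  also have "\<dots> \<le> 2 * (\<Sum>h\<in>?A. 2 * real (card {x. D h x \<noteq> 0}))"
    using half[OF add(1)] by (intro mult_left_mono sum_mono) auto
  also have "\<dots> = 4 * real (\<Sum>h\<in>?A. card {x. D h x \<noteq> 0})"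
    by (simp add: sum_distrib_left)
  also have "(\<Sum>h\<in>?A. card {x. D h x \<noteq> 0}) = card (SIGMA h:?A. {x. D h x \<noteq> 0})"
    by (simp add: card_SigmaI)
  also have "4 * real (card (SIGMA h:?A. {x. D h x \<noteq> 0})) \<le> 4 * real (card {(h, x). D h x \<noteq> 0})"
    by (intro mult_left_mono of_nat_mono card_mono) auto
  finally show False
    using few by (simp add: power2_eq_square)
qed

lemma card_preimage_pairs:
  fixes S :: "('v::finite \<times> 'v) set"
  assumes "inj_on f X" and "f ` X \<subseteq> S \<times> (UNIV :: 'v set)"
  shows "real (card X) \<le> real (card S) * real CARD('v)"
proof -
  have "card X \<le> card (S \<times> (UNIV :: 'v set))"
    using assms by (intro card_inj_on_le) auto
  then have "real (card X) \<le> real (card (S \<times> (UNIV :: 'v set)))"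
    by (rule of_nat_mono)
  then show ?thesis
    by (simp only: card_cartesian_product of_nat_mult)
qed

context high_rank_variety
begin

lemma card_not_generic_pairs: "real (card {(h, a). \<not> generic [a, h]}) \<le> \<epsilon> / 5 * N\<^sup>2"
proof -
  have "{(h, a). \<not> generic [a, h]} \<subseteq> ({h. \<not> generic [h]} \<times> UNIV) \<union> (SIGMA h : {h. generic [h]}. {a. \<not> generic [a, h]})"
    by auto
  then have "card {(h, a). \<not> generic [a, h]} \<le> card ({h. \<not> generic [h]} \<times> (UNIV :: (('p mod_ring)^'d) set)) + card (SIGMA h : {h. generic [h]}. {a. \<not> generic [a, h]})"
    by (intro order.trans[OF card_mono card_Un_le]) auto
  also have "card (SIGMA h : {h. generic [h]}. {a. \<not> generic [a, h]}) = (\<Sum>h | generic [h]. card {a. \<not> generic [a, h]})"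
    by (subst card_SigmaI) auto
  finally have "real (card {(h, a). \<not> generic [a, h]}) \<le> real (card ({h. \<not> generic [h]} \<times> (UNIV :: (('p mod_ring)^'d) set)) + (\<Sum>h | generic [h]. card {a. \<not> generic [a, h]}))"
    by (rule of_nat_mono)
  then have "real (card {(h, a). \<not> generic [a, h]}) \<le> real (card {h. \<not> generic [h]}) * N + (\<Sum>h | generic [h]. real (card {a. \<not> generic [a, h]}))"
    by (simp only: card_cartesian_product N_def of_nat_mult of_nat_sum of_nat_add)
  also have "(\<Sum>h | generic [h]. real (card {a. \<not> generic [a, h]})) \<le> (\<Sum>h | generic [h]. q\<^sup>2 * \<rho> * N)"
    using card_not_generic2 by (intro sum_mono) auto
  also have "\<dots> \<le> N * (q\<^sup>2 * \<rho> * N)"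
    unfolding sum_constant using card_le_N q_ge1 rho0 N_pos by (intro mult_right_mono) auto
  also have "real (card {h. \<not> generic [h]}) * N \<le> (q * \<rho> * N) * N"
    using card_not_generic1 N_pos by (intro mult_right_mono) auto
  finally have "real (card {(h, a). \<not> generic [a, h]}) \<le> (q ^ 1 * \<rho> + q ^ 2 * \<rho>) * N\<^sup>2"
    by (simp add: power2_eq_square algebra_simps)
  also have "\<dots> \<le> (\<epsilon> / 10 + \<epsilon> / 10) * N\<^sup>2"
    using rho_small[of 1] rho_small[of 2] by (intro mult_right_mono add_mono) auto
  finally show ?thesis
    by simp
qed

lemma card_not_generic_triples: "real (card {(u, v, w). \<not> generic [w, v, u]}) \<le> 3 / 10 * \<epsilon> * N ^ 3"
proof -
  let ?A = "{(u, v). \<not> generic [v, u]}" and ?C = "{(u, v). generic [v, u]}"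
  have "card {(u, v, w). \<not> generic [w, v, u]} = card {((u, v), w). \<not> generic [w, v, u]}"
    by (rule bij_betw_same_card[of "\<lambda>(u, v, w). ((u, v), w)"],
        rule bij_betwI[where g = "\<lambda>((u, v), w). (u, v, w)"]) auto
  also have "{((u, v), w). \<not> generic [w, v, u]} \<subseteq> (?A \<times> UNIV) \<union> (SIGMA uv : ?C. {w. \<not> generic [w, snd uv, fst uv]})"
    by auto
  then have "card {((u, v), w). \<not> generic [w, v, u]} \<le> card (?A \<times> (UNIV :: (('p mod_ring)^'d) set)) + card (SIGMA uv : ?C. {w. \<not> generic [w, snd uv, fst uv]})"
    by (intro order.trans[OF card_mono card_Un_le]) auto
  also have "card (SIGMA uv : ?C. {w. \<not> generic [w, snd uv, fst uv]}) = (\<Sum>uv\<in>?C. card {w. \<not> generic [w, snd uv, fst uv]})"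
    by (subst card_SigmaI) auto
  finally have "real (card {(u, v, w). \<not> generic [w, v, u]}) \<le> real (card (?A \<times> (UNIV :: (('p mod_ring)^'d) set)) + (\<Sum>uv\<in>?C. card {w. \<not> generic [w, snd uv, fst uv]}))"
    by (rule of_nat_mono)
  then have "real (card {(u, v, w). \<not> generic [w, v, u]}) \<le> real (card ?A) * N + (\<Sum>uv\<in>?C. real (card {w. \<not> generic [w, snd uv, fst uv]}))"
    by (simp only: card_cartesian_product N_def of_nat_mult of_nat_sum of_nat_add)
  also have "(\<Sum>uv\<in>?C. real (card {w. \<not> generic [w, snd uv, fst uv]})) \<le> (\<Sum>uv\<in>?C. q ^ 3 * \<rho> * N)"
    using card_not_generic3 by (intro sum_mono) auto
  also have "\<dots> = real (card ?C) * (q ^ 3 * \<rho> * N)"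
    by simp
  also have "\<dots> \<le> N\<^sup>2 * (q ^ 3 * \<rho> * N)"
  proof (rule mult_right_mono)
    have "card ?C \<le> card (UNIV \<times> UNIV :: ((('p mod_ring)^'d) \<times> (('p mod_ring)^'d)) set)"
      by (intro card_mono) auto
    then have "real (card ?C) \<le> real (card (UNIV \<times> UNIV :: ((('p mod_ring)^'d) \<times> (('p mod_ring)^'d)) set))"
      by (rule of_nat_mono)
    then show "real (card ?C) \<le> N\<^sup>2"
      by (simp only: card_cartesian_product N_def of_nat_mult power2_eq_square)
  qed (use q_ge1 rho0 N_pos in auto)
  also have "\<dots> = (q ^ 3 * \<rho>) * N ^ 3"
    by (simp add: eval_nat_numeral)
  also have "\<dots> \<le> (\<epsilon> / 10) * N ^ 3"
    using rho_small[of 3] N_pos by (intro mult_right_mono) auto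
  also have "real (card ?A) * N \<le> (\<epsilon> / 5 * N\<^sup>2) * N"
    using card_not_generic_pairs N_pos by (intro mult_right_mono) auto
  finally show ?thesis
    by (simp add: eval_nat_numeral algebra_simps)
qed

lemma card_pairs_over:
  assumes "real (card B) \<le> \<beta> * N"
  shows "q\<^sup>2 * real (card {(h, x). h \<in> B \<and> x \<in> Z \<and> x + h \<in> Z}) \<le> (11/10 * \<beta> + \<epsilon> / 10) * N\<^sup>2"
proof -
  have "{(h, x). h \<in> B \<and> x \<in> Z \<and> x + h \<in> Z} = (SIGMA h:B. translates [h])"
    by (auto simp: translates_def)
  then have "q\<^sup>2 * real (card {(h, x). h \<in> B \<and> x \<in> Z \<and> x + h \<in> Z}) = (\<Sum>h\<in>B. q\<^sup>2 * real (card (translates [h])))"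
    by (simp add: card_SigmaI sum_distrib_left)
  also have "\<dots> \<le> (\<Sum>h\<in>B. 11/10 * N + (if generic [h] then 0 else q\<^sup>2 * N))"
  proof (rule sum_mono)
    fix h
    show "q\<^sup>2 * real (card (translates [h])) \<le> 11/10 * N + (if generic [h] then 0 else q\<^sup>2 * N)"
    proof (cases "generic [h]")
      case True
      then show ?thesis
        using card_translates(2)[OF True] by (simp add: power2_eq_square)
    next
      case False
      have "q\<^sup>2 * real (card (translates [h])) \<le> q\<^sup>2 * N"
        by (intro mult_left_mono card_le_N) auto
      then show ?thesis
        using N_pos False by simp
    qed
  qed
  also have "\<dots> = real (card B) * (11/10 * N) + (\<Sum>h\<in>B. if generic [h] then 0 else q\<^sup>2 * N)"
    by (simp only: sum.distrib sum_constant)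
  also have "(\<Sum>h\<in>B. if generic [h] then 0 else q\<^sup>2 * N) \<le> (\<Sum>h\<in>UNIV. if generic [h] then 0 else q\<^sup>2 * N)"
    using N_pos by (intro sum_mono2) auto
  also have "\<dots> = real (card {h. \<not> generic [h]}) * (q\<^sup>2 * N)"
    by (simp add: sum.If_cases Collect_neg_eq)
  also have "\<dots> \<le> (q * \<rho> * N) * (q\<^sup>2 * N)"
    using card_not_generic1 N_pos by (intro mult_right_mono) auto
  also have "\<dots> = (q ^ 3 * \<rho>) * N\<^sup>2"
    by (simp add: eval_nat_numeral)
  also have "\<dots> \<le> \<epsilon> / 10 * N\<^sup>2"
    using rho_small[of 3] by (intro mult_right_mono) auto
  also have "real (card B) * (11/10 * N) \<le> (\<beta> * N) * (11/10 * N)"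
    using assms N_pos by (intro mult_right_mono) auto
  finally show ?thesis
    by (simp add: power2_eq_square algebra_simps)
qed

text \<open>
  For a property \<open>P h x\<close> of the pair \<open>(x, x + h)\<close>: most triples \<open>x, x + h, x + h + k\<close> in \<open>Z\<close> have the
  property on all three of their pairs. Since the set of all such \<open>x\<close> has at least
  \<open>9/10 * N / q\<^sup>3\<close> elements, more than half of them are good.
\<close>

definition composable :: "(('p mod_ring)^'d \<Rightarrow> ('p mod_ring)^'d \<Rightarrow> bool) \<Rightarrow> ('p mod_ring)^'d \<Rightarrow> ('p mod_ring)^'d \<Rightarrow> bool" where
  "composable P h k \<longleftrightarrow> generic [k, h] \<and>
     q ^ 3 * real (card {x \<in> translates [h + k, h]. \<not> (P h x \<and> P k (x + h) \<and> P (h + k) x)}) \<le> 4/10 * N"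

lemma card_Z_bounds: "9/10 * N \<le> q * real (card Z)" "q * real (card Z) \<le> 11/10 * N"
  using card_translates(1,2)[of "[]"] by (simp_all add: translates_def)

lemma composable_count:
  assumes "composable P h k"
  shows "5/10 * N \<le> q ^ 3 * real (card {x \<in> translates [h + k, h]. P h x \<and> P k (x + h) \<and> P (h + k) x})"
proof -
  let ?T = "translates [h + k, h]" and ?P = "\<lambda>x. P h x \<and> P k (x + h) \<and> P (h + k) x"
  have "generic [h + k, h]"
    using assms by (auto simp: composable_def intro: generic_add)
  then have "9/10 * N \<le> q ^ 3 * real (card ?T)"
    using card_translates(1)[of "[h + k, h]"] by (simp add: eval_nat_numeral)
  moreover have "card ?T = card ({x \<in> ?T. ?P x} \<union> {x \<in> ?T. \<not> ?P x})"
    by (rule arg_cong[of _ _ card]) auto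
  then have "card ?T = card {x \<in> ?T. ?P x} + card {x \<in> ?T. \<not> ?P x}"
    by (subst (asm) card_Un_disjoint) auto
  then have "q ^ 3 * real (card ?T) = q ^ 3 * real (card {x \<in> ?T. ?P x}) + q ^ 3 * real (card {x \<in> ?T. \<not> ?P x})"
    by (simp add: distrib_left)
  ultimately show ?thesis
    using assms unfolding composable_def by linarith
qed

text \<open>
  Count the triples in \<open>Z\<^sup>3\<close> with a bad pair: there are at most three times the number of bad pairs
  times \<open>card Z\<close>, and each generic pair that is not composable accounts for many of them.
\<close>

lemma card_not_composable:
  assumes K: "q\<^sup>2 * real (card {(h, x). x \<in> Z \<and> x + h \<in> Z \<and> \<not> P h x}) \<le> \<kappa> * N\<^sup>2" and \<kappa>: "\<epsilon> \<le> \<kappa>"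
  shows "real (card {(h, k). \<not> composable P h k}) \<le> 9 * \<kappa> * N\<^sup>2"
proof -
  define F where "F = {(h, x). x \<in> Z \<and> x + h \<in> Z \<and> \<not> P h x}"
  define W where "W h k = {x \<in> translates [h + k, h]. \<not> (P h x \<and> P k (x + h) \<and> P (h + k) x)}" for h k
  define S where "S = {(h, k). 4/10 * N < q ^ 3 * real (card (W h k))}"
  let ?U = "SIGMA hk:UNIV. W (fst hk) (snd hk)"
  have "card ?U \<le> 3 * (card F * card Z)"
  proof -
    let ?U1 = "{((h, k), x). (h, x) \<in> F \<and> x + h + k \<in> Z}"
    let ?U2 = "{((h, k), x). (k, x + h) \<in> F \<and> x \<in> Z}"
    let ?U3 = "{((h, k), x). (h + k, x) \<in> F \<and> x + h \<in> Z}"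
    have "card ?U1 \<le> card (F \<times> Z)"
      by (rule card_inj_on_le[of "\<lambda>((h, k), x). ((h, x), x + h + k)"]) (auto simp: inj_on_def)
    moreover have "card ?U2 \<le> card (F \<times> Z)"
      by (rule card_inj_on_le[of "\<lambda>((h, k), x). ((k, x + h), x)"]) (auto simp: inj_on_def)
    moreover have "card ?U3 \<le> card (F \<times> Z)"
      by (rule card_inj_on_le[of "\<lambda>((h, k), x). ((h + k, x), x + h)"]) (auto simp: inj_on_def)
    moreover have "?U \<subseteq> ?U1 \<union> ?U2 \<union> ?U3"
      by (auto simp: W_def F_def translates_def add.assoc)
    then have "card ?U \<le> card (?U1 \<union> ?U2 \<union> ?U3)"
      by (intro card_mono) auto
    then have "card ?U \<le> card ?U1 + card ?U2 + card ?U3"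
      using card_Un_le[of "?U1 \<union> ?U2" ?U3] card_Un_le[of ?U1 ?U2] by linarith
    ultimately show ?thesis
      unfolding card_cartesian_product by linarith
  qed
  then have "real (card ?U) \<le> real (3 * (card F * card Z))"
    by (rule of_nat_mono)
  then have U: "real (card ?U) \<le> 3 * (real (card F) * real (card Z))"
    by simp
  have "real (card S) * (4/10 * N) = (\<Sum>hk\<in>S. 4/10 * N)"
    by simp
  also have "\<dots> \<le> (\<Sum>hk\<in>S. q ^ 3 * real (card (W (fst hk) (snd hk))))"
    by (intro sum_mono) (auto simp: S_def)
  also have "\<dots> \<le> (\<Sum>hk\<in>UNIV. q ^ 3 * real (card (W (fst hk) (snd hk))))"
    using q_ge1 by (intro sum_mono2) auto
  also have "\<dots> = q ^ 3 * real (card ?U)"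
    by (simp add: card_SigmaI sum_distrib_left)
  also have "\<dots> \<le> q ^ 3 * (3 * (real (card F) * real (card Z)))"
    using U q_ge1 by (intro mult_left_mono) auto
  also have "\<dots> = 3 * ((q\<^sup>2 * real (card F)) * (q * real (card Z)))"
    by (simp add: eval_nat_numeral)
  also have "\<dots> \<le> 3 * ((\<kappa> * N\<^sup>2) * (11/10 * N))"
  proof -
    have "(q\<^sup>2 * real (card F)) * (q * real (card Z)) \<le> (\<kappa> * N\<^sup>2) * (11/10 * N)"
      by (rule mult_mono) (use K card_Z_bounds q_ge1 \<kappa> eps in \<open>auto simp: F_def\<close>)
    then show ?thesis
      by (rule mult_left_mono) simp
  qed
  also have "\<dots> = (33/4 * \<kappa> * N\<^sup>2) * (4/10 * N)"
    by simp
  finally have S: "real (card S) \<le> 33/4 * \<kappa> * N\<^sup>2"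
    using N_pos by (subst (asm) mult_le_cancel_right_pos) auto
  have "{(h, k). \<not> composable P h k} \<subseteq> S \<union> {(h, k). \<not> generic [k, h]}"
    by (auto simp: composable_def S_def W_def)
  then have "card {(h, k). \<not> composable P h k} \<le> card S + card {(h, k). \<not> generic [k, h]}"
    by (intro order.trans[OF card_mono card_Un_le]) auto
  then have "real (card {(h, k). \<not> composable P h k}) \<le> 33/4 * \<kappa> * N\<^sup>2 + \<epsilon> / 5 * N\<^sup>2"
    using S card_not_generic_pairs by linarith
  also have "\<dots> = (33/4 * \<kappa> + \<epsilon> / 5) * N\<^sup>2"
    by (simp add: algebra_simps)
  also have "\<dots> \<le> 9 * \<kappa> * N\<^sup>2"
    using \<kappa> eps by (intro mult_right_mono) auto
  finally show ?thesis .
qed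

lemma generic_independent:
  fixes a :: "nat \<Rightarrow> nat \<Rightarrow> ('p mod_ring)^'n"
  assumes "generic hs" and "\<And>x. (\<Sum>k<length hs. \<Sum>i<s. polar (Q i) (hs ! k) x *s a k i) = 0"
    and "k < length hs" "i < s"
  shows "a k i = 0"
proof (rule ccontr)
  assume "a k i \<noteq> 0"
  then obtain j where "a k i $ j \<noteq> 0"
    by (auto simp: vec_eq_iff)
  then obtain x where "(\<Sum>k<length hs. \<Sum>i<s. a k i $ j * polar (Q i) (hs ! k) x) \<noteq> 0"
    using assms(1)[unfolded generic_def, rule_format, of "\<lambda>k i. a k i $ j"] assms(3,4) by blast
  moreover have "(\<Sum>k<length hs. \<Sum>i<s. polar (Q i) (hs ! k) x *s a k i) $ j = 0"
    by (simp only: assms(2) zero_index)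
  ultimately show False
    by (simp add: sum_component mult.commute)
qed

text \<open>
  The maps by which a derivative may be changed without affecting it, up to constants, on the slice of
  \<open>h\<close>; the coefficients \<open>a i\<close> are vectors of the target space.
\<close>

definition correction :: "('p mod_ring)^'d \<Rightarrow> (nat \<Rightarrow> ('p mod_ring)^'n) \<Rightarrow> ('p mod_ring)^'d \<Rightarrow> ('p mod_ring)^'n" where
  "correction h a x = (\<Sum>i<s. polar (Q i) h x *s a i)"

lemma correction_add_left: "correction (h + k) a x = correction h a x + correction k a x"
  by (simp add: correction_def additive_map_add[OF add_polar(2)] vector_sadd_rdistrib sum.distrib)

lemma correction_add: "correction h (\<lambda>i. a i + b i) x = correction h a x + correction h b x"
  by (simp add: correction_def vector_add_ldistrib sum.distrib)

lemma correction_diff: "correction h (\<lambda>i. a i - b i) x = correction h a x - correction h b x"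
  by (simp add: correction_def vector_ssub_ldistrib sum_subtractf)

lemma correction_cong: "(\<And>i. i < s \<Longrightarrow> a i = b i) \<Longrightarrow> correction h a x = correction h b x"
  by (simp add: correction_def)

lemma additive_correction: "additive_map (correction h a)"
  by (simp add: additive_map_def correction_def additive_map_add[OF add_polar(1)] vector_sadd_rdistrib sum.distrib)

lemma correction_independent3:
  assumes "generic [w, v, u]" and "\<And>x. correction u a x + correction v b x + correction w c x = 0" and "i < s"
  shows "a i = 0" "b i = 0" "c i = 0"
proof -
  define A where "A k = (if k = 0 then c else if k = Suc 0 then b else a)" for k :: nat
  have "(\<Sum>k<length [w, v, u]. \<Sum>i<s. polar (Q i) ([w, v, u] ! k) x *s A k i) = 0" for x
    using assms(2)[of x] by (simp add: A_def correction_def eval_nat_numeral add_ac)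
  note * = generic_independent[OF assms(1) this _ assms(3)]
  show "a i = 0" "b i = 0" "c i = 0"
    using *[of 2] *[of 1] *[of 0] by (simp_all add: A_def)
qed

lemma correction_independent2:
  assumes "generic [v, u]" and "\<And>x. correction u a x + correction v b x = 0" and "i < s"
  shows "a i = 0" "b i = 0"
proof -
  define A where "A k = (if k = 0 then b else a)" for k :: nat
  have "(\<Sum>k<length [v, u]. \<Sum>i<s. polar (Q i) ([v, u] ! k) x *s A k i) = 0" for x
    using assms(2)[of x] by (simp add: A_def correction_def add_ac)
  note * = generic_independent[OF assms(1) this _ assms(3)]
  show "a i = 0" "b i = 0"
    using *[of 1] *[of 0] by (simp_all add: A_def)
qed

text \<open>
  For good \<open>x\<close> the cocycle identity makes \<open>E = M (h + k) - M h - M k\<close> equal to a constant \<open>e\<close>.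
  A coordinate of \<open>E\<close> outside the span of the functionals of \<open>h\<close> and \<open>h + k\<close> would take the
  value \<open>e\<close> at most \<open>11/10 * N / (p q\<^sup>3)\<close> times, which for \<open>p \<ge> 3\<close> is less than the
  \<open>5/10 * N / q\<^sup>3\<close> good points.
\<close>

lemma composable_imp_correction:
  fixes M :: "('p mod_ring)^'d \<Rightarrow> ('p mod_ring)^'d \<Rightarrow> ('p mod_ring)^'n"
  assumes M: "\<And>h. additive_map (M h)"
    and comp: "composable (\<lambda>h x. \<psi> (x + h) - \<psi> x = M h x + t h) h k"
  obtains a b where "\<And>x. M (h + k) x = M h x + M k x + correction h a x + correction k b x"
proof -
  let ?P = "\<lambda>h x. \<psi> (x + h) - \<psi> x = M h x + t h"
  let ?T = "translates [h + k, h]"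
  define E where "E x = M (h + k) x - M h x - M k x" for x
  define e where "e = M k h + t h + t k - t (h + k)"
  have gen: "generic [h + k, h]"
    using comp by (auto simp: composable_def intro: generic_add)
  have addE: "additive_map (\<lambda>x. E x $ j)" for j
    by (simp add: additive_map_def E_def additive_map_add[OF M])
  have Ee: "E x = e" if x: "?P h x" "?P k (x + h)" "?P (h + k) x" for x
  proof -
    have "M (h + k) x + t (h + k) = (\<psi> (x + h + k) - \<psi> (x + h)) + (\<psi> (x + h) - \<psi> x)"
      using x(3) by (simp add: add.assoc)
    also have "\<dots> = (M k x + M k h + t k) + (M h x + t h)"
      using x(1,2) by (simp add: additive_map_add[OF M])
    finally show ?thesis
      by (simp add: E_def e_def algebra_simps)
  qed
  define R where "R j c \<longleftrightarrow> (\<forall>x. E x $ j = (\<Sum>l<length [h + k, h]. \<Sum>i<s. c l i * polar (Q i) ([h + k, h] ! l) x))" for j c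
  have "\<exists>c. R j c" for j
  proof (rule ccontr)
    assume "\<not> ?thesis"
    then have "\<And>c. \<exists>x. E x $ j \<noteq> (\<Sum>l<length [h + k, h]. \<Sum>i<s. c l i * polar (Q i) ([h + k, h] ! l) x)"
      by (auto simp: R_def)
    then have "real CARD('p) * q ^ 3 * real (card {x \<in> ?T. E x $ j = e $ j}) \<le> 11/10 * N"
      using card_translates(3)[OF gen _ addE[of j], of "e $ j"] by (simp add: eval_nat_numeral)
    moreover have "3 * (q ^ 3 * real (card {x \<in> ?T. E x $ j = e $ j})) \<le> real CARD('p) * (q ^ 3 * real (card {x \<in> ?T. E x $ j = e $ j}))"
      using p3 q_ge1 by (intro mult_right_mono) auto
    moreover have "5/10 * N \<le> q ^ 3 * real (card {x \<in> ?T. ?P h x \<and> ?P k (x + h) \<and> ?P (h + k) x})"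
      by (rule composable_count[OF comp])
    moreover have "q ^ 3 * real (card {x \<in> ?T. ?P h x \<and> ?P k (x + h) \<and> ?P (h + k) x}) \<le> q ^ 3 * real (card {x \<in> ?T. E x $ j = e $ j})"
      using q_ge1 Ee by (intro mult_left_mono of_nat_mono card_mono) auto
    ultimately show False
      using N_pos by (simp add: mult.assoc)
  qed
  then obtain c where "\<And>j. R j (c j)"
    by metis
  then have c: "E x $ j = (\<Sum>l<length [h + k, h]. \<Sum>i<s. c j l i * polar (Q i) ([h + k, h] ! l) x)" for j x
    by (simp only: R_def)
  define b where "b i = (\<chi> j. c j 0 i)" for i
  define a where "a i = (\<chi> j. c j 0 i + c j 1 i)" for i
  have "E x = correction h a x + correction k b x" for x
    by (simp add: vec_eq_iff c correction_def a_def b_def sum_component additive_map_add[OF add_polar(2)]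
        sum.distrib algebra_simps)
  then have "M (h + k) x = M h x + M k x + correction h a x + correction k b x" for x
    by (simp add: E_def algebra_simps)
  then show thesis
    by (rule that)
qed

text \<open>
  The coefficients \<open>A\<close> satisfy a cocycle identity for most triples, by comparing the two ways of
  expanding \<open>M (u + v + w)\<close>. Fixing a \<open>u\<close> that is good for most \<open>(v, w)\<close> exhibits them as the
  coboundary of \<open>c h = A u (h - u)\<close>. The coefficients \<open>B\<close> need no cocycle of their own: they are the
  \<open>A\<close> for the pair in the other order.
\<close>

lemma corrected_additive:
  fixes M :: "('p mod_ring)^'d \<Rightarrow> ('p mod_ring)^'d \<Rightarrow> ('p mod_ring)^'n"
  assumes S: "\<And>h k. S h k \<Longrightarrow> generic [k, h] \<and> (\<exists>a b. \<forall>x. M (h + k) x = M h x + M k x + correction h a x + correction k b x)"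
    and few: "real (card {(h, k). \<not> S h k}) \<le> 9 * \<kappa> * N\<^sup>2" and \<kappa>: "\<epsilon> \<le> \<kappa>"
  obtains c where "real (card {(h, k). (\<lambda>x. M h x - correction h (c h) x) + (\<lambda>x. M k x - correction k (c k) x)
      \<noteq> (\<lambda>x. M (h + k) x - correction (h + k) (c (h + k)) x)}) \<le> 74 * \<kappa> * N\<^sup>2"
proof -
  have "\<forall>hk. \<exists>ab. S (fst hk) (snd hk) \<longrightarrow> (\<forall>x. M (fst hk + snd hk) x = M (fst hk) x + M (snd hk) x +
      correction (fst hk) (fst ab) x + correction (snd hk) (snd ab) x)"
    using S by auto
  then obtain AB where AB: "\<forall>hk. S (fst hk) (snd hk) \<longrightarrow> (\<forall>x. M (fst hk + snd hk) x = M (fst hk) x + M (snd hk) x +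
      correction (fst hk) (fst (AB hk)) x + correction (snd hk) (snd (AB hk)) x)"
    by (rule choice[THEN exE])
  define A where "A h k = fst (AB (h, k))" for h k
  define B where "B h k = snd (AB (h, k))" for h k
  have coc: "M (h + k) x = M h x + M k x + correction h (A h k) x + correction k (B h k) x" if "S h k" for h k x
    using AB[rule_format, of "(h, k)"] that by (simp add: A_def B_def)
  have symm: "B h k i = A k h i" if "S h k" "S k h" "i < s" for h k i
  proof -
    have eq: "correction h (\<lambda>i. A h k i - B k h i) x + correction k (\<lambda>i. B h k i - A k h i) x = 0" for x
    proof -
      have 1: "M (h + k) x = M h x + M k x + correction h (A h k) x + correction k (B h k) x"
        by (rule coc[OF that(1)])
      have 2: "M (h + k) x = M k x + M h x + correction k (A k h) x + correction h (B k h) x"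
        using coc[OF that(2), of x] by (simp only: add.commute[of k h])
      have "correction h (\<lambda>i. A h k i - B k h i) x + correction k (\<lambda>i. B h k i - A k h i) x =
          (M h x + M k x + correction h (A h k) x + correction k (B h k) x) -
          (M k x + M h x + correction k (A k h) x + correction h (B k h) x)"
        by (simp only: correction_diff) (simp add: algebra_simps)
      also have "\<dots> = 0"
        unfolding 1[symmetric] 2[symmetric] by simp
      finally show ?thesis .
    qed
    have "B h k i - A k h i = 0"
      by (rule correction_independent2(2)[OF _ eq that(3)]) (use S[OF that(1)] in blast)
    then show ?thesis
      by simp
  qed
  define T where "T u v w \<longleftrightarrow> S u v \<and> S (u + v) w \<and> S v w \<and> S u (v + w) \<and> generic [w, v, u]" for u v w
  have cocycle: "A u v i + A (u + v) w i = A u (v + w) i" if "T u v w" "i < s" for u v w i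
  proof -
    have S': "S u v" "S (u + v) w" "S v w" "S u (v + w)" "generic [w, v, u]"
      using that(1) by (auto simp: T_def)
    have eq: "correction u (\<lambda>i. A u v i + A (u + v) w i - A u (v + w) i) x +
        correction v (\<lambda>i. B u v i + A (u + v) w i - A v w i - B u (v + w) i) x +
        correction w (\<lambda>i. B (u + v) w i - B v w i - B u (v + w) i) x = 0" for x
    proof -
      have 1: "M (u + v + w) x = M u x + M v x + correction u (A u v) x + correction v (B u v) x + M w x +
          (correction u (A (u + v) w) x + correction v (A (u + v) w) x) + correction w (B (u + v) w) x"
        by (simp only: coc[OF S'(2)] coc[OF S'(1)] correction_add_left)
      have 2: "M (u + v + w) x = M u x + (M v x + M w x + correction v (A v w) x + correction w (B v w) x) +
          correction u (A u (v + w)) x + (correction v (B u (v + w)) x + correction w (B u (v + w)) x)"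
        by (simp only: add.assoc[of u v w] coc[OF S'(4)] coc[OF S'(3)] correction_add_left)
      have "correction u (\<lambda>i. A u v i + A (u + v) w i - A u (v + w) i) x +
          correction v (\<lambda>i. B u v i + A (u + v) w i - A v w i - B u (v + w) i) x +
          correction w (\<lambda>i. B (u + v) w i - B v w i - B u (v + w) i) x =
          (M u x + M v x + correction u (A u v) x + correction v (B u v) x + M w x +
            (correction u (A (u + v) w) x + correction v (A (u + v) w) x) + correction w (B (u + v) w) x) -
          (M u x + (M v x + M w x + correction v (A v w) x + correction w (B v w) x) +
            correction u (A u (v + w)) x + (correction v (B u (v + w)) x + correction w (B u (v + w)) x))"
        by (simp only: correction_diff correction_add) (simp add: algebra_simps)
      also have "\<dots> = 0"
        unfolding 1[symmetric] 2[symmetric] by simp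
      finally show ?thesis .
    qed
    have "A u v i + A (u + v) w i - A u (v + w) i = 0"
      by (rule correction_independent3(1)[OF S'(5) eq that(2)])
    then show ?thesis
      by simp
  qed
  have few_T: "real (card {(u, v, w). \<not> T u v w}) \<le> 37 * \<kappa> * N ^ 3"
  proof -
    let ?S = "{(h, k). \<not> S h k}"
    let ?X1 = "{(u, v, w :: ('p mod_ring)^'d). \<not> S u v}" and ?X2 = "{(u, v, w). \<not> S (u + v) w}"
    let ?X3 = "{(u :: ('p mod_ring)^'d, v, w). \<not> S v w}" and ?X4 = "{(u, v, w). \<not> S u (v + w)}"
    let ?X5 = "{(u, v, w). \<not> generic [w, v, u]}"
    have X1: "real (card ?X1) \<le> real (card ?S) * N"
      unfolding N_def by (rule card_preimage_pairs[where f = "\<lambda>(u, v, w). ((u, v), w)" and S = ?S]) (auto simp: inj_on_def)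
    have X2: "real (card ?X2) \<le> real (card ?S) * N"
      unfolding N_def by (rule card_preimage_pairs[where f = "\<lambda>(u, v, w). ((u + v, w), v)" and S = ?S]) (auto simp: inj_on_def)
    have X3: "real (card ?X3) \<le> real (card ?S) * N"
      unfolding N_def by (rule card_preimage_pairs[where f = "\<lambda>(u, v, w). ((v, w), u)" and S = ?S]) (auto simp: inj_on_def)
    have X4: "real (card ?X4) \<le> real (card ?S) * N"
      unfolding N_def by (rule card_preimage_pairs[where f = "\<lambda>(u, v, w). ((u, v + w), v)" and S = ?S]) (auto simp: inj_on_def)
    have "real (card ?S) * N \<le> (9 * \<kappa> * N\<^sup>2) * N"
      using few N_pos by (intro mult_right_mono) auto
    also have "\<dots> = 9 * \<kappa> * N ^ 3"
      by (simp add: eval_nat_numeral)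
    finally have SN: "real (card ?S) * N \<le> 9 * \<kappa> * N ^ 3" .
    have "{(u, v, w). \<not> T u v w} \<subseteq> ?X1 \<union> ?X2 \<union> ?X3 \<union> ?X4 \<union> ?X5"
      by (auto simp: T_def)
    then have "card {(u, v, w). \<not> T u v w} \<le> card (?X1 \<union> ?X2 \<union> ?X3 \<union> ?X4 \<union> ?X5)"
      by (intro card_mono) auto
    then have "card {(u, v, w). \<not> T u v w} \<le> card ?X1 + card ?X2 + card ?X3 + card ?X4 + card ?X5"
      using card_Un_le[of "?X1 \<union> ?X2 \<union> ?X3 \<union> ?X4" ?X5] card_Un_le[of "?X1 \<union> ?X2 \<union> ?X3" ?X4]
        card_Un_le[of "?X1 \<union> ?X2" ?X3] card_Un_le[of ?X1 ?X2] by linarith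
    then have "real (card {(u, v, w). \<not> T u v w}) \<le> 4 * (9 * \<kappa> * N ^ 3) + 3 / 10 * \<epsilon> * N ^ 3"
      using X1 X2 X3 X4 SN card_not_generic_triples by linarith
    also have "\<dots> = (36 * \<kappa> + 3 / 10 * \<epsilon>) * N ^ 3"
      by (simp add: algebra_simps)
    also have "\<dots> \<le> 37 * \<kappa> * N ^ 3"
      using \<kappa> eps N_pos by (intro mult_right_mono) auto
    finally show ?thesis .
  qed
  obtain u where u: "real (card {(v, w). \<not> T u v w}) \<le> 37 * \<kappa> * N\<^sup>2"
  proof -
    have "{(u, v, w). \<not> T u v w} = (SIGMA u:UNIV. {(v, w). \<not> T u v w})"
      by auto
    then have "real (\<Sum>u\<in>UNIV. card {(v, w). \<not> T u v w}) = real (card {(u, v, w). \<not> T u v w})"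
      by (simp add: card_SigmaI)
    also have "\<dots> \<le> 37 * \<kappa> * N\<^sup>2 * N"
      using few_T by (simp add: eval_nat_numeral mult.assoc)
    finally have "real (\<Sum>u\<in>UNIV. card {(v, w). \<not> T u v w}) \<le> 37 * \<kappa> * N\<^sup>2 * real (card (UNIV :: (('p mod_ring)^'d) set))"
      by (simp only: N_def)
    from exists_le_average[OF _ _ this] that show thesis
      by auto
  qed
  define c where "c h = A u (h - u)" for h
  let ?M = "\<lambda>h x. M h x - correction h (c h) x"
  have A_eq: "A h k i = c (h + k) i - c h i" if "T u (h - u) k" "i < s" for h k i
    using cocycle[OF that] by (simp add: c_def algebra_simps)
  have good: "?M h + ?M k = ?M (h + k)" if T: "T u (h - u) k" "T u (k - u) h" for h k
  proof
    fix x
    have S: "S h k" "S k h"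
      using T by (auto simp: T_def)
    have 1: "correction h (A h k) x = correction h (\<lambda>i. c (h + k) i - c h i) x"
      using A_eq[OF T(1)] by (rule correction_cong)
    have 2: "correction k (B h k) x = correction k (\<lambda>i. c (h + k) i - c k i) x"
      using A_eq[OF T(2)] symm[OF S] by (intro correction_cong) (simp add: add.commute)
    show "(?M h + ?M k) x = ?M (h + k) x"
      by (simp only: plus_fun_apply coc[OF S(1)] 1 2 correction_diff correction_add_left) (simp add: algebra_simps)
  qed
  have "{(h, k). ?M h + ?M k \<noteq> ?M (h + k)} \<subseteq> {(h, k). \<not> T u (h - u) k} \<union> {(h, k). \<not> T u (k - u) h}"
    using good by auto
  then have "card {(h, k). ?M h + ?M k \<noteq> ?M (h + k)} \<le> card {(h, k). \<not> T u (h - u) k} + card {(h, k). \<not> T u (k - u) h}"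
    by (intro order.trans[OF card_mono card_Un_le]) auto
  moreover have "card {(h, k). \<not> T u (h - u) k} \<le> card {(v, w). \<not> T u v w}"
    by (rule card_inj_on_le[of "\<lambda>(h, k). (h - u, k)"]) (auto simp: inj_on_def)
  moreover have "card {(h, k). \<not> T u (k - u) h} \<le> card {(v, w). \<not> T u v w}"
    by (rule card_inj_on_le[of "\<lambda>(h, k). (k - u, h)"]) (auto simp: inj_on_def)
  ultimately have "real (card {(h, k). ?M h + ?M k \<noteq> ?M (h + k)}) \<le> 74 * \<kappa> * N\<^sup>2"
    using u by linarith
  then show thesis
    by (rule that)
qed

end


context high_rank_variety
begin

text \<open>
  Linearity testing is applied to \<open>h \<mapsto> M h - correction h (c h)\<close>, whose values are functions.
  On the slice of \<open>h\<close> every \<open>polar (Q i) h\<close> is constant, so undoing the correction only changes the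
  constant \<open>t h\<close>.
\<close>

lemma derivatives_bilinear:
  fixes \<psi> :: "('p mod_ring)^'d \<Rightarrow> ('p mod_ring)^'n"
  assumes "approx_quadratic_on (1 - \<epsilon>) Z \<psi>"
  obtains B t where "\<And>h. additive_map (B h)" and "\<And>x. additive_map (\<lambda>h. B h x)"
    and "q\<^sup>2 * real (card {(h, x). x \<in> Z \<and> x + h \<in> Z \<and> \<psi> (x + h) - \<psi> x \<noteq> B h x + t h}) \<le> 50000 * \<epsilon> * N\<^sup>2"
proof -
  obtain M t where M: "\<And>h. additive_map (M h)"
    and fail: "q\<^sup>2 * real (card {(h, x). x \<in> Z \<and> x + h \<in> Z \<and> \<psi> (x + h) - \<psi> x \<noteq> M h x + t h}) \<le> 250 * \<epsilon> * N\<^sup>2"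
    using derivatives_affine[OF assms] by blast
  let ?P = "\<lambda>h x. \<psi> (x + h) - \<psi> x = M h x + t h"
  have few: "real (card {(h, k). \<not> composable ?P h k}) \<le> 9 * (250 * \<epsilon>) * N\<^sup>2"
    by (rule card_not_composable) (use fail eps in auto)
  have comp: "generic [k, h] \<and> (\<exists>a b. \<forall>x. M (h + k) x = M h x + M k x + correction h a x + correction k b x)"
    if "composable ?P h k" for h k
  proof
    show "generic [k, h]"
      using that by (simp add: composable_def)
    show "\<exists>a b. \<forall>x. M (h + k) x = M h x + M k x + correction h a x + correction k b x"
      by (rule composable_imp_correction[OF M that]) blast
  qed
  have "\<epsilon> \<le> 250 * \<epsilon>"
    using eps by simp
  from corrected_additive[OF comp few this]
  obtain c where c: "real (card {(h, k). (\<lambda>x. M h x - correction h (c h) x) + (\<lambda>x. M k x - correction k (c k) x)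
      \<noteq> (\<lambda>x. M (h + k) x - correction (h + k) (c (h + k)) x)}) \<le> 74 * (250 * \<epsilon>) * N\<^sup>2"
    by blast
  define f where "f h = (\<lambda>x. M h x - correction h (c h) x)" for h
  have f_add: "additive_map (f h)" for h
    by (simp add: additive_map_def f_def additive_map_add[OF M] additive_map_add[OF additive_correction])
  have "real (card {(h, k). h \<in> UNIV \<and> k \<in> UNIV \<and> f h + f k \<noteq> f (h + k)}) \<le> 74 * (250 * \<epsilon>) * (real (card (UNIV :: (('p mod_ring)^'d) set)))\<^sup>2"
    using c unfolding f_def N_def by simp
  note bad = this
  have "74 * (250 * \<epsilon>) < 1/6"
    using eps by simp
  from linearity_testing[OF finite subgroup_set_UNIV bad this]
  obtain B where add: "\<And>h k. h \<in> UNIV \<Longrightarrow> k \<in> UNIV \<Longrightarrow> B (h + k) = B h + B k"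
    and fB: "real (card {h \<in> UNIV. f h \<noteq> B h}) \<le> 2 * (74 * (250 * \<epsilon>)) * real (card (UNIV :: (('p mod_ring)^'d) set))"
    by blast
  have B: "B (h + k) = B h + B k" for h k
    using add by simp
  define E where "E = {h. f h \<noteq> B h}"
  have E: "real (card E) \<le> 37000 * \<epsilon> * N"
    using fB by (simp add: E_def N_def)
  have B1: "additive_map (B h)" for h
  proof -
    \<comment> \<open>Every \<open>h\<close> is a sum of two elements at which \<open>B\<close> and \<open>f\<close> agree.\<close>
    have "card {k. h - k \<in> E} \<le> card E"
      by (rule card_inj_on_le[of "\<lambda>k. h - k"]) (auto simp: inj_on_def)
    then have "real (card (E \<union> {k. h - k \<in> E})) \<le> 2 * (37000 * \<epsilon> * N)"
      using E card_Un_le[of E "{k. h - k \<in> E}"] by linarith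
    also have "\<dots> = (74000 * \<epsilon>) * N"
      by simp
    also have "\<dots> < 1 * N"
      using eps N_pos by (intro mult_strict_right_mono) auto
    finally have "E \<union> {k. h - k \<in> E} \<noteq> UNIV"
      by (auto simp: N_def)
    then obtain k where k: "f k = B k" "f (h - k) = B (h - k)"
      by (auto simp: E_def)
    have "B h = f k + f (h - k)"
      using B[of k "h - k"] k by simp
    then show ?thesis
      by (simp add: additive_map_def additive_map_add[OF f_add])
  qed
  have B2: "additive_map (\<lambda>h. B h x)" for x
    by (simp add: additive_map_def B)
  define t' where "t' h = t h + (\<Sum>i<s. (Q i 0 - Q i h) *s c h i)" for h
  have P': "\<psi> (x + h) - \<psi> x = B h x + t' h" if "h \<notin> E" "x \<in> Z" "x + h \<in> Z" "?P h x" for h x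
  proof -
    have "correction h (c h) x = (\<Sum>i<s. (Q i 0 - Q i h) *s c h i)"
      unfolding correction_def using that(2,3) mem_Z_shift by (intro sum.cong) auto
    then have "M h x + t h = f h x + t' h"
      by (simp add: f_def t'_def)
    with that show ?thesis
      by (simp add: E_def)
  qed
  let ?F = "{(h, x). x \<in> Z \<and> x + h \<in> Z \<and> \<psi> (x + h) - \<psi> x \<noteq> M h x + t h}"
  let ?G = "{(h, x). h \<in> E \<and> x \<in> Z \<and> x + h \<in> Z}"
  have "{(h, x). x \<in> Z \<and> x + h \<in> Z \<and> \<psi> (x + h) - \<psi> x \<noteq> B h x + t' h} \<subseteq> ?F \<union> ?G"
    using P' by blast
  then have "card {(h, x). x \<in> Z \<and> x + h \<in> Z \<and> \<psi> (x + h) - \<psi> x \<noteq> B h x + t' h} \<le> card ?F + card ?G"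
    by (intro order.trans[OF card_mono card_Un_le]) auto
  then have "q\<^sup>2 * real (card {(h, x). x \<in> Z \<and> x + h \<in> Z \<and> \<psi> (x + h) - \<psi> x \<noteq> B h x + t' h}) \<le> q\<^sup>2 * (real (card ?F) + real (card ?G))"
    by (intro mult_left_mono) auto
  also have "\<dots> \<le> 250 * \<epsilon> * N\<^sup>2 + (11/10 * (37000 * \<epsilon>) + \<epsilon> / 10) * N\<^sup>2"
    unfolding distrib_left by (intro add_mono fail card_pairs_over E)
  also have "\<dots> = (250 + 11/10 * 37000 + 1/10) * (\<epsilon> * N\<^sup>2)"
    by (simp add: algebra_simps)
  also have "\<dots> \<le> 50000 * (\<epsilon> * N\<^sup>2)"
    using eps by (intro mult_right_mono) auto
  finally show thesis
    using that[OF B1 B2, of t'] by (simp add: mult.assoc)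
qed

lemma quadratic_of_bilinear:
  fixes B :: "'v::ab_group_add \<Rightarrow> 'v \<Rightarrow> ('p mod_ring)^'n"
  assumes B: "\<And>h. additive_map (B h)" "\<And>x. additive_map (\<lambda>h. B h x)" and L: "additive_map L"
  shows "quadratic (\<lambda>x. (1/2) *s B x x + L x + e)"
  unfolding quadratic_def mult_diff_def
  by (simp add: additive_map_add[OF B(1)] additive_map_add[OF B(2)] additive_map_add[OF L]
      vector_add_ldistrib algebra_simps)

text \<open>
  The left-hand side of \<open>t (h + k) = t h + t k + B k h\<close> is symmetric in \<open>h\<close> and \<open>k\<close>.
\<close>

lemma bilinear_symmetric:
  fixes B :: "('p mod_ring)^'d \<Rightarrow> ('p mod_ring)^'d \<Rightarrow> ('p mod_ring)^'n"
  assumes B: "\<And>h. additive_map (B h)" "\<And>x. additive_map (\<lambda>h. B h x)"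
    and t: "real (card {(h, k). t (h + k) \<noteq> t h + t k + B k h}) \<le> \<delta> * N\<^sup>2" and \<delta>: "8 * \<delta> < 1"
  shows "B h k = B k h"
proof -
  let ?X = "{(h, k). t (h + k) \<noteq> t h + t k + B k h}"
  let ?Y = "{(h, k). t (k + h) \<noteq> t k + t h + B h k}"
  define D where "D h k = B h k - B k h" for h k
  have "card ?Y \<le> card ?X"
    by (rule card_inj_on_le[of "\<lambda>(h, k). (k, h)"]) (auto simp: inj_on_def)
  moreover have "D h k = 0" if "(h, k) \<notin> ?X" "(h, k) \<notin> ?Y" for h k
  proof -
    have "t h + t k + B k h = t h + t k + B h k"
      using that by (simp add: add.commute)
    then show ?thesis
      by (simp add: D_def)
  qed
  then have "{(h, k). D h k \<noteq> 0} \<subseteq> ?X \<union> ?Y"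
    by blast
  then have "card {(h, k). D h k \<noteq> 0} \<le> card ?X + card ?Y"
    by (intro order.trans[OF card_mono card_Un_le]) auto
  ultimately have "4 * real (card {(h, k). D h k \<noteq> 0}) \<le> (8 * \<delta>) * N\<^sup>2"
    using t by linarith
  also have "\<dots> < 1 * N\<^sup>2"
    using \<delta> N_pos by (intro mult_strict_right_mono) auto
  finally have few: "4 * real (card {(h, k). D h k \<noteq> 0}) < (real CARD(('p mod_ring)^'d))\<^sup>2"
    by (simp only: N_def mult_1)
  have "D h k = 0"
    by (rule biadditive_eq_0[OF _ _ few])
      (simp_all add: additive_map_def D_def additive_map_add[OF B(1)] additive_map_add[OF B(2)])
  then show ?thesis
    by (simp add: D_def)
qed

text \<open>
  The factor \<open>2 ^ 21\<close> collects all losses: \<open>derivatives_bilinear\<close> costs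
  \<open>\<kappa> = 50000 \<epsilon>\<close>, integration multiplies it by \<open>21\<close>, and comparing \<open>(N / q)\<^sup>2\<close> with
  \<open>card Z ^ 2\<close> by \<open>100/81\<close>.
\<close>

theorem agrees_with_quadratic:
  fixes \<psi> :: "('p mod_ring)^'d \<Rightarrow> ('p mod_ring)^'n"
  assumes "approx_quadratic_on (1 - \<epsilon>) Z \<psi>"
  obtains F where "quadratic F" and "real (card {x \<in> Z. \<psi> x \<noteq> F x}) \<le> 2 ^ 21 * \<epsilon> * real (card Z)"
proof -
  define \<kappa> where "\<kappa> = 50000 * \<epsilon>"
  have \<kappa>: "\<epsilon> \<le> \<kappa>" "\<kappa> < 1 / 10 ^ 6"
    using eps by (auto simp: \<kappa>_def)
  obtain B t where B: "\<And>h. additive_map (B h)" "\<And>x. additive_map (\<lambda>h. B h x)"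
    and fail: "q\<^sup>2 * real (card {(h, x). x \<in> Z \<and> x + h \<in> Z \<and> \<psi> (x + h) - \<psi> x \<noteq> B h x + t h}) \<le> \<kappa> * N\<^sup>2"
    using derivatives_bilinear[OF assms] unfolding \<kappa>_def by blast
  let ?P = "\<lambda>h x. \<psi> (x + h) - \<psi> x = B h x + t h"
  have "real (card {(h, k). \<not> composable ?P h k}) \<le> 9 * \<kappa> * N\<^sup>2"
    by (rule card_not_composable[OF fail \<kappa>(1)])
  have t_eq: "t (h + k) = t h + t k + B k h" if comp: "composable ?P h k" for h k
  proof -
    have "{x \<in> translates [h + k, h]. ?P h x \<and> ?P k (x + h) \<and> ?P (h + k) x} \<noteq> {}"
      using composable_count[OF comp] N_pos by (metis (no_types, lifting) card.empty mult_zero_right of_nat_0 not_less zero_less_divide_iff mult_pos_pos zero_less_numeral)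
    then obtain x where x: "?P h x" "?P k (x + h)" "?P (h + k) x"
      by blast
    have "B (h + k) x + t (h + k) = (\<psi> (x + h + k) - \<psi> (x + h)) + (\<psi> (x + h) - \<psi> x)"
      using x(3) by (simp add: add.assoc)
    also have "\<dots> = (B k x + B k h + t k) + (B h x + t h)"
      using x(1,2) by (simp add: additive_map_add[OF B(1)])
    finally show ?thesis
      by (simp add: additive_map_add[OF B(2)] algebra_simps)
  qed
  have "card {(h, k). t (h + k) \<noteq> t h + t k + B k h} \<le> card {(h, k). \<not> composable ?P h k}"
    using t_eq by (intro card_mono) auto
  then have few: "real (card {(h, k). t (h + k) \<noteq> t h + t k + B k h}) \<le> 9 * \<kappa> * N\<^sup>2"
    using \<open>real (card {(h, k). \<not> composable ?P h k}) \<le> 9 * \<kappa> * N\<^sup>2\<close> by linarith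
  have sym: "B h k = B k h" for h k
    by (rule bilinear_symmetric[OF B few]) (use \<kappa> in simp)
  have two: "(2 :: 'p mod_ring) \<noteq> 0"
    by (rule two_neq_zero_mod_ring[OF p3])
  have half: "(1/2) *s B (h + k) (h + k) = (1/2) *s B h h + (1/2) *s B k k + B h k" for h k
  proof -
    have "B (h + k) (h + k) = B h h + B k k + 2 *s B h k"
      using sym[of k h] by (simp add: additive_map_add[OF B(1)] additive_map_add[OF B(2)] vec_eq_iff)
    then show ?thesis
      using two by (simp add: vector_add_ldistrib vector_smult_assoc)
  qed
  define f where "f h = t h - (1/2) *s B h h" for h
  have f_eq: "f h + f k = f (h + k)" if "t (h + k) = t h + t k + B k h" for h k
    unfolding f_def that half using sym[of h k] by (simp add: algebra_simps)
  have "card {(h, k). h \<in> UNIV \<and> k \<in> UNIV \<and> f h + f k \<noteq> f (h + k)} \<le> card {(h, k). t (h + k) \<noteq> t h + t k + B k h}"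
    using f_eq by (intro card_mono) auto
  then have "real (card {(h, k). h \<in> UNIV \<and> k \<in> UNIV \<and> f h + f k \<noteq> f (h + k)}) \<le> 9 * \<kappa> * (real (card (UNIV :: (('p mod_ring)^'d) set)))\<^sup>2"
    using few unfolding N_def by linarith
  note bad = this
  have "9 * \<kappa> < 1/6"
    using \<kappa> by simp
  from linearity_testing[OF finite subgroup_set_UNIV bad this]
  obtain L where add: "\<And>a b. a \<in> UNIV \<Longrightarrow> b \<in> UNIV \<Longrightarrow> L (a + b) = L a + L b"
    and fL: "real (card {h \<in> UNIV. f h \<noteq> L h}) \<le> 2 * (9 * \<kappa>) * real (card (UNIV :: (('p mod_ring)^'d) set))"
    by blast
  have L: "additive_map L"
    using add by (simp add: additive_map_def)
  define E where "E = {h. f h \<noteq> L h}"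
  have E: "real (card E) \<le> 18 * \<kappa> * N"
    using fL by (simp add: E_def N_def)
  define F where "F x = (1/2) *s B x x + L x" for x
  have F: "F (x + h) - F x = B h x + t h" if "h \<notin> E" for x h
  proof -
    have "t h = L h + (1/2) *s B h h"
      using that by (simp add: E_def f_def algebra_simps)
    then show ?thesis
      unfolding F_def half using sym[of x h] by (simp add: additive_map_add[OF L])
  qed
  define G where "G = {(h, x). x \<in> Z \<and> x + h \<in> Z \<and> \<psi> (x + h) - F (x + h) \<noteq> \<psi> x - F x}"
  let ?F1 = "{(h, x). x \<in> Z \<and> x + h \<in> Z \<and> \<psi> (x + h) - \<psi> x \<noteq> B h x + t h}"
  let ?F2 = "{(h, x). h \<in> E \<and> x \<in> Z \<and> x + h \<in> Z}"
  have "(h, x) \<notin> G" if "(h, x) \<notin> ?F1" "(h, x) \<notin> ?F2" for h x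
  proof
    assume "(h, x) \<in> G"
    then have "\<psi> (x + h) - \<psi> x = F (x + h) - F x" "\<psi> (x + h) - F (x + h) \<noteq> \<psi> x - F x"
      using F[of h x] that by (auto simp: G_def)
    then show False
      by (simp add: algebra_simps)
  qed
  then have "G \<subseteq> ?F1 \<union> ?F2"
    by auto
  then have "card G \<le> card ?F1 + card ?F2"
    by (intro order.trans[OF card_mono card_Un_le]) auto
  then have "q\<^sup>2 * real (card G) \<le> q\<^sup>2 * (real (card ?F1) + real (card ?F2))"
    by (intro mult_left_mono) auto
  also have "\<dots> \<le> \<kappa> * N\<^sup>2 + (11/10 * (18 * \<kappa>) + \<epsilon> / 10) * N\<^sup>2"
    unfolding distrib_left by (intro add_mono fail card_pairs_over E)
  also have "\<dots> = (208/10 * \<kappa> + \<epsilon> / 10) * N\<^sup>2"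
    by (simp add: algebra_simps)
  also have "\<dots> \<le> (21 * \<kappa>) * N\<^sup>2"
    using \<kappa> eps by (intro mult_right_mono) auto
  finally have G: "q\<^sup>2 * real (card G) \<le> 21 * \<kappa> * N\<^sup>2" .
  have "(9/10 * N)\<^sup>2 \<le> (q * real (card Z))\<^sup>2"
    using card_Z_bounds(1) N_pos by (intro power_mono) auto
  then have NZ: "N\<^sup>2 \<le> 100/81 * (q\<^sup>2 * (real (card Z))\<^sup>2)"
    by (simp add: power_mult_distrib power_divide)
  have "q\<^sup>2 * real (card G) \<le> 21 * \<kappa> * (100/81 * (q\<^sup>2 * (real (card Z))\<^sup>2))"
    using NZ \<kappa> eps by (intro order_trans[OF G] mult_left_mono) auto
  also have "\<dots> = q\<^sup>2 * ((2100/81 * \<kappa>) * (real (card Z))\<^sup>2)"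
    by simp
  finally have "real (card G) \<le> (2100/81 * \<kappa>) * (real (card Z))\<^sup>2"
    using q_ge1 by (subst (asm) mult_le_cancel_left_pos) auto
  also have "\<dots> \<le> (2 ^ 21 * \<epsilon>) * (real (card Z))\<^sup>2"
    using eps by (intro mult_right_mono) (auto simp: \<kappa>_def)
  also have "card G = card {(x, y). x \<in> Z \<and> y \<in> Z \<and> \<psi> y - F y \<noteq> \<psi> x - F x}"
    by (rule bij_betw_same_card[of "\<lambda>(h, x). (x, x + h)"], rule bij_betwI[where g = "\<lambda>(x, y). (y - x, x)"])
      (auto simp: G_def)
  finally have avg: "real (\<Sum>x\<in>Z. card {y \<in> Z. \<psi> y - F y \<noteq> \<psi> x - F x}) \<le> (2 ^ 21 * \<epsilon> * real (card Z)) * real (card Z)"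
    by (simp add: card_pairs_eq_sum power2_eq_square mult.assoc)
  have "Z \<noteq> {}"
    using card_Z_bounds(1) N_pos by auto
  from exists_le_average[OF _ this avg] obtain x0
    where "real (card {y \<in> Z. \<psi> y - F y \<noteq> \<psi> x0 - F x0}) \<le> 2 ^ 21 * \<epsilon> * real (card Z)"
    by auto
  moreover have "{x \<in> Z. \<psi> x \<noteq> F x + (\<psi> x0 - F x0)} = {y \<in> Z. \<psi> y - F y \<noteq> \<psi> x0 - F x0}"
    by (auto simp: algebra_simps)
  moreover have "quadratic (\<lambda>x. F x + (\<psi> x0 - F x0))"
    unfolding F_def by (rule quadratic_of_bilinear[OF B L])
  ultimately show thesis
    using that[of "\<lambda>x. F x + (\<psi> x0 - F x0)"] by simp
qed

end

section \<open>The quantitative statement\<close>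

lemma quadratic_linear_combination:
  fixes f :: "nat \<Rightarrow> 'v::ab_group_add \<Rightarrow> 'p::prime_card mod_ring"
  assumes "\<And>i. i < s \<Longrightarrow> quadratic (f i)"
  shows "quadratic (\<lambda>x. \<Sum>i<s. l i * f i x)"
proof -
  have eq: "mult_diff h (\<lambda>x. \<Sum>i<s. l i * g i x) = (\<lambda>x. \<Sum>i<s. l i * mult_diff h (g i) x)"
    for h and g :: "nat \<Rightarrow> 'v \<Rightarrow> 'p mod_ring"
    by (simp add: mult_diff_def sum_subtractf right_diff_distrib)
  show ?thesis
    using assms by (simp add: quadratic_def eq)
qed

lemma polar_linear_combination:
  "polar (\<lambda>x. \<Sum>i<s. l i * f i x) h x = (\<Sum>i<s. l i * polar (f i) h x :: 'p::prime_card mod_ring)"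
  by (simp add: polar_def sum_subtractf [symmetric] sum.distrib [symmetric] algebra_simps)

theorem lemma8p1:
  fixes p s R :: nat
    and \<epsilon> :: real
    and Qs :: "nat \<Rightarrow> ('p::prime_card mod_ring)^'d \<Rightarrow> 'p mod_ring"
    and \<psi> :: "('p mod_ring)^'d \<Rightarrow> ('p mod_ring)^'n"
  assumes "p = CARD('p)" and "p \<ge> 3"
    and "\<And>i. i < s \<Longrightarrow> quadratic (Qs i)"
    and "\<And>l :: nat \<Rightarrow> 'p mod_ring. (\<exists>i<s. l i \<noteq> 0) \<Longrightarrow>
           quad_rank (\<lambda>x. \<Sum>i<s. l i * Qs i x) \<ge> R"
    and "0 < \<epsilon>" and "\<epsilon> < 1 / (2 ^ 160 * real p ^ 16)"
    and "real R \<ge> 2 ^ 20 * (real s + log (real p) (1 / \<epsilon>))"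
    and "approx_quadratic_on (1 - \<epsilon>) (common_zeros s Qs) \<psi>"
  shows "\<exists>Q :: ('p mod_ring)^'d \<Rightarrow> ('p mod_ring)^'n. quadratic Q \<and>
           proportion (common_zeros s Qs) (\<lambda>x. \<psi> x = Q x) \<ge> 1 - 2 ^ 10 * root 16 \<epsilon>"
proof -
  define q where "q = real CARD('p) ^ s"
  define \<rho> where "\<rho> = 1 / real CARD('p) ^ R"
  have p: "real p \<ge> 3" "real p > 1"
    using assms(2) by auto
  have q1: "q \<ge> 1"
    using p by (simp add: q_def assms(1)[symmetric])
  have "\<epsilon> * (2 ^ 160 * real p ^ 16) < 1"
    using assms(6) p by (simp add: pos_less_divide_eq)
  moreover have "\<epsilon> * (2 ^ 160 * real p) \<le> \<epsilon> * (2 ^ 160 * real p ^ 16)"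
    using p assms(5) self_le_power[of "real p" 16] by (intro mult_left_mono) auto
  ultimately have eps_p: "\<epsilon> * (2 ^ 160 * real p) < 1"
    by linarith
  moreover have "\<epsilon> * (2 ^ 160 * 1) \<le> \<epsilon> * (2 ^ 160 * real p)"
    using p assms(5) by (intro mult_left_mono) auto
  ultimately have eps160: "\<epsilon> < 1 / 2 ^ 160"
    by (simp add: field_simps)
  have eps1: "\<epsilon> \<le> 1"
    using eps160 by simp
  \<comment> \<open>The exponent \<open>40\<close> suffices for \<open>rho1\<close> and, after a square root, for \<open>rho2\<close>.\<close>
  have "(q / \<epsilon>) ^ 40 \<le> real p ^ R"
  proof -
    have "real p powr (real s + log (real p) (1 / \<epsilon>)) = q / \<epsilon>"
      using p assms(5) by (simp add: powr_add powr_realpow q_def assms(1)[symmetric])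
    then have "(q / \<epsilon>) ^ 40 = (real p powr (real s + log (real p) (1 / \<epsilon>))) powr 40"
      using q1 assms(5) by simp
    also have "\<dots> = real p powr (40 * (real s + log (real p) (1 / \<epsilon>)))"
      by (simp add: powr_powr mult.commute)
    also have "\<dots> \<le> real p powr real R"
    proof (rule powr_mono)
      have "0 \<le> real s + log (real p) (1 / \<epsilon>)"
        using p assms(5) eps1 by (simp add: zero_le_log_cancel_iff)
      then have "40 * (real s + log (real p) (1 / \<epsilon>)) \<le> 2 ^ 20 * (real s + log (real p) (1 / \<epsilon>))"
        by (intro mult_right_mono) auto
      then show "40 * (real s + log (real p) (1 / \<epsilon>)) \<le> real R"
        using assms(7) by linarith
    qed (use p in auto)
    finally show ?thesis
      using p by (simp add: powr_realpow)
  qed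
  then have "1 / real p ^ R \<le> 1 / (q / \<epsilon>) ^ 40"
    using q1 assms(5) p by (intro divide_left_mono mult_pos_pos zero_less_power) auto
  then have rho: "\<rho> \<le> (\<epsilon> / q) ^ 40"
    by (simp add: \<rho>_def assms(1) power_divide)
  have rho0: "0 \<le> \<rho>"
    by (simp add: \<rho>_def)
  have V: "high_rank_variety s Qs \<rho> \<epsilon>"
  proof
    show "quadratic (Qs i)" if "i < s" for i
      using assms(3) that .
    show "real (card {h. \<forall>x. (\<Sum>i<s. l i * polar (Qs i) h x) = 0}) \<le> \<rho> * real CARD(('p mod_ring)^'d)"
      if "\<exists>i<s. l i \<noteq> 0" for l
      using card_radical_le[OF quadratic_linear_combination[OF assms(3)] _ assms(4)[OF that]] assms(1,2)
      by (simp only: polar_linear_combination \<rho>_def)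
    show "10 * (real CARD('p) ^ s) ^ 20 * \<rho> \<le> \<epsilon>"
    proof -
      have "10 * q ^ 20 * \<rho> \<le> 10 * q ^ 20 * (\<epsilon> / q) ^ 40"
        using rho q1 by (intro mult_left_mono) auto
      also have "\<dots> = 10 * \<epsilon> ^ 40 / q ^ 20"
        using q1 by (simp add: power_divide eval_nat_numeral)
      also have "\<dots> \<le> 10 * \<epsilon> ^ 40 / 1"
        using q1 assms(5) by (intro divide_left_mono) auto
      also have "\<dots> \<le> 10 * \<epsilon> ^ 2"
        using power_decreasing[of 2 40 \<epsilon>] assms(5) eps1 by simp
      also have "\<dots> = (10 * \<epsilon>) * \<epsilon>"
        by (simp add: power2_eq_square)
      also have "\<dots> \<le> 1 * \<epsilon>"
        using eps160 assms(5) by (intro mult_right_mono) auto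
      finally show ?thesis
        by (simp add: q_def)
    qed
    show "10 * (real CARD('p) ^ s) ^ 4 * real CARD('p) * sqrt \<rho> \<le> 1"
    proof -
      have "sqrt \<rho> \<le> sqrt (((\<epsilon> / q) ^ 20)\<^sup>2)"
        using rho by (simp flip: power_mult)
      also have "\<dots> = (\<epsilon> / q) ^ 20"
        using q1 assms(5) by (subst real_sqrt_abs) simp
      finally have "10 * q ^ 4 * real p * sqrt \<rho> \<le> 10 * q ^ 4 * real p * (\<epsilon> / q) ^ 20"
        using q1 by (intro mult_left_mono) auto
      also have "\<dots> = 10 * real p * \<epsilon> ^ 20 / q ^ 16"
        using q1 by (simp add: power_divide eval_nat_numeral)
      also have "\<dots> \<le> 10 * real p * \<epsilon> ^ 20 / 1"
        using q1 assms(5) by (intro divide_left_mono) auto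
      also have "\<dots> \<le> 10 * real p * \<epsilon>"
        using power_decreasing[of 1 20 \<epsilon>] assms(5) eps1 by (simp add: mult_left_mono)
      also have "\<dots> \<le> \<epsilon> * (2 ^ 160 * real p)"
        using assms(5) by (simp add: mult_ac)
      finally have "10 * q ^ 4 * real p * sqrt \<rho> \<le> 1"
        using eps_p by linarith
      then show ?thesis
        unfolding q_def assms(1) .
    qed
    show "\<epsilon> < 1 / 2 ^ 100"
      using eps160 by (rule less_trans) simp
  qed (use assms(1,2,5) rho0 in auto)
  interpret V: high_rank_variety s Qs \<rho> \<epsilon> "real CARD(('p mod_ring)^'d)" "real CARD('p) ^ s"
    by (rule V) simp_all
  have Z: "common_zeros s Qs = V.Z"
    by (simp add: common_zeros_def V.Z_def)
  obtain F where F: "quadratic F" and "real (card {x \<in> V.Z. \<psi> x \<noteq> F x}) \<le> 2 ^ 21 * \<epsilon> * real (card V.Z)"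
    using V.agrees_with_quadratic[of \<psi>] assms(8) unfolding Z by blast
  moreover have "card V.Z = card ({x \<in> V.Z. \<psi> x = F x} \<union> {x \<in> V.Z. \<psi> x \<noteq> F x})"
    by (rule arg_cong[of _ _ card]) auto
  then have "card V.Z = card {x \<in> V.Z. \<psi> x = F x} + card {x \<in> V.Z. \<psi> x \<noteq> F x}"
    by (subst (asm) card_Un_disjoint) auto
  ultimately have "(1 - 2 ^ 21 * \<epsilon>) * real (card V.Z) \<le> real (card {x \<in> V.Z. \<psi> x = F x})"
    by (simp add: algebra_simps)
  moreover have "real (card V.Z) > 0"
  proof (rule zero_less_mult_pos)
    show "0 < real CARD('p) ^ s * real (card V.Z)"
      using V.card_Z_bounds(1) V.N_pos by linarith
  qed simp
  ultimately have "1 - 2 ^ 21 * \<epsilon> \<le> proportion V.Z (\<lambda>x. \<psi> x = F x)"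
    unfolding proportion_def by (simp only: pos_le_divide_eq)
  moreover have "2 ^ 21 * \<epsilon> \<le> 2 ^ 10 * root 16 \<epsilon>"
  proof -
    define r where "r = root 16 \<epsilon>"
    have r0: "r \<ge> 0" and r: "r ^ 16 = \<epsilon>"
      using assms(5) by (simp_all add: r_def)
    have "r ^ 16 \<le> (1 / 2 ^ 10) ^ 16"
      using eps160 unfolding r by (simp add: power_divide flip: power_mult)
    then have r1: "r \<le> 1 / 2 ^ 10"
      using r0 by (simp add: power_mono_iff)
    \<comment> \<open>Since \<open>r \<le> 2\<^sup>-\<^sup>1\<^sup>0\<close>, the factor \<open>r ^ 15\<close> absorbs the constant.\<close>
    have "2 ^ 21 * \<epsilon> = 2 ^ 21 * r ^ 15 * r"
      unfolding r[symmetric] by (simp add: eval_nat_numeral)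
    also have "\<dots> \<le> 2 ^ 21 * (1 / 2 ^ 10) ^ 15 * r"
      using r0 r1 by (intro mult_right_mono mult_left_mono power_mono) auto
    also have "\<dots> \<le> 2 ^ 10 * r"
      using r0 by (intro mult_right_mono) (simp_all add: power_divide)
    finally show ?thesis
      by (simp add: r_def)
  qed
  ultimately have "proportion V.Z (\<lambda>x. \<psi> x = F x) \<ge> 1 - 2 ^ 10 * root 16 \<epsilon>"
    by linarith
  with F show ?thesis
    unfolding Z by blast
qed

end
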